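(* Let $d=2$, $r>0$, $\mathcal{K}$ a compact subset of $\mathbb{R}^+\setminus\{0\}$ such that $\alpha>r$ for all $\alpha\in\mathcal{K}$, and $\Theta$ a bounded open subset of $\mathbb{R}$. For $\alpha\in\mathcal{K}$, $\theta\in\Theta$, $\Lambda\in\mathcal{B}(\mathbb{R}^d)$, $\gamma\in\mathcal{M}(\mathbb{R}^d)$, define (hardcore Delaunay tessellations model) $$H^{\alpha,\theta}_\Lambda(\gamma)=\sum_{T\in Del(\gamma),\ B(T)\cap\Lambda\neq\emptyset}\varphi(T),\qquad \varphi(T)=\begin{cases}+\infty,&\text{if }R(T)\ge\alpha,\\+\infty,&\text{if }l(T)\le r,\\\theta\,Per(T),&\text{otherwise.}\end{cases}$$ Let $(\alpha^*,\theta^* )\in\mathcal{K}\times\Theta$ and let $\mu^{\alpha^*,\theta^*}$ be a stationary Gibbs measure for $(H^{\alpha^*,\theta^*}_\Lambda)$. Then the following properties hold. (S1) For all $\gamma\in\mathcal{M}(\mathbb{R}^d)$, $\alpha\in\mathcal{K}$, $\theta,\theta'\in\Theta$, $\Lambda\in\mathcal{B}(\mathbb{R}^d)$: $H^{\alpha,\theta}_\Lambda(\gamma)<\infty\iff H^{\alpha,\theta'}_\Lambda(\gamma)<\infty$. (S2) For all $\gamma\in\mathcal{M}(\mathbb{R}^d)$, $\alpha\le\alpha'$, $\theta\in\Theta$, $\Lambda\in\mathcal{B}(\mathbb{R}^d)$: $H^{\alpha,\theta}_\Lambda(\gamma)<\infty\Rightarrow H^{\alpha',\theta}_\Lambda(\gamma)<\infty$.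 (S3) For every $\alpha<\alpha^*$ there is $R_\alpha>0$ such that every stationary Gibbs measure $\mu$ for $(H^{\alpha^*,\theta^*}_\Lambda)$ satisfies $\mu(H^{\alpha,\theta^*}_{B(0,R_\alpha)}(\gamma)=+\infty)>0$. (S4) For all $\gamma\in\mathcal{M}(\mathbb{R}^d)$, $\Lambda\in\mathcal{B}(\mathbb{R}^d)$, $\theta\in\Theta$ and $\alpha'$ with $H^{\alpha',\theta}_\Lambda(\gamma)<+\infty$, there is $\alpha<\alpha'$ with $H^{\alpha,\theta}_\Lambda(\gamma)<+\infty$. (H2) For all $(\alpha,\theta)$, $h^{\alpha,\theta}(x+y,\gamma_y)=h^{\alpha,\theta}(x,\gamma)$ for all $x,y\in\mathbb{R}^d$ and all $\gamma$ for which the local energy is defined, where $\gamma_y$ is $\gamma$ translated by $y$. (H3) There is $K\ge0$ such that $h^{\alpha,\theta}(x,\gamma)\ge-K$ for all $(\alpha,\theta)\in\mathcal{K}\times\Theta$, $\gamma\in\mathcal{M}^\alpha_\infty(\mathbb{R}^d)$, $x\in\mathbb{R}^d$. (H4) For all $\theta\in\Theta$, $h^{\alpha^*,\theta}(0,\cdot)\exp(-h^{\alpha^*,\theta^*}(0,\cdot))\in L^1(\mu^{\alpha^*,\theta^*})$, with the convention $\infty e^{-\infty}=0$. (H5) For all $\theta\in\Theta\setminus\{\theta^*\}$, $\mu^{\alpha^*,\theta^*}(h^{\alpha^*,\theta^*}(0,\cdot)\ne h^{\alpha^*,\theta}(0,\cdot))>0$. (H6$'$) There are a real function $\delta$ with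 $\delta(x)\to0$ as $x\to0$ and $g\in L^1(\mu^{\alpha^*,\theta^*})$ such that, for $\mu^{\alpha^*,\theta^*}$-a.e. $\gamma\in\mathcal{M}^{\alpha^*}_\infty(\mathbb{R}^d)$, all $\alpha\le\alpha^*$ in $\mathcal{K}$ and all $(\theta,\theta')\in\Theta^2$: if $0\in\mathcal{R}^\alpha(\gamma+\delta_0)$ and $h^{\alpha,\theta}(0,\gamma)<\infty$, then $|h^{\alpha,\theta}(0,\gamma)-h^{\alpha^*,\theta'}(0,\gamma)|\le g(\gamma)[\delta(|\alpha-\alpha^*|)+\delta(|\theta-\theta'|)]$.
   Context: Delaunay notions: for $\gamma\in\mathcal{M}(\mathbb{R}^d)$ ($d=2$), a subset $T$ of three points of $\gamma$ is a Delaunay triangle if its open circumscribed ball $B(T)$ contains no point of $\gamma$; $Del(\gamma)$ is the set of Delaunay triangles. $R(T)$ is the radius of $B(T)$, $l(T)$ the smallest length of the sides of $T$, $Per(T)$ the perimeter of $T$. $\mathcal{B}(\mathbb{R}^d)$: bounded Borel sets of $\mathbb{R}^d$; $\lambda$: Lebesgue measure; $B(x,r)$: open ball. $\mathcal{M}(\mathbb{R}^d)$: simple integer-valued measures $\gamma$ on $\mathbb{R}^d$ ($\gamma(\Lambda)\in\mathbb{N}$ for $\Lambda\in\mathcal{B}(\mathbb{R}^d)$, $\gamma(\{x\})\le1$), with the $\sigma$-algebra generated by the counts $\gamma(\Lambda)$. $x\in\gamma$ means $\gamma(\{x\})>0$; $\gamma_\Lambda=\sum_{x\in\gamma\cap\Lambda}\delta_x$.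 $\pi_\Lambda$: Poisson process on $\Lambda$ with intensity $\mathbf{1}_\Lambda\lambda$. Sums containing a $+\infty$ term equal $+\infty$. For a family of energies $(H_\Lambda)_{\Lambda\in\mathcal{B}(\mathbb{R}^d)}$ (satisfying $H_{\Lambda'}(\gamma)=H_\Lambda(\gamma)+\varphi_{\Lambda,\Lambda'}(\gamma_{\Lambda^c})$ for $\Lambda\subset\Lambda'$, for some measurable $\varphi_{\Lambda,\Lambda'}$): $\mathcal{M}_\infty(\mathbb{R}^d)$ is the set of $\gamma$ with $H_\Lambda(\gamma)<+\infty$ for all $\Lambda\in\mathcal{B}(\mathbb{R}^d)$. A point $x\in\gamma$ is removable from $\gamma$ if some $\Lambda\in\mathcal{B}(\mathbb{R}^d)$ satisfies $x\in\Lambda$, $H_\Lambda(\gamma-\delta_x)<+\infty$; $\mathcal{R}(\gamma)$ is the set of removable points, and for $x\in\mathcal{R}(\gamma)$ the local energy is $h(x,\gamma-\delta_x)=H_\Lambda(\gamma)-H_\Lambda(\gamma-\delta_x)\in\mathbb{R}\cup\{+\infty\}$ for any such $\Lambda$ (independent of the choice). So $h(x,\gamma)$ is defined whenever $x\in\mathcal{R}(\gamma+\delta_x)$, in particular for $\gamma\in\mathcal{M}_\infty(\mathbb{R}^d)$. For $(H^{\alpha,\theta}_\Lambda)$, where by (S1) they depend only on $\alpha$, the first two objects are written $\mathcal{M}^\alpha_\infty(\mathbb{R}^d)$, $\mathcal{R}^\alpha(\gamma)$; the local energy is written $h^{\alpha,\theta}$. A probability measure $\mu$ on $\mathcal{M}(\mathbb{R}^d)$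 is a Gibbs measure for $(H_\Lambda)$ if $\int f\,\mathrm{d}\mu=\int\int_{\mathcal{M}(\Lambda)}f(\gamma'_\Lambda+\gamma_{\Lambda^c})\frac{e^{-H_\Lambda(\gamma'_\Lambda+\gamma_{\Lambda^c})}}{Z_\Lambda(\gamma_{\Lambda^c})}\pi_\Lambda(\mathrm{d}\gamma'_\Lambda)\mu(\mathrm{d}\gamma)$ for all $\Lambda\in\mathcal{B}(\mathbb{R}^d)$ and bounded measurable $f$, where $Z_\Lambda(\gamma_{\Lambda^c})=\int_{\mathcal{M}(\Lambda)}e^{-H_\Lambda(\gamma'_\Lambda+\gamma_{\Lambda^c})}\pi_\Lambda(\mathrm{d}\gamma'_\Lambda)$ is assumed in $(0,+\infty)$ for $\gamma\in\mathcal{M}_\infty(\mathbb{R}^d)$. Stationary: translation invariant. The parameters $\alpha,\alpha'$ range over $\mathcal{K}$, except that in (S4) the value $\alpha<\alpha'$ is any positive real, the energy being given by the same formula. *)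

theory Defs
  imports "HOL-Probability.Probability"
begin

section \<open>Point configurations\<close>

definition bounded_borel :: "'a::euclidean_space set set" where
  "bounded_borel = {\<Lambda> \<in> sets borel. bounded \<Lambda>}"

definition configurations :: "'a::euclidean_space measure set" where
  "configurations = {\<gamma>. sets \<gamma> = sets borel
      \<and> (\<forall>\<Lambda>\<in>bounded_borel. emeasure \<gamma> \<Lambda> \<in> range of_nat)
      \<and> (\<forall>x. emeasure \<gamma> {x} \<le> 1)}"

text \<open>The measurable space of configurations: the sigma-algebra is generated by the counts.\<close>

definition conf :: "'a::euclidean_space measure measure" where
  "conf = sigma configurations
     {{\<gamma> \<in> configurations. emeasure \<gamma> \<Lambda> \<in> A} | \<Lambda> A. \<Lambda> \<in> bounded_borel \<and> A \<in> sets borel}"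

definition points :: "'a::euclidean_space measure \<Rightarrow> 'a set" where
  "points \<gamma> = {x. emeasure \<gamma> {x} > 0}"

definition add_measure :: "'a measure \<Rightarrow> 'a measure \<Rightarrow> 'a measure" where
  "add_measure \<gamma> \<gamma>' = measure_of (space \<gamma>) (sets \<gamma>) (\<lambda>A. emeasure \<gamma> A + emeasure \<gamma>' A)"

definition add_point :: "'a::euclidean_space measure \<Rightarrow> 'a \<Rightarrow> 'a measure" where
  "add_point \<gamma> x = add_measure \<gamma> (return borel x)"

definition remove_point :: "'a::euclidean_space measure \<Rightarrow> 'a \<Rightarrow> 'a measure" where
  "remove_point \<gamma> x = diff_measure \<gamma> (return borel x)"

definition restrict_conf :: "'a::euclidean_space measure \<Rightarrow> 'a set \<Rightarrow> 'a measure" where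
  "restrict_conf \<gamma> \<Lambda> = density \<gamma> (indicator \<Lambda>)"

text \<open>\<open>glue \<Lambda> \<gamma>' \<gamma>\<close> agrees with \<open>\<gamma>'\<close> in \<open>\<Lambda>\<close> and with \<open>\<gamma>\<close> outside \<open>\<Lambda>\<close>.\<close>

definition glue ::
    "'a::euclidean_space set \<Rightarrow> 'a measure \<Rightarrow> 'a measure \<Rightarrow> 'a measure" where
  "glue \<Lambda> \<gamma>' \<gamma> = add_measure (restrict_conf \<gamma>' \<Lambda>) (restrict_conf \<gamma> (- \<Lambda>))"

definition translate :: "'a::euclidean_space measure \<Rightarrow> 'a \<Rightarrow> 'a measure" where
  "translate \<gamma> y = distr \<gamma> borel (\<lambda>x. x + y)"

definition stationary :: "'a::euclidean_space measure measure \<Rightarrow> bool" where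
  "stationary \<mu> \<longleftrightarrow> (\<forall>y. distr \<mu> conf (\<lambda>\<gamma>. translate \<gamma> y) = \<mu>)"

text \<open>\<open>P\<close> is the law of a Poisson process with intensity the Lebesgue measure restricted to \<open>\<Lambda>\<close>,
  seen as a law on all configurations (the count outside \<open>\<Lambda>\<close> is almost surely zero).
  Note \<open>0 ^ 0 = 1\<close> in the case where \<open>B \<inter> \<Lambda>\<close> is a null set.\<close>

definition poisson_process ::
    "'a::euclidean_space set \<Rightarrow> 'a measure measure \<Rightarrow> bool" where
  "poisson_process \<Lambda> P \<longleftrightarrow>
     prob_space P \<and> sets P = sets conf
     \<and> (\<forall>B\<in>bounded_borel. \<forall>n::nat.
          measure P {\<gamma> \<in> space P. emeasure \<gamma> B = of_nat n}
            = exp (- measure lborel (B \<inter> \<Lambda>)) * measure lborel (B \<inter> \<Lambda>) ^ n / fact n)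
     \<and> (\<forall>(I :: nat set) B. finite I \<and> disjoint_family_on B I \<and> B ` I \<subseteq> bounded_borel
          \<longrightarrow> prob_space.indep_vars P (\<lambda>_. borel) (\<lambda>i \<gamma>. emeasure \<gamma> (B i)) I)"


section \<open>Gibbs measures and local energies for a family of energies\<close>

type_synonym 'a energy = "'a set \<Rightarrow> 'a measure \<Rightarrow> ereal"

text \<open>\<open>boltzmann e\<close> is \<open>exp (- e)\<close> for energies \<open>e\<close> with values in \<open>(-\<infinity>, \<infinity>]\<close>.\<close>

definition boltzmann :: "ereal \<Rightarrow> real" where
  "boltzmann e = (if e = \<infinity> then 0 else exp (- real_of_ereal e))"

definition partition_fun ::
    "'a::euclidean_space energy \<Rightarrow> 'a set \<Rightarrow> 'a measure measure \<Rightarrow> 'a measure \<Rightarrow> ennreal" where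
  "partition_fun H \<Lambda> \<pi> \<gamma> = (\<integral>\<^sup>+ \<gamma>'. ennreal (boltzmann (H \<Lambda> (glue \<Lambda> \<gamma>' \<gamma>))) \<partial>\<pi>)"

text \<open>The Poisson law \<open>\<pi>\<close> is determined by \<open>\<Lambda>\<close>; the existential quantifier only names it.
  The partition function has to lie in \<open>(0, \<infinity>)\<close> for almost every boundary condition only. This is
  what the equation itself forces, by taking \<open>f = 1\<close>. Asking for it at every configuration of finite
  energy would be unsatisfiable for non-hereditary energies: if \<open>\<Lambda> = {x}\<close> and \<open>x\<close> is a
  non-removable point of \<open>\<gamma>\<close>, the partition function vanishes at \<open>\<gamma>\<close>.\<close>

definition gibbs_measure ::
    "'a::euclidean_space energy \<Rightarrow> 'a measure measure \<Rightarrow> bool" where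
  "gibbs_measure H \<mu> \<longleftrightarrow>
     prob_space \<mu> \<and> sets \<mu> = sets conf
     \<and> (\<forall>\<Lambda>\<in>bounded_borel. \<exists>\<pi>. poisson_process \<Lambda> \<pi>
          \<and> (AE \<gamma> in \<mu>. 0 < partition_fun H \<Lambda> \<pi> \<gamma> \<and> partition_fun H \<Lambda> \<pi> \<gamma> < \<infinity>)
          \<and> (\<forall>f :: 'a measure \<Rightarrow> real.
               f \<in> borel_measurable conf \<and> bounded (f ` space conf) \<longrightarrow>
               (\<integral>\<gamma>. f \<gamma> \<partial>\<mu>)
                 = (\<integral>\<gamma>. (\<integral>\<gamma>'. f (glue \<Lambda> \<gamma>' \<gamma>)
                       * (boltzmann (H \<Lambda> (glue \<Lambda> \<gamma>' \<gamma>)) / enn2real (partition_fun H \<Lambda> \<pi> \<gamma>)) \<partial>\<pi>) \<partial>\<mu>)))"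

definition finite_energy :: "'a::euclidean_space energy \<Rightarrow> 'a measure set" where
  "finite_energy H = {\<gamma> \<in> configurations. \<forall>\<Lambda>\<in>bounded_borel. H \<Lambda> \<gamma> < \<infinity>}"

definition removable :: "'a::euclidean_space energy \<Rightarrow> 'a measure \<Rightarrow> 'a set" where
  "removable H \<gamma> = {x \<in> points \<gamma>. \<gamma> \<in> configurations
      \<and> (\<exists>\<Lambda>\<in>bounded_borel. x \<in> \<Lambda> \<and> H \<Lambda> (remove_point \<gamma> x) < \<infinity>)}"

text \<open>The sets \<open>\<Lambda>\<close> through which the energy of adding \<open>x\<close> to \<open>\<gamma>\<close> may be evaluated.\<close>

definition admissible :: "'a::euclidean_space energy \<Rightarrow> 'a \<Rightarrow> 'a measure \<Rightarrow> 'a set set" where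
  "admissible H x \<gamma> = {\<Lambda> \<in> bounded_borel. x \<in> \<Lambda> \<and> H \<Lambda> \<gamma> < \<infinity>}"

text \<open>The local energy is the common value of \<open>H \<Lambda> (\<gamma> + \<delta>\<^sub>x) - H \<Lambda> \<gamma>\<close> over admissible \<open>\<Lambda>\<close>. For the
  Delaunay energies below this value is not literally the same for very small \<open>\<Lambda>\<close>: with
  \<open>\<Lambda> = {x}\<close> no Delaunay triangle of \<open>\<gamma> + \<delta>\<^sub>x\<close> is counted, since its open ball avoids \<open>x\<close>.
  Hence the common value is taken over all sufficiently large admissible \<open>\<Lambda>\<close>; the admissible
  sets are closed under finite unions, so there is at most one such value.
  It is meaningful if \<open>x \<in> removable H (add_point \<gamma> x)\<close>.\<close>

definition local_energy :: "'a::euclidean_space energy \<Rightarrow> 'a \<Rightarrow> 'a measure \<Rightarrow> ereal" where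
  "local_energy H x \<gamma> = (THE e. \<exists>\<Lambda>\<^sub>0\<in>admissible H x \<gamma>. \<forall>\<Lambda>\<in>admissible H x \<gamma>.
      \<Lambda>\<^sub>0 \<subseteq> \<Lambda> \<longrightarrow> e = H \<Lambda> (add_point \<gamma> x) - H \<Lambda> \<gamma>)"

text \<open>Membership in \<open>L\<^sup>1(\<mu>)\<close> of a function that is only defined almost everywhere: the completion
  makes its values on null sets irrelevant.\<close>

definition in_L1 :: "'b measure \<Rightarrow> ('b \<Rightarrow> ereal) \<Rightarrow> bool" where
  "in_L1 \<mu> f \<longleftrightarrow> (AE \<omega> in \<mu>. \<bar>f \<omega>\<bar> \<noteq> \<infinity>) \<and> integrable (completion \<mu>) (\<lambda>\<omega>. real_of_ereal (f \<omega>))"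


section \<open>The hardcore Delaunay model\<close>

text \<open>Three distinct collinear points have no circumscribed circle, so the following
  are used for non-collinear \<open>T\<close> only.\<close>

definition circumcenter :: "(real^2) set \<Rightarrow> real^2" where
  "circumcenter T = (THE c. \<exists>\<rho>. T \<subseteq> sphere c \<rho>)"

definition circumradius :: "(real^2) set \<Rightarrow> real" where
  "circumradius T = (THE \<rho>. \<exists>c. T \<subseteq> sphere c \<rho>)"

definition circumball :: "(real^2) set \<Rightarrow> (real^2) set" where
  "circumball T = ball (circumcenter T) (circumradius T)"

definition min_side :: "(real^2) set \<Rightarrow> real" where
  "min_side T = Min {dist x y | x y. x \<in> T \<and> y \<in> T \<and> x \<noteq> y}"

text \<open>Each side occurs twice in the double sum.\<close>

definition perimeter :: "(real^2) set \<Rightarrow> real" where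
  "perimeter T = (\<Sum>x\<in>T. \<Sum>y\<in>T. dist x y) / 2"

definition delaunay :: "(real^2) measure \<Rightarrow> (real^2) set set" where
  "delaunay \<gamma> = {T. T \<subseteq> points \<gamma> \<and> card T = 3 \<and> \<not> collinear T \<and> circumball T \<inter> points \<gamma> = {}}"

definition triangle_energy :: "real \<Rightarrow> real \<Rightarrow> real \<Rightarrow> (real^2) set \<Rightarrow> ereal" where
  "triangle_energy r \<alpha> \<theta> T =
     (if circumradius T \<ge> \<alpha> then \<infinity>
      else if min_side T \<le> r then \<infinity>
      else ereal (\<theta> * perimeter T))"

text \<open>A sum containing an infinite term is infinite. Otherwise all the triangles involved have
  radius less than \<open>\<alpha>\<close> and a ball meeting the bounded set \<open>\<Lambda>\<close>, so the sum is finite.\<close>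

definition delaunay_energy :: "real \<Rightarrow> real \<Rightarrow> real \<Rightarrow> (real^2) energy" where
  "delaunay_energy r \<alpha> \<theta> \<Lambda> \<gamma> =
     (let D = {T \<in> delaunay \<gamma>. circumball T \<inter> \<Lambda> \<noteq> {}} in
      if \<exists>T\<in>D. triangle_energy r \<alpha> \<theta> T = \<infinity> then \<infinity>
      else (\<Sum>T\<in>D. triangle_energy r \<alpha> \<theta> T))"

abbreviation delaunay_local_energy :: "real \<Rightarrow> real \<Rightarrow> real \<Rightarrow> real^2 \<Rightarrow> (real^2) measure \<Rightarrow> ereal" where
  "delaunay_local_energy r \<alpha> \<theta> \<equiv> local_energy (delaunay_energy r \<alpha> \<theta>)"

end

theory Submission
  imports Defs
begin

text \<open>
  Write \<open>P\<close> for the point set of a configuration. In the lifted picture a Delaunay disc is a vertex of a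
  concave piecewise affine function, so if \<open>P\<close> is not contained in a half-plane, every empty disc gives a
  Delaunay disc at least as large. Hence for stationary \<open>\<mu>\<close> the configurations of finite energy are, almost
  surely, those which are \<open>r\<close>-separated and whose balls of radius \<open>\<alpha>\<close> cover the plane. Such a
  configuration can be modified in a disc so as to leave a smaller disc of any radius below \<open>\<alpha>\<close> empty,
  robustly under small perturbations; by the Gibbs property empty discs of all these radii have positive
  probability, which is (S3).

  Adding a point \<open>x\<close> changes the energy by \<open>\<theta> D(x)\<close>, where \<open>D(x)\<close> is the perimeter of the new triangles minus that of
  the destroyed ones. Only boundedly many triangles are involved, which gives (H3), (H4) and (H6'). For (H5),
  if \<open>D(0)\<close> vanished almost surely, then \<open>D\<close> would vanish at infinitely many points of a segment in a
  large empty disc; infinitely many of them have the same combinatorics, where \<open>D\<close> is a strictly convex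
  sum of distances.
\<close>

section \<open>Configurations as locally finite point sets\<close>

text \<open>The energy is not hereditary: deleting a point can make it infinite, so configurations
  cannot be handled by removing points one by one. A whole disc is resampled instead. By the Gibbs
  equation a null event is entered only through resamplings of infinite energy; hence an event has
  positive probability if, for almost every boundary condition, resamplings of finite energy enter
  it with positive Poisson probability. The emptied disc is refilled with points that are
  \<open>s\<close>-separated from each other and leave no hole of radius above \<open>s\<close>,
  where \<open>r < s < \<alpha>\<close>; this is where \<open>\<alpha> > r\<close> enters. The
  strict inequalities leave room to move the new points, whereas exact positions would be a Poisson
  null event.

  Configurations in a half-plane can satisfy the hard constraints without covering the plane.
  Stationarity makes the probability of an empty quadrant independent of its apex, which reduces
  their exclusion to that of the empty configuration; there a single point can be thrown in without
  creating a triangle.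

  The local energy is a definite description that agrees only almost surely with a measurable
  function, hence the completions.\<close>

lemma
  assumes "\<gamma> \<in> configurations"
  shows sets_configuration: "sets \<gamma> = sets borel"
    and space_configuration: "space \<gamma> = UNIV"
proof -
  show "sets \<gamma> = sets borel" using assms by (simp add: configurations_def)
  from sets_eq_imp_space_eq[OF this] show "space \<gamma> = UNIV" by simp
qed

lemma configuration_count:
  assumes "\<gamma> \<in> configurations" "\<Lambda> \<in> bounded_borel"
  obtains n :: nat where "emeasure \<gamma> \<Lambda> = of_nat n"
  using assms by (auto simp: configurations_def)

lemma singleton_bounded_borel [simp]: "{x} \<in> bounded_borel"
  by (simp add: bounded_borel_def)

lemma ball_bounded_borel [simp]: "ball x e \<in> bounded_borel"
  by (simp add: bounded_borel_def)

lemma emeasure_point: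
  assumes "\<gamma> \<in> configurations"
  shows "emeasure \<gamma> {x} = indicator (points \<gamma>) x"
proof -
  obtain n :: nat where n: "emeasure \<gamma> {x} = of_nat n"
    using configuration_count[OF assms singleton_bounded_borel] .
  have "emeasure \<gamma> {x} \<le> 1" using assms by (auto simp: configurations_def)
  then have "n \<le> 1"
    by (metis n of_nat_1 of_nat_le_iff)
  then consider "n = 0" | "n = 1" by linarith
  then show ?thesis by cases (auto simp: n points_def)
qed

lemma finite_points:
  fixes B :: "'a::euclidean_space set"
  assumes "\<gamma> \<in> configurations" "bounded B"
  shows "finite (points \<gamma> \<inter> B)"
proof (rule ccontr)
  assume inf: "infinite (points \<gamma> \<inter> B)"
  obtain e where e: "B \<subseteq> ball 0 e"
    using assms(2) bounded_subset_ballD by blast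
  obtain n :: nat where n: "emeasure \<gamma> (ball 0 e) = of_nat n"
    using configuration_count[OF assms(1) ball_bounded_borel] .
  obtain S where S: "S \<subseteq> points \<gamma> \<inter> B" "finite S" "card S = Suc n"
    using infinite_arbitrarily_large[OF inf] by metis
  have "of_nat (Suc n) = (\<Sum>x\<in>S. emeasure \<gamma> {x})"
    using S by (simp add: emeasure_point[OF assms(1)] subset_iff)
  also have "\<dots> = emeasure \<gamma> S"
    using S by (intro emeasure_eq_sum_singleton[symmetric])
      (auto simp: sets_configuration[OF assms(1)])
  also have "\<dots> \<le> emeasure \<gamma> (ball 0 e)"
    using S e by (intro emeasure_mono) (auto simp: sets_configuration[OF assms(1)])
  finally have "(of_nat (Suc n) :: ennreal) \<le> of_nat n" by (simp only: n)
  then show False unfolding of_nat_le_iff by simp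
qed

lemma countable_points:
  assumes "\<gamma> \<in> configurations"
  shows "countable (points \<gamma>)"
proof -
  have "points \<gamma> = (\<Union>n::nat. points \<gamma> \<inter> ball 0 (real n))"
    by (auto simp: reals_Archimedean2)
  moreover have "countable (\<Union>n::nat. points \<gamma> \<inter> ball 0 (real n))"
    by (rule countable_UN) (auto intro: countable_finite finite_points assms)
  ultimately show ?thesis by (rule ssubst)
qed

lemma points_borel [simp]: "\<gamma> \<in> configurations \<Longrightarrow> points \<gamma> \<in> sets borel"
  using countable_points by (rule sets.countable[rotated]) auto

text \<open>The counts of shrinking balls decrease to the count of \<open>{x}\<close>, which is 0;
  being natural numbers, they reach 0 after finitely many steps.\<close>

lemma null_neighbourhood:
  fixes x :: "'a::euclidean_space"
  assumes "\<gamma> \<in> configurations" "x \<notin> points \<gamma>"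
  shows "\<exists>e>0. emeasure \<gamma> (ball x e) = 0"
proof -
  define B where "B n = ball x (1 / real (Suc n))" for n
  have dec: "decseq B"
    unfolding B_def decseq_def by (intro allI impI subset_ball frac_le) auto
  have Int: "(\<Inter>n. B n) = {x}"
  proof (rule equalityI)
    show "(\<Inter>n. B n) \<subseteq> {x}"
    proof
      fix y assume y: "y \<in> (\<Inter>n. B n)"
      show "y \<in> {x}"
      proof (rule ccontr)
        assume "y \<notin> {x}"
        then obtain n where n: "inverse (real (Suc n)) < dist x y"
          using reals_Archimedean[of "dist x y"] by auto
        from y have "y \<in> B n" by (rule INT_D) simp
        with n show False unfolding B_def by (simp add: inverse_eq_divide)
      qed
    qed
    show "{x} \<subseteq> (\<Inter>n. B n)" unfolding B_def by simp
  qed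
  have fin: "emeasure \<gamma> (B n) \<noteq> \<infinity>" for n
  proof -
    obtain k :: nat where "emeasure \<gamma> (B n) = of_nat k"
      using configuration_count[OF assms(1) ball_bounded_borel] unfolding B_def .
    then show ?thesis by simp
  qed
  have "(\<lambda>n. emeasure \<gamma> (B n)) \<longlonglongrightarrow> emeasure \<gamma> (\<Inter>n. B n)"
    using fin by (intro Lim_emeasure_decseq dec) (auto simp: B_def sets_configuration[OF assms(1)])
  then have "(\<lambda>n. emeasure \<gamma> (B n)) \<longlonglongrightarrow> 0"
    using assms by (simp add: Int emeasure_point)
  then have "eventually (\<lambda>n. emeasure \<gamma> (B n) < 1) sequentially"
    by (rule order_tendstoD) simp
  then obtain n where n: "emeasure \<gamma> (B n) < 1" by (auto simp: eventually_sequentially)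
  obtain k :: nat where "emeasure \<gamma> (B n) = of_nat k"
    using configuration_count[OF assms(1) ball_bounded_borel] unfolding B_def .
  with n have "emeasure \<gamma> (B n) = 0" by (cases k) auto
  then show ?thesis unfolding B_def by (intro exI[of _ "1 / real (Suc n)"]) auto
qed

text \<open>The complement is uncountable, so its null balls can be summed only after Lindelof's
  theorem has selected countably many of them.\<close>

lemma emeasure_Compl_points:
  assumes "\<gamma> \<in> configurations"
  shows "emeasure \<gamma> (- points \<gamma>) = 0"
proof -
  define F where "F = {ball x e | x e. x \<notin> points \<gamma> \<and> emeasure \<gamma> (ball x e) = 0}"
  have "\<And>S. S \<in> F \<Longrightarrow> open S" by (auto simp: F_def)
  then obtain F' where F': "F' \<subseteq> F" "countable F'" "\<Union>F' = \<Union>F"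
    by (rule Lindelof)
  have "emeasure \<gamma> (\<Union>F') = 0"
  proof -
    have "(\<Union>X\<in>F'. X) \<in> null_sets \<gamma>"
      using F' by (intro null_sets_UN' ) (auto simp: F_def null_sets_def sets_configuration[OF assms])
    then show ?thesis by auto
  qed
  moreover have "- points \<gamma> \<subseteq> \<Union>F'"
  proof
    fix x assume "x \<in> - points \<gamma>"
    then obtain e where "e > 0" "emeasure \<gamma> (ball x e) = 0"
      using null_neighbourhood[OF assms] by auto
    then show "x \<in> \<Union>F'" using \<open>x \<in> - points \<gamma>\<close> unfolding F'(3)
      by (intro UnionI[of "ball x e"]) (auto simp: F_def)
  qed
  moreover have "\<Union>F' \<in> sets \<gamma>"
    using F' \<open>\<And>S. S \<in> F \<Longrightarrow> open S\<close> by (auto simp: sets_configuration[OF assms] intro!: borel_open)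
  ultimately show ?thesis
    by (metis emeasure_mono le_zero_eq)
qed

text \<open>Identifies a configuration with the counting measure of its point set, so that the
  geometry can be done with sets.\<close>

lemma emeasure_configuration:
  assumes "\<gamma> \<in> configurations" "A \<in> sets borel"
  shows "emeasure \<gamma> A = emeasure (count_space UNIV) (A \<inter> points \<gamma>)"
proof -
  note s = sets_configuration[OF assms(1)]
  have "emeasure \<gamma> A = emeasure \<gamma> ((A \<inter> points \<gamma>) \<union> (A - points \<gamma>))"
    by (rule arg_cong[where f = "emeasure \<gamma>"]) auto
  also have "\<dots> = emeasure \<gamma> (A \<inter> points \<gamma>) + emeasure \<gamma> (A - points \<gamma>)"
    by (rule plus_emeasure[symmetric]) (use assms in \<open>auto simp: s\<close>)
  also have "emeasure \<gamma> (A - points \<gamma>) = 0"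
  proof -
    have "emeasure \<gamma> (A - points \<gamma>) \<le> emeasure \<gamma> (- points \<gamma>)"
      using assms by (intro emeasure_mono) (auto simp: s borel_comp)
    then show ?thesis by (simp add: emeasure_Compl_points[OF assms(1)])
  qed
  also have "emeasure \<gamma> (A \<inter> points \<gamma>) = (\<integral>\<^sup>+x. emeasure \<gamma> {x} \<partial>count_space (A \<inter> points \<gamma>))"
    by (rule emeasure_countable_singleton)
       (auto simp: s intro: countable_subset[OF _ countable_points[OF assms(1)]])
  also have "\<dots> = (\<integral>\<^sup>+x. 1 \<partial>count_space (A \<inter> points \<gamma>))"
    by (intro nn_integral_cong) (auto simp: emeasure_point[OF assms(1)])
  also have "\<dots> = emeasure (count_space UNIV) (A \<inter> points \<gamma>)"
    by (simp add: emeasure_count_space)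
  finally show ?thesis by simp
qed

lemma emeasure_configuration_card:
  assumes "\<gamma> \<in> configurations" "A \<in> bounded_borel"
  shows "emeasure \<gamma> A = of_nat (card (points \<gamma> \<inter> A))"
  using assms finite_points[OF assms(1), of A]
  by (auto simp: emeasure_configuration bounded_borel_def Int_commute ennreal_of_nat_eq_real_of_nat)

lemma emeasure_configuration_eq_0_iff:
  assumes "\<gamma> \<in> configurations" "A \<in> sets borel"
  shows "emeasure \<gamma> A = 0 \<longleftrightarrow> points \<gamma> \<inter> A = {}"
  unfolding emeasure_configuration[OF assms] by (subst emeasure_count_space_eq_0) auto

lemma nn_integral_configuration:
  assumes "\<gamma> \<in> configurations" "f \<in> borel_measurable borel"
  shows "(\<integral>\<^sup>+x. f x \<partial>\<gamma>) = (\<integral>\<^sup>+x. f x \<partial>count_space (points \<gamma>))"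
proof -
  have "\<gamma> = distr (count_space (points \<gamma>)) borel (\<lambda>x. x)"
  proof (rule measure_eqI)
    fix A assume "A \<in> sets \<gamma>"
    then have A: "A \<in> sets borel" by (simp add: sets_configuration[OF assms(1)])
    then have "emeasure (distr (count_space (points \<gamma>)) borel (\<lambda>x. x)) A
        = emeasure (count_space (points \<gamma>)) (A \<inter> points \<gamma>)"
      by (simp add: emeasure_distr)
    also have "\<dots> = emeasure (count_space UNIV) (A \<inter> points \<gamma>)"
      by (simp add: emeasure_count_space)
    finally show "emeasure \<gamma> A = emeasure (distr (count_space (points \<gamma>)) borel (\<lambda>x. x)) A"
      using emeasure_configuration[OF assms(1) A] by simp
  qed (simp add: sets_configuration[OF assms(1)])
  then have "(\<integral>\<^sup>+x. f x \<partial>\<gamma>) = (\<integral>\<^sup>+x. f x \<partial>distr (count_space (points \<gamma>)) borel (\<lambda>x. x))"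
    by (rule arg_cong)
  then show ?thesis by (simp add: nn_integral_distr assms)
qed

lemma configurationsI:
  fixes \<gamma> :: "'a::euclidean_space measure"
  assumes "sets \<gamma> = sets borel"
    and "\<And>\<Lambda>. \<Lambda> \<in> bounded_borel \<Longrightarrow> \<exists>n::nat. emeasure \<gamma> \<Lambda> = of_nat n"
    and "\<And>x. emeasure \<gamma> {x} \<le> 1"
  shows "\<gamma> \<in> configurations"
  using assms by (force simp: configurations_def)

lemma
  assumes "sets \<gamma>' = sets \<gamma>"
  shows sets_add_measure: "sets (add_measure \<gamma> \<gamma>') = sets \<gamma>"
    and emeasure_add_measure: "A \<in> sets \<gamma> \<Longrightarrow> emeasure (add_measure \<gamma> \<gamma>') A = emeasure \<gamma> A + emeasure \<gamma>' A"
proof -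
  show "sets (add_measure \<gamma> \<gamma>') = sets \<gamma>"
    by (simp add: add_measure_def)
  assume A: "A \<in> sets \<gamma>"
  show "emeasure (add_measure \<gamma> \<gamma>') A = emeasure \<gamma> A + emeasure \<gamma>' A"
    unfolding add_measure_def
  proof (rule emeasure_measure_of_sigma)
    show "countably_additive (sets \<gamma>) (\<lambda>A. emeasure \<gamma> A + emeasure \<gamma>' A)"
    proof (rule countably_additiveI)
      fix A :: "nat \<Rightarrow> 'a set" assume A: "range A \<subseteq> sets \<gamma>" "disjoint_family A"
      have "(\<Sum>i. emeasure \<gamma> (A i) + emeasure \<gamma>' (A i)) = (\<Sum>i. emeasure \<gamma> (A i)) + (\<Sum>i. emeasure \<gamma>' (A i))"
        by (rule suminf_add[symmetric]) auto
      then show "(\<Sum>i. emeasure \<gamma> (A i) + emeasure \<gamma>' (A i)) = emeasure \<gamma> (\<Union> (range A)) + emeasure \<gamma>' (\<Union> (range A))"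
        using A assms by (simp add: suminf_emeasure)
    qed
  qed (auto simp: A positive_def sets.sigma_algebra_axioms)
qed

lemma
  assumes "\<gamma> \<in> configurations"
  shows sets_add_point: "sets (add_point \<gamma> x) = sets borel"
    and emeasure_add_point: "A \<in> sets borel \<Longrightarrow> emeasure (add_point \<gamma> x) A = emeasure \<gamma> A + indicator A x"
    and points_add_point: "points (add_point \<gamma> x) = insert x (points \<gamma>)"
proof -
  have s: "sets (return borel x) = sets \<gamma>" by (simp add: sets_configuration[OF assms])
  show "sets (add_point \<gamma> x) = sets borel"
    unfolding add_point_def using sets_add_measure[OF s] sets_configuration[OF assms] by simp
  show *: "emeasure (add_point \<gamma> x) A = emeasure \<gamma> A + indicator A x" if "A \<in> sets borel" for A
    unfolding add_point_def using that by (subst emeasure_add_measure[OF s]) (auto simp: sets_configuration[OF assms])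
  show "points (add_point \<gamma> x) = insert x (points \<gamma>)"
    unfolding points_def by (auto simp: * indicator_def add_pos_nonneg add_nonneg_pos split: if_splits)
qed

text \<open>A second copy of an occupied point has mass 2. This is why inserted points are kept
  outside the configuration below.\<close>

lemma add_point_configuration_iff:
  assumes "\<gamma> \<in> configurations"
  shows "add_point \<gamma> x \<in> configurations \<longleftrightarrow> x \<notin> points \<gamma>"
proof
  assume "add_point \<gamma> x \<in> configurations"
  then have "emeasure (add_point \<gamma> x) {x} \<le> 1" by (simp add: configurations_def)
  then have "emeasure \<gamma> {x} + 1 \<le> 1"
    using emeasure_add_point[OF assms, of "{x}" x] by simp
  then show "x \<notin> points \<gamma>" by (auto simp: emeasure_point[OF assms] indicator_def split: if_splits)
next
  assume x: "x \<notin> points \<gamma>"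
  show "add_point \<gamma> x \<in> configurations"
  proof (rule configurationsI)
    show "\<exists>n::nat. emeasure (add_point \<gamma> x) \<Lambda> = of_nat n" if L: "\<Lambda> \<in> bounded_borel" for \<Lambda>
    proof -
      obtain n :: nat where "emeasure \<gamma> \<Lambda> = of_nat n"
        using configuration_count[OF assms L] .
      then have "emeasure (add_point \<gamma> x) \<Lambda> = of_nat (n + (if x \<in> \<Lambda> then 1 else 0))"
        using L by (auto simp: emeasure_add_point[OF assms] bounded_borel_def)
      then show ?thesis by blast
    qed
    show "emeasure (add_point \<gamma> x) {y} \<le> 1" for y
      using x by (auto simp: emeasure_add_point[OF assms] emeasure_point[OF assms] indicator_def)
  qed (simp add: sets_add_point[OF assms])
qed

lemma remove_add_point:
  assumes "\<gamma> \<in> configurations"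
  shows "remove_point (add_point \<gamma> x) x = \<gamma>"
proof -
  have sp: "space (add_point \<gamma> x) = space \<gamma>"
    using sets_eq_imp_space_eq[OF sets_add_point[OF assms, of x]] by (simp add: space_configuration[OF assms])
  have "remove_point (add_point \<gamma> x) x = measure_of (space \<gamma>) (sets \<gamma>) (emeasure \<gamma>)"
    unfolding remove_point_def diff_measure_def sp sets_add_point[OF assms] sets_configuration[OF assms]
  proof (rule measure_of_eq)
    show "sets borel \<subseteq> Pow (space \<gamma>)" by (simp add: space_configuration[OF assms])
    have e: "sigma_sets (space \<gamma>) (sets borel) = sets (borel :: 'a measure)"
      using sets.sigma_sets_eq[of "borel :: 'a measure"] by (simp add: space_configuration[OF assms])
    show "emeasure (add_point \<gamma> x) A - emeasure (return borel x) A = emeasure \<gamma> A"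
      if "A \<in> sigma_sets (space \<gamma>) (sets borel)" for A
      using that unfolding e by (simp add: emeasure_add_point[OF assms] indicator_def)
  qed
  then show ?thesis by (simp add: measure_of_of_measure)
qed

lemma
  assumes "\<gamma> \<in> configurations" "\<gamma>' \<in> configurations" "\<Lambda> \<in> sets borel"
  shows emeasure_glue: "A \<in> sets borel \<Longrightarrow> emeasure (glue \<Lambda> \<gamma>' \<gamma>) A = emeasure \<gamma>' (A \<inter> \<Lambda>) + emeasure \<gamma> (A - \<Lambda>)"
    and points_glue: "points (glue \<Lambda> \<gamma>' \<gamma>) = (points \<gamma>' \<inter> \<Lambda>) \<union> (points \<gamma> - \<Lambda>)"
    and glue_configuration: "glue \<Lambda> \<gamma>' \<gamma> \<in> configurations"
proof -
  have s: "sets (restrict_conf \<gamma> (- \<Lambda>)) = sets (restrict_conf \<gamma>' \<Lambda>)"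
    "sets (restrict_conf \<gamma>' \<Lambda>) = sets borel"
    by (simp_all add: restrict_conf_def sets_configuration assms)
  have r: "emeasure (restrict_conf \<gamma> B) A = emeasure \<gamma> (A \<inter> B)"
    if "\<gamma> \<in> configurations" "A \<in> sets borel" "B \<in> sets borel" for \<gamma> :: "'a measure" and A B
  proof -
    note [simp] = sets_configuration[OF that(1)]
    have "emeasure (restrict_conf \<gamma> B) A = (\<integral>\<^sup>+x. indicator B x * indicator A x \<partial>\<gamma>)"
      unfolding restrict_conf_def using that
      by (subst emeasure_density) (simp_all cong: measurable_cong_sets)
    also have "\<dots> = (\<integral>\<^sup>+x. indicator (A \<inter> B) x \<partial>\<gamma>)"
      by (intro nn_integral_cong) (auto simp: indicator_def)
    also have "\<dots> = emeasure \<gamma> (A \<inter> B)"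
      using that by (intro nn_integral_indicator) simp
    finally show ?thesis .
  qed
  show e: "emeasure (glue \<Lambda> \<gamma>' \<gamma>) A = emeasure \<gamma>' (A \<inter> \<Lambda>) + emeasure \<gamma> (A - \<Lambda>)" if "A \<in> sets borel" for A
    unfolding glue_def using that assms
    by (subst emeasure_add_measure[OF s(1)]) (simp_all add: s r Diff_eq borel_comp)
  show "points (glue \<Lambda> \<gamma>' \<gamma>) = (points \<gamma>' \<inter> \<Lambda>) \<union> (points \<gamma> - \<Lambda>)"
  proof -
    have "emeasure (glue \<Lambda> \<gamma>' \<gamma>) {x} = (if x \<in> \<Lambda> then emeasure \<gamma>' {x} else emeasure \<gamma> {x})" for x
      by (simp add: e insert_Diff_if)
    then show ?thesis unfolding points_def by auto
  qed
  show "glue \<Lambda> \<gamma>' \<gamma> \<in> configurations"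
  proof (rule configurationsI)
    show "sets (glue \<Lambda> \<gamma>' \<gamma>) = sets borel" by (simp add: glue_def sets_add_measure[OF s(1)] s)
    show "\<exists>n::nat. emeasure (glue \<Lambda> \<gamma>' \<gamma>) A = of_nat n" if A: "A \<in> bounded_borel" for A
    proof -
      have "A \<inter> \<Lambda> \<in> bounded_borel" "A - \<Lambda> \<in> bounded_borel" "A \<in> sets borel"
        using A assms(3) by (auto simp: bounded_borel_def intro: bounded_subset)
      then show ?thesis using configuration_count[OF assms(1)] configuration_count[OF assms(2)] e
        by (metis of_nat_add)
    qed
    show "emeasure (glue \<Lambda> \<gamma>' \<gamma>) {x} \<le> 1" for x
      by (cases "x \<in> \<Lambda>") (auto simp: e emeasure_point assms indicator_def insert_Diff_if)
  qed
qed

lemma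
  assumes "\<gamma> \<in> configurations"
  shows emeasure_translate: "A \<in> sets borel \<Longrightarrow> emeasure (translate \<gamma> y) A = emeasure \<gamma> ((\<lambda>x. x - y) ` A)"
    and points_translate: "points (translate \<gamma> y) = (\<lambda>x. x + y) ` points \<gamma>"
    and translate_configuration: "translate \<gamma> y \<in> configurations"
proof -
  have m: "(\<lambda>x. x + y) \<in> measurable \<gamma> borel"
    by (simp add: sets_configuration[OF assms] cong: measurable_cong_sets)
  have pre: "(\<lambda>x. x + y) -` A = (\<lambda>x. x - y) ` A" for A
    by (force simp: image_iff)
  show e: "emeasure (translate \<gamma> y) A = emeasure \<gamma> ((\<lambda>x. x - y) ` A)" if "A \<in> sets borel" for A
    using that by (simp add: translate_def emeasure_distr m space_configuration[OF assms] pre)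
  show "points (translate \<gamma> y) = (\<lambda>x. x + y) ` points \<gamma>"
    unfolding points_def by (force simp: e image_iff)
  show "translate \<gamma> y \<in> configurations"
  proof (rule configurationsI)
    show "\<exists>n::nat. emeasure (translate \<gamma> y) A = of_nat n" if A: "A \<in> bounded_borel" for A
    proof -
      have "(\<lambda>x. x - y) ` A \<in> sets borel"
        using A measurable_sets[of "\<lambda>x. x + y" borel borel A] by (simp add: pre[symmetric] bounded_borel_def)
      moreover have "bounded ((\<lambda>x. x - y) ` A)"
        using A bounded_translation_minus by (auto simp: bounded_borel_def)
      ultimately have "(\<lambda>x. x - y) ` A \<in> bounded_borel" by (simp add: bounded_borel_def)
      with A show ?thesis using configuration_count[OF assms] e
        by (metis bounded_borel_def mem_Collect_eq)
    qed
    show "emeasure (translate \<gamma> y) {x} \<le> 1" for x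
      by (auto simp: e emeasure_point[OF assms] indicator_def)
  qed (simp add: translate_def)
qed


section \<open>Measurability on the space of configurations\<close>

lemma space_conf [simp]: "space conf = configurations"
  unfolding conf_def by (intro space_measure_of) auto

lemma measurable_confI:
  assumes "\<And>\<omega>. \<omega> \<in> space M \<Longrightarrow> g \<omega> \<in> configurations"
    and "\<And>\<Lambda>. \<Lambda> \<in> bounded_borel \<Longrightarrow> (\<lambda>\<omega>. emeasure (g \<omega>) \<Lambda>) \<in> borel_measurable M"
  shows "g \<in> measurable M conf"
  unfolding conf_def
proof (rule measurable_measure_of)
  fix y :: "'b measure set"
  assume "y \<in> {{\<gamma> \<in> configurations. emeasure \<gamma> \<Lambda> \<in> A} | \<Lambda> A. \<Lambda> \<in> bounded_borel \<and> A \<in> sets borel}"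
  then obtain \<Lambda> A where y: "y = {\<gamma> \<in> configurations. emeasure \<gamma> \<Lambda> \<in> A}"
    and L: "\<Lambda> \<in> bounded_borel" and A: "A \<in> sets borel" by auto
  have "g -` y \<inter> space M = (\<lambda>\<omega>. emeasure (g \<omega>) \<Lambda>) -` A \<inter> space M"
    using assms(1) by (auto simp: y)
  then show "g -` y \<inter> space M \<in> sets M"
    using measurable_sets[OF assms(2)[OF L] A] by simp
qed (use assms(1) in auto)

lemma measurable_count_bounded:
  assumes "\<Lambda> \<in> bounded_borel"
  shows "(\<lambda>\<gamma>. emeasure \<gamma> \<Lambda>) \<in> borel_measurable conf"
proof (rule measurableI)
  fix A :: "ennreal set" assume A: "A \<in> sets borel"
  have "{\<gamma> \<in> configurations. emeasure \<gamma> \<Lambda> \<in> A} \<in> sets conf"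
    unfolding conf_def by (rule in_measure_of) (use A assms in auto)
  also have "{\<gamma> \<in> configurations. emeasure \<gamma> \<Lambda> \<in> A} = (\<lambda>\<gamma>. emeasure \<gamma> \<Lambda>) -` A \<inter> space conf"
    by auto
  finally show "(\<lambda>\<gamma>. emeasure \<gamma> \<Lambda>) -` A \<inter> space conf \<in> sets conf" .
qed simp

text \<open>Normalising the restriction to a ball turns a configuration into a subprobability measure, for
  which the library knows that integration is measurable in the measure.\<close>

lemma measurable_nn_integral_configuration [measurable]:
  fixes F :: "'b \<Rightarrow> 'a::euclidean_space \<Rightarrow> ennreal"
  assumes g [measurable]: "g \<in> measurable M conf"
    and F [measurable]: "(\<lambda>(\<omega>, x). F \<omega> x) \<in> borel_measurable (M \<Otimes>\<^sub>M borel)"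
  shows "(\<lambda>\<omega>. \<integral>\<^sup>+x. F \<omega> x \<partial>g \<omega>) \<in> borel_measurable M"
proof -
  define B where "B n = ball (0::'a) (real n)" for n
  have B [measurable]: "B n \<in> sets borel" and Bb: "B n \<in> bounded_borel" for n
    unfolding B_def by simp_all
  have gc: "g \<omega> \<in> configurations" if "\<omega> \<in> space M" for \<omega>
    using measurable_space[OF g that] by simp
  \<comment> \<open>The summand 1 keeps the divisor nonzero when the ball contains no point;
    finiteness holds because the count in a ball is a natural number.\<close>
  define c where "c n \<omega> = 1 + emeasure (g \<omega>) (B n)" for n \<omega>
  have cfin: "c n \<omega> \<noteq> \<infinity>" "c n \<omega> \<noteq> 0" if \<omega>: "\<omega> \<in> space M" for n \<omega>
  proof -
    obtain k :: nat where "emeasure (g \<omega>) (B n) = of_nat k"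
      using configuration_count[OF gc[OF \<omega>] Bb] .
    then show "c n \<omega> \<noteq> \<infinity>" "c n \<omega> \<noteq> 0" by (simp_all add: c_def)
  qed
  define \<kappa> where "\<kappa> n \<omega> = density (g \<omega>) (\<lambda>x. indicator (B n) x / c n \<omega>)" for n \<omega>
  have int\<kappa>: "(\<integral>\<^sup>+x. f x \<partial>\<kappa> n \<omega>) = (\<integral>\<^sup>+x. f x * indicator (B n) x \<partial>g \<omega>) / c n \<omega>"
    if \<omega>: "\<omega> \<in> space M" and f: "f \<in> borel_measurable borel" for f n \<omega>
  proof -
    have [measurable_cong]: "sets (g \<omega>) = sets borel" using sets_configuration gc \<omega> by blast
    note f [measurable]
    have "(\<integral>\<^sup>+x. f x \<partial>\<kappa> n \<omega>) = (\<integral>\<^sup>+x. (indicator (B n) x / c n \<omega>) * f x \<partial>g \<omega>)"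
      unfolding \<kappa>_def by (subst nn_integral_density) simp_all
    also have "\<dots> = (\<integral>\<^sup>+x. (f x * indicator (B n) x) / c n \<omega> \<partial>g \<omega>)"
      by (intro nn_integral_cong) (auto simp: indicator_def ennreal_times_divide mult.commute)
    also have "\<dots> = (\<integral>\<^sup>+x. f x * indicator (B n) x \<partial>g \<omega>) / c n \<omega>"
      by (rule nn_integral_divide) simp
    finally show ?thesis .
  qed
  have em\<kappa>: "emeasure (\<kappa> n \<omega>) A = emeasure (g \<omega>) (A \<inter> B n) / c n \<omega>"
    if \<omega>: "\<omega> \<in> space M" and A [measurable]: "A \<in> sets borel" for A n \<omega>
  proof -
    have s: "sets (g \<omega>) = sets borel" using sets_configuration gc \<omega> by blast
    have "emeasure (\<kappa> n \<omega>) A = (\<integral>\<^sup>+x. indicator A x \<partial>\<kappa> n \<omega>)"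
      by (rule nn_integral_indicator[symmetric]) (simp add: \<kappa>_def s)
    also have "\<dots> = (\<integral>\<^sup>+x. indicator A x * indicator (B n) x \<partial>g \<omega>) / c n \<omega>"
      by (rule int\<kappa>[OF \<omega>]) simp
    also have "(\<integral>\<^sup>+x. indicator A x * indicator (B n) x \<partial>g \<omega>) = (\<integral>\<^sup>+x. indicator (A \<inter> B n) x \<partial>g \<omega>)"
      by (intro nn_integral_cong) (auto simp: indicator_def)
    also have "\<dots> = emeasure (g \<omega>) (A \<inter> B n)"
      by (rule nn_integral_indicator) (simp add: s)
    finally show ?thesis .
  qed
  have cnt [measurable]: "(\<lambda>\<omega>. emeasure (g \<omega>) A) \<in> borel_measurable M" if "A \<in> bounded_borel" for A
    using measurable_compose[OF g measurable_count_bounded[OF that]] .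
  have cm [measurable]: "c n \<in> borel_measurable M" for n
    unfolding c_def using cnt[OF Bb, of n] by simp
  have \<kappa>m: "\<kappa> n \<in> measurable M (subprob_algebra borel)" for n
  proof (rule measurable_subprob_algebra)
    fix \<omega> assume \<omega>: "\<omega> \<in> space M"
    show "sets (\<kappa> n \<omega>) = sets borel"
      using sets_configuration[OF gc[OF \<omega>]] by (simp add: \<kappa>_def)
    from sets_eq_imp_space_eq[OF this] have sp: "space (\<kappa> n \<omega>) = UNIV" by simp
    have "emeasure (\<kappa> n \<omega>) UNIV \<le> 1"
    proof -
      have "emeasure (g \<omega>) (B n) / c n \<omega> \<le> c n \<omega> / c n \<omega>"
        by (rule divide_right_mono_ennreal) (simp add: c_def)
      also have "\<dots> = 1" using cfin[OF \<omega>] by (intro ennreal_divide_self) (auto simp: top.not_eq_extremum)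
      finally show ?thesis by (simp add: em\<kappa>[OF \<omega>])
    qed
    then show "subprob_space (\<kappa> n \<omega>)" by (intro subprob_spaceI) (simp_all add: sp)
  next
    fix A :: "'a set" assume A: "A \<in> sets borel"
    have AB: "A \<inter> B n \<in> bounded_borel"
      using A by (auto simp: bounded_borel_def B_def intro: bounded_subset)
    have "(\<lambda>\<omega>. emeasure (g \<omega>) (A \<inter> B n) / c n \<omega>) \<in> borel_measurable M"
      using cnt[OF AB] by simp
    then show "(\<lambda>\<omega>. emeasure (\<kappa> n \<omega>) A) \<in> borel_measurable M"
      by (rule measurable_cong[THEN iffD1, rotated]) (simp add: em\<kappa> A)
  qed
  have "(\<lambda>\<omega>. \<integral>\<^sup>+x. F \<omega> x \<partial>\<kappa> n \<omega>) \<in> borel_measurable M" for n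
    by (rule nn_integral_measurable_subprob_algebra2[OF F \<kappa>m])
  \<comment> \<open>Multiplying by \<open>c n\<close> undoes the normalisation, and the balls
    \<open>B n\<close> exhaust the space, so monotone convergence recovers the full
    integral.\<close>
  then have "(\<lambda>\<omega>. SUP n. c n \<omega> * (\<integral>\<^sup>+x. F \<omega> x \<partial>\<kappa> n \<omega>)) \<in> borel_measurable M"
    by measurable
  moreover have "(\<integral>\<^sup>+x. F \<omega> x \<partial>g \<omega>) = (SUP n. c n \<omega> * (\<integral>\<^sup>+x. F \<omega> x \<partial>\<kappa> n \<omega>))"
    if \<omega>: "\<omega> \<in> space M" for \<omega>
  proof -
    have s [measurable_cong]: "sets (g \<omega>) = sets borel" using sets_configuration gc \<omega> by blast
    have [measurable]: "F \<omega> \<in> borel_measurable borel"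
      using measurable_compose[OF measurable_Pair1'[OF \<omega>] F] by simp
    have "c n \<omega> * (\<integral>\<^sup>+x. F \<omega> x \<partial>\<kappa> n \<omega>) = (\<integral>\<^sup>+x. F \<omega> x * indicator (B n) x \<partial>g \<omega>)" for n
      using cfin[OF \<omega>, of n]
      by (simp add: int\<kappa>[OF \<omega>] ennreal_times_divide ennreal_mult_divide_eq mult.commute[of "c n \<omega>"])
    then have "(SUP n. c n \<omega> * (\<integral>\<^sup>+x. F \<omega> x \<partial>\<kappa> n \<omega>)) = (SUP n. (\<integral>\<^sup>+x. F \<omega> x * indicator (B n) x \<partial>g \<omega>))"
      by simp
    also have "\<dots> = (\<integral>\<^sup>+x. (SUP n. F \<omega> x * indicator (B n) x) \<partial>g \<omega>)"
    proof (rule nn_integral_monotone_convergence_SUP[symmetric])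
      show "incseq (\<lambda>n x. F \<omega> x * indicator (B n) x)"
        by (auto simp: incseq_def le_fun_def indicator_def B_def)
    qed measurable
    also have "\<dots> = (\<integral>\<^sup>+x. F \<omega> x \<partial>g \<omega>)"
    proof (rule nn_integral_cong)
      fix x :: 'a
      obtain n where n: "norm x < real n" using reals_Archimedean2 by blast
      show "(SUP n. F \<omega> x * indicator (B n) x) = F \<omega> x"
      proof (rule antisym)
        show "(SUP n. F \<omega> x * indicator (B n) x) \<le> F \<omega> x"
          by (rule SUP_least) (auto simp: indicator_def)
        show "F \<omega> x \<le> (SUP n. F \<omega> x * indicator (B n) x)"
          by (rule SUP_upper2[of n]) (use n in \<open>auto simp: B_def indicator_def\<close>)
      qed
    qed
    finally show ?thesis by simp
  qed
  ultimately show ?thesis by (subst measurable_cong) auto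
qed

text \<open>The set may vary with the sample: the emptiness test below concerns the circumscribed
  ball of a varying triple of points.\<close>

lemma measurable_emeasure_configuration:
  assumes g: "g \<in> measurable M conf"
    and A [measurable]: "(\<lambda>(\<omega>, x). x \<in> A \<omega>) \<in> measurable (M \<Otimes>\<^sub>M borel) (count_space UNIV)"
  shows "(\<lambda>\<omega>. emeasure (g \<omega>) (A \<omega>)) \<in> borel_measurable M"
proof -
  have "(\<lambda>\<omega>. \<integral>\<^sup>+x. indicator (A \<omega>) x \<partial>g \<omega>) \<in> borel_measurable M"
  proof (rule measurable_nn_integral_configuration[OF g])
    have "(\<lambda>(\<omega>, x). if x \<in> A \<omega> then 1 else 0 :: ennreal) \<in> borel_measurable (M \<Otimes>\<^sub>M borel)"
      using A by (simp add: split_beta')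
    then show "(\<lambda>(\<omega>, x). indicator (A \<omega>) x :: ennreal) \<in> borel_measurable (M \<Otimes>\<^sub>M borel)"
      by (simp add: indicator_def of_bool_def split_beta')
  qed
  moreover have "(\<integral>\<^sup>+x. indicator (A \<omega>) x \<partial>g \<omega>) = emeasure (g \<omega>) (A \<omega>)" if "\<omega> \<in> space M" for \<omega>
  proof (rule nn_integral_indicator)
    have "(\<lambda>x. x \<in> A \<omega>) \<in> measurable borel (count_space UNIV)"
      using measurable_compose[OF measurable_Pair1'[OF that] A] by simp
    then have "A \<omega> \<in> sets borel" by (simp add: pred_def)
    then show "A \<omega> \<in> sets (g \<omega>)"
      using sets_configuration measurable_space[OF g that] by (metis space_conf)
  qed
  ultimately show ?thesis by (subst measurable_cong) auto
qed

lemma measurable_count [measurable]: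
  assumes "A \<in> sets borel"
  shows "(\<lambda>\<gamma>. emeasure \<gamma> A) \<in> borel_measurable conf"
  by (rule measurable_emeasure_configuration) (use assms in auto)

lemma measurable_glue [measurable]:
  fixes f g :: "'b \<Rightarrow> 'a::euclidean_space measure"
  assumes L: "\<Lambda> \<in> sets borel" and f: "f \<in> measurable M conf" and g: "g \<in> measurable M conf"
  shows "(\<lambda>\<omega>. glue \<Lambda> (f \<omega>) (g \<omega>)) \<in> measurable M conf"
proof (rule measurable_confI)
  have fc: "f \<omega> \<in> configurations" and gc: "g \<omega> \<in> configurations" if "\<omega> \<in> space M" for \<omega>
    using measurable_space[OF f that] measurable_space[OF g that] by auto
  show "glue \<Lambda> (f \<omega>) (g \<omega>) \<in> configurations" if "\<omega> \<in> space M" for \<omega>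
    using that by (intro glue_configuration gc fc L)
  fix A :: "'a set" assume "A \<in> bounded_borel"
  then have A: "A \<in> sets borel" by (simp add: bounded_borel_def)
  have "(\<lambda>\<omega>. emeasure (f \<omega>) (A \<inter> \<Lambda>) + emeasure (g \<omega>) (A - \<Lambda>)) \<in> borel_measurable M"
    by (intro borel_measurable_add measurable_compose[OF f] measurable_compose[OF g] measurable_count)
      (use A L in auto)
  then show "(\<lambda>\<omega>. emeasure (glue \<Lambda> (f \<omega>) (g \<omega>)) A) \<in> borel_measurable M"
    by (subst measurable_cong) (auto simp: emeasure_glue fc gc L A)
qed

lemma measurable_translate [measurable]: "(\<lambda>\<gamma>. translate \<gamma> y) \<in> measurable conf conf"
proof (rule measurable_confI)
  fix A :: "'a set" assume "A \<in> bounded_borel"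
  then have A: "A \<in> sets borel" by (simp add: bounded_borel_def)
  have "(\<lambda>x. x - y) ` A = (\<lambda>x. x + y) -` A \<inter> space borel" by (force simp: image_iff)
  moreover have "(\<lambda>x. x + y) -` A \<inter> space borel \<in> sets borel"
    using A by (intro measurable_sets[of _ borel borel]) simp_all
  ultimately have "(\<lambda>x. x - y) ` A \<in> sets borel" by (simp only:)
  from measurable_count[OF this] show "(\<lambda>\<gamma>. emeasure (translate \<gamma> y) A) \<in> borel_measurable conf"
    by (subst measurable_cong) (auto simp: emeasure_translate A)
qed (simp add: translate_configuration)

lemma measurable_add_point:
  fixes g :: "'b \<Rightarrow> 'a::euclidean_space measure"
  assumes g: "g \<in> measurable M conf" and "\<And>\<omega>. \<omega> \<in> space M \<Longrightarrow> x \<notin> points (g \<omega>)"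
  shows "(\<lambda>\<omega>. add_point (g \<omega>) x) \<in> measurable M conf"
proof (rule measurable_confI)
  have gc: "g \<omega> \<in> configurations" if "\<omega> \<in> space M" for \<omega>
    using measurable_space[OF g that] by auto
  show "add_point (g \<omega>) x \<in> configurations" if "\<omega> \<in> space M" for \<omega>
    using assms(2)[OF that] by (simp add: add_point_configuration_iff[OF gc[OF that]])
  fix A :: "'a set" assume "A \<in> bounded_borel"
  then have A: "A \<in> sets borel" by (simp add: bounded_borel_def)
  have "(\<lambda>\<omega>. emeasure (g \<omega>) A + indicator A x) \<in> borel_measurable M"
    by (intro borel_measurable_add measurable_compose[OF g] measurable_count) (use A in auto)
  then show "(\<lambda>\<omega>. emeasure (add_point (g \<omega>) x) A) \<in> borel_measurable M"
    by (subst measurable_cong) (auto simp: emeasure_add_point gc A)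
qed


section \<open>Circumscribed circles and Delaunay triangles\<close>

lemma inner_real2: "x \<bullet> y = x $ 1 * y $ 1 + x $ 2 * y $ 2" for x y :: "real^2"
  by (simp add: inner_vec_def sum_2)

text \<open>The quarter turn. Thus \<open>rot u \<bullet> v\<close> is the determinant of
  \<open>u\<close> and \<open>v\<close>, which vanishes exactly for parallel vectors.\<close>

definition rot :: "real^2 \<Rightarrow> real^2" where
  "rot u = (- (u $ 2)) *\<^sub>R axis 1 1 + (u $ 1) *\<^sub>R axis 2 1"

lemma rot_nth [simp]: "rot u $ 1 = - (u $ 2)" "rot u $ 2 = u $ 1"
  by (simp_all add: rot_def axis_def)

lemma rot_inner_self [simp]: "rot u \<bullet> u = 0" "u \<bullet> rot u = 0"
  by (simp_all add: inner_real2)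

lemma vec2_eq_iff: "x = y \<longleftrightarrow> x $ 1 = y $ 1 \<and> x $ 2 = y $ 2" for x y :: "real^2"
  by (simp add: vec_eq_iff forall_2)

lemma rot_eq_0_iff [simp]: "rot u = 0 \<longleftrightarrow> u = 0"
  by (auto simp: vec2_eq_iff)

lemma orthogonal_rot_imp_parallel:
  assumes "rot u \<bullet> v = 0" "u \<noteq> 0"
  obtains k where "v = k *\<^sub>R u"
proof
  have *: "u $ 1 * v $ 2 = u $ 2 * v $ 1" using assms(1) by (simp add: inner_real2)
  have n: "u $ 1 * u $ 1 + u $ 2 * u $ 2 \<noteq> 0"
    using assms(2) by (metis inner_eq_zero_iff inner_real2)
  have 1: "v $ 1 * (u $ 1 * u $ 1 + u $ 2 * u $ 2) = (u $ 1 * v $ 1 + u $ 2 * v $ 2) * u $ 1"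
    using * by algebra
  have 2: "v $ 2 * (u $ 1 * u $ 1 + u $ 2 * u $ 2) = (u $ 1 * v $ 1 + u $ 2 * v $ 2) * u $ 2"
    using * by algebra
  show "v = ((u \<bullet> v) / (u \<bullet> u)) *\<^sub>R u"
    using n 1 2 by (simp add: vec2_eq_iff inner_real2 field_simps)
qed

lemma collinear_3_rot: "collinear {a, b, c} \<longleftrightarrow> rot (b - a) \<bullet> (c - a) = 0"
proof -
  have "collinear {a, b, c} \<longleftrightarrow> collinear {b, a, c}" by (simp add: insert_commute)
  also have "\<dots> \<longleftrightarrow> collinear {0, b - a, c - a}" by (rule collinear_3) (simp add: NO_MATCH_def)
  also have "\<dots> \<longleftrightarrow> rot (b - a) \<bullet> (c - a) = 0"
  proof
    assume "collinear {0, b - a, c - a}"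
    then consider "b - a = 0" | "c - a = 0" | k where "c - a = k *\<^sub>R (b - a)"
      unfolding collinear_lemma by auto
    then show "rot (b - a) \<bullet> (c - a) = 0" by cases (simp_all add: rot_eq_0_iff[THEN iffD2])
  next
    assume r: "rot (b - a) \<bullet> (c - a) = 0"
    show "collinear {0, b - a, c - a}"
    proof (cases "b - a = 0")
      case True then show ?thesis unfolding collinear_lemma by blast
    next
      case False
      from orthogonal_rot_imp_parallel[OF r False] show ?thesis unfolding collinear_lemma by blast
    qed
  qed
  finally show ?thesis .
qed

text \<open>After squaring, the quadratic terms in the centre cancel: the perpendicular bisector is
  a linear equation, which makes the circumcentre the solution of a linear system.\<close>

lemma dist_eq_iff_inner:
  "dist o' a = dist o' b \<longleftrightarrow> 2 * ((o' - a) \<bullet> (b - a)) = (b - a) \<bullet> (b - a)" for a b o' :: "'a::real_inner"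
proof -
  have "dist o' a = dist o' b \<longleftrightarrow> (norm (o' - a))\<^sup>2 = (norm (o' - b))\<^sup>2"
    by (simp add: dist_norm)
  also have "\<dots> \<longleftrightarrow> 2 * ((o' - a) \<bullet> (b - a)) = (b - a) \<bullet> (b - a)"
    by (simp add: power2_norm_eq_inner algebra_simps inner_commute)
  finally show ?thesis .
qed

text \<open>The solution of the linear system \<open>2 (o - a) \<bullet> u = |u|\<^sup>2\<close>, \<open>2 (o - a) \<bullet> v = |v|\<^sup>2\<close>
  for \<open>u = b - a\<close> and \<open>v = c - a\<close>, by Cramer's rule.\<close>

definition circ :: "real^2 \<Rightarrow> real^2 \<Rightarrow> real^2 \<Rightarrow> real^2" where
  "circ a b c = a + (1 / (2 * (rot (b - a) \<bullet> (c - a)))) *\<^sub>R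
     (((norm (c - a))\<^sup>2) *\<^sub>R rot (b - a) - ((norm (b - a))\<^sup>2) *\<^sub>R rot (c - a))"

lemma dist_circ:
  assumes "\<not> collinear {a, b, c}"
  shows "dist (circ a b c) b = dist (circ a b c) a" "dist (circ a b c) c = dist (circ a b c) a"
proof -
  have d: "rot (b - a) \<bullet> (c - a) \<noteq> 0" using assms by (simp add: collinear_3_rot)
  have e: "rot (c - a) \<bullet> (b - a) = - (rot (b - a) \<bullet> (c - a))"
    by (simp add: inner_real2 algebra_simps)
  have "dist (circ a b c) a = dist (circ a b c) b"
    unfolding dist_eq_iff_inner using d
    by (simp add: circ_def inner_diff_left e power2_norm_eq_inner)
  then show "dist (circ a b c) b = dist (circ a b c) a" by simp
  have "dist (circ a b c) a = dist (circ a b c) c"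
    unfolding dist_eq_iff_inner using d
    by (simp add: circ_def inner_diff_left e power2_norm_eq_inner)
  then show "dist (circ a b c) c = dist (circ a b c) a" by simp
qed

text \<open>The difference of two solutions is orthogonal to both sides \<open>b - a\<close> and
  \<open>c - a\<close>, whose determinant is nonzero.\<close>

lemma circ_unique:
  assumes "\<not> collinear {a, b, c}" "dist p b = dist p a" "dist p c = dist p a"
  shows "p = circ a b c"
proof -
  let ?q = "circ a b c"
  have d: "rot (b - a) \<bullet> (c - a) \<noteq> 0" using assms by (simp add: collinear_3_rot)
  have "dist p a = dist p b" "dist p a = dist p c" "dist ?q a = dist ?q b" "dist ?q a = dist ?q c"
    using assms(2,3) dist_circ[OF assms(1)] by simp_all
  then have "(p - ?q) \<bullet> (b - a) = 0" "(p - ?q) \<bullet> (c - a) = 0"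
    unfolding dist_eq_iff_inner by (simp_all add: inner_diff_left)
  then have e: "(p - ?q) $ 1 * (b - a) $ 1 + (p - ?q) $ 2 * (b - a) $ 2 = 0"
    "(p - ?q) $ 1 * (c - a) $ 1 + (p - ?q) $ 2 * (c - a) $ 2 = 0"
    by (simp_all add: inner_real2)
  have d': "(b - a) $ 1 * (c - a) $ 2 - (b - a) $ 2 * (c - a) $ 1 \<noteq> 0"
    using d by (simp add: inner_real2 algebra_simps)
  have "(p - ?q) $ 1 * ((b - a) $ 1 * (c - a) $ 2 - (b - a) $ 2 * (c - a) $ 1) = 0"
    using e by algebra
  moreover have "(p - ?q) $ 2 * ((b - a) $ 1 * (c - a) $ 2 - (b - a) $ 2 * (c - a) $ 1) = 0"
    using e by algebra
  ultimately have "p - ?q = 0" using d' by (simp add: vec2_eq_iff)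
  then show ?thesis by simp
qed

lemma circum_eq:
  assumes "\<not> collinear {a, b, c}"
  shows circumcenter_eq: "circumcenter {a, b, c} = circ a b c"
    and circumradius_eq: "circumradius {a, b, c} = dist (circ a b c) a"
proof -
  have *: "{a, b, c} \<subseteq> sphere p \<rho> \<longleftrightarrow> p = circ a b c \<and> \<rho> = dist (circ a b c) a" for p \<rho>
  proof
    assume "{a, b, c} \<subseteq> sphere p \<rho>"
    then have d: "dist p a = \<rho>" "dist p b = \<rho>" "dist p c = \<rho>" by auto
    have "p = circ a b c" by (rule circ_unique[OF assms]) (simp_all add: d)
    then show "p = circ a b c \<and> \<rho> = dist (circ a b c) a" using d by simp
  next
    assume "p = circ a b c \<and> \<rho> = dist (circ a b c) a"
    then show "{a, b, c} \<subseteq> sphere p \<rho>" using dist_circ[OF assms] by simp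
  qed
  show "circumcenter {a, b, c} = circ a b c" "circumradius {a, b, c} = dist (circ a b c) a"
    unfolding circumcenter_def circumradius_def * by auto
qed

lemma card_3_noncollinear_obtain:
  assumes "card T = 3" "\<not> collinear T"
  obtains a b c where "T = {a, b, c}" "a \<noteq> b" "a \<noteq> c" "b \<noteq> c" "\<not> collinear {a, b, c}"
  using assms by (auto simp: card_3_iff)

lemma noncollinear_distinct:
  assumes "\<not> collinear {a, b, c}"
  shows "a \<noteq> b" "a \<noteq> c" "b \<noteq> c" "card {a, b, c} = 3"
proof -
  show 1: "a \<noteq> b" "a \<noteq> c" "b \<noteq> c" using assms by (auto simp: insert_commute)
  then show "card {a, b, c} = 3" by simp
qed

lemma dist_circumcenter:
  assumes "card T = 3" "\<not> collinear T" "p \<in> T"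
  shows "dist (circumcenter T) p = circumradius T"
proof -
  obtain a b c where T: "T = {a, b, c}" "\<not> collinear {a, b, c}"
    using card_3_noncollinear_obtain[OF assms(1,2)] by metis
  then show ?thesis using assms(3) dist_circ[OF T(2)] by (auto simp: circum_eq)
qed

lemma circumradius_pos:
  assumes "card T = 3" "\<not> collinear T"
  shows "circumradius T > 0"
proof -
  obtain a b c where T: "T = {a, b, c}" "a \<noteq> b"
    using card_3_noncollinear_obtain[OF assms] by metis
  then have "dist (circumcenter T) a = circumradius T" "dist (circumcenter T) b = circumradius T"
    using assms by (auto intro!: dist_circumcenter)
  then show ?thesis using T(2) by (metis dist_le_zero_iff not_le)
qed

lemma circum_unique:
  assumes "card T = 3" "\<not> collinear T" "\<And>p. p \<in> T \<Longrightarrow> dist o' p = \<rho>"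
  shows "circumcenter T = o'" "circumradius T = \<rho>"
proof -
  obtain a b c where T: "T = {a, b, c}" "\<not> collinear {a, b, c}"
    using card_3_noncollinear_obtain[OF assms(1,2)] by metis
  have "o' = circ a b c" using assms(3) T by (intro circ_unique) auto
  then show "circumcenter T = o'" "circumradius T = \<rho>"
    using T assms(3)[of a] by (auto simp: circum_eq)
qed

text \<open>A line meets a circle at most twice: for a point \<open>a + k (b - a)\<close> on the
  circle, equidistance becomes a quadratic equation in \<open>k\<close> with roots 0 and 1, that is,
  \<open>a\<close> and \<open>b\<close>.\<close>

lemma concyclic_noncollinear:
  fixes a b c :: "real^2"
  assumes "a \<noteq> b" "a \<noteq> c" "b \<noteq> c" "dist o' a = \<rho>" "dist o' b = \<rho>" "dist o' c = \<rho>"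
  shows "\<not> collinear {a, b, c}"
proof
  assume "collinear {a, b, c}"
  then have "rot (b - a) \<bullet> (c - a) = 0" by (simp add: collinear_3_rot)
  then obtain k where k: "c - a = k *\<^sub>R (b - a)"
    using orthogonal_rot_imp_parallel[of "b - a" "c - a"] assms(1) by auto
  have "dist o' a = dist o' b" "dist o' a = dist o' c" using assms by auto
  then have 1: "2 * ((o' - a) \<bullet> (b - a)) = (b - a) \<bullet> (b - a)"
    and 2: "2 * ((o' - a) \<bullet> (c - a)) = (c - a) \<bullet> (c - a)"
    by (auto intro: dist_eq_iff_inner[THEN iffD1])
  from 2 have "k * (2 * ((o' - a) \<bullet> (b - a))) = k * (k * ((b - a) \<bullet> (b - a)))"
    unfolding k by simp
  then have "k * ((b - a) \<bullet> (b - a)) = k * (k * ((b - a) \<bullet> (b - a)))" unfolding 1 .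
  moreover have "(b - a) \<bullet> (b - a) \<noteq> 0" using assms(1) by simp
  ultimately have "k = 0 \<or> k = 1" by auto
  then show False using k assms(2,3) by auto
qed

lemma min_side_le_iff:
  assumes "card T = 3"
  shows "min_side T \<le> r \<longleftrightarrow> (\<exists>x\<in>T. \<exists>y\<in>T. x \<noteq> y \<and> dist x y \<le> r)"
proof -
  have f: "finite T" using assms by (simp add: card_ge_0_finite)
  let ?D = "{dist x y | x y. x \<in> T \<and> y \<in> T \<and> x \<noteq> y}"
  have "?D \<subseteq> (\<lambda>(x, y). dist x y) ` (T \<times> T)" by auto
  then have "finite ?D" using f by (meson finite_SigmaI finite_imageI finite_subset)
  moreover have "?D \<noteq> {}" using assms by (auto simp: card_3_iff)
  ultimately show ?thesis unfolding min_side_def by (subst Min_le_iff) auto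
qed

text \<open>Energies depend on a configuration only through its points; working with a bare set
  allows points to be inserted or moved without constructing measures.\<close>

definition del :: "(real^2) set \<Rightarrow> (real^2) set set" where
  "del P = {T. T \<subseteq> P \<and> card T = 3 \<and> \<not> collinear T \<and> circumball T \<inter> P = {}}"

lemma delaunay_eq_del: "delaunay \<gamma> = del (points \<gamma>)"
  by (simp add: delaunay_def del_def)

lemma delD:
  assumes "T \<in> del P"
  shows "T \<subseteq> P" "card T = 3" "\<not> collinear T" "finite T" "circumradius T > 0"
    "\<And>p. p \<in> T \<Longrightarrow> dist (circumcenter T) p = circumradius T"
    "\<And>p. p \<in> P \<Longrightarrow> circumradius T \<le> dist (circumcenter T) p"
proof -
  show T: "T \<subseteq> P" "card T = 3" "\<not> collinear T" using assms by (auto simp: del_def)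
  show "finite T" using T by (simp add: card_ge_0_finite)
  show "circumradius T > 0" using T by (simp add: circumradius_pos)
  show "dist (circumcenter T) p = circumradius T" if "p \<in> T" for p
    using dist_circumcenter[OF T(2,3) that] .
  show "circumradius T \<le> dist (circumcenter T) p" if "p \<in> P" for p
  proof -
    have "p \<notin> circumball T" using assms that by (auto simp only: del_def mem_Collect_eq)
    then show ?thesis by (simp add: circumball_def)
  qed
qed

lemma delI:
  assumes "T \<subseteq> P" "card T = 3" "\<not> collinear T" "\<And>p. p \<in> T \<Longrightarrow> dist o' p = \<rho>"
    "\<And>p. p \<in> P \<Longrightarrow> \<rho> \<le> dist o' p"
  shows "T \<in> del P" "circumcenter T = o'" "circumradius T = \<rho>"
proof -
  show c: "circumcenter T = o'" "circumradius T = \<rho>"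
    using circum_unique[OF assms(2,3,4)] by auto
  have "circumball T \<inter> P = {}"
    using assms(5) by (auto simp: circumball_def c not_less[symmetric] simp del: not_less)
  then show "T \<in> del P" using assms(1,2,3) by (simp add: del_def)
qed

section \<open>Nearest neighbours span Delaunay triangles\<close>

definition locally_finite :: "'a::metric_space set \<Rightarrow> bool" where
  "locally_finite P \<longleftrightarrow> (\<forall>B. bounded B \<longrightarrow> finite (P \<inter> B))"

lemma locally_finite_points: "\<gamma> \<in> configurations \<Longrightarrow> locally_finite (points \<gamma>)"
  by (simp add: locally_finite_def finite_points)

lemma locally_finite_insert: "locally_finite P \<Longrightarrow> locally_finite (insert x P)"
  by (simp add: locally_finite_def Int_insert_left)

lemma locally_finite_attains_min:
  fixes f :: "'a::metric_space \<Rightarrow> real"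
  assumes "locally_finite P" "S \<subseteq> P" "s0 \<in> S" "bounded {s \<in> S. f s \<le> f s0}"
  obtains s where "s \<in> S" "\<And>s'. s' \<in> S \<Longrightarrow> f s \<le> f s'"
proof -
  let ?F = "{s \<in> S. f s \<le> f s0}"
  have "finite (P \<inter> ?F)" using assms(1,4) by (simp add: locally_finite_def)
  moreover have "P \<inter> ?F = ?F" using assms(2) by auto
  ultimately have fin: "finite ?F" by simp
  have ne: "?F \<noteq> {}" using assms(3) by auto
  obtain s where s: "s \<in> ?F" "\<And>x. x \<in> ?F \<Longrightarrow> f s \<le> f x"
  proof
    show "arg_min_on f ?F \<in> ?F" using arg_min_if_finite(1)[OF fin ne] .
    show "f (arg_min_on f ?F) \<le> f x" if "x \<in> ?F" for x
      using arg_min_least[OF fin ne that] .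
  qed
  show ?thesis
  proof
    show "s \<in> S" using s by simp
    show "f s \<le> f s'" if "s' \<in> S" for s'
      using s(1) s(2)[of s'] that by (cases "f s' \<le> f s0") auto
  qed
qed

text \<open>The disc with diameter \<open>p q\<close> is empty because \<open>q\<close> is nearest
  to \<open>p\<close>. Its centre is pushed from the midpoint \<open>m\<close> along the bisector in
  direction \<open>n\<close>, keeping \<open>p\<close> and \<open>q\<close> on the circle, until the
  growing side first meets a point \<open>s\<close>. In formulas, \<open>A s - t * B s\<close> is
  the power of \<open>s\<close> with respect to the circle centred at
  \<open>m + t *\<^sub>R n\<close>, so the first contact is at the minimum of
  \<open>A s / B s\<close> over the points with \<open>B s > 0\<close>.\<close>

lemma nearest_neighbour_del_aux:
  fixes p q n :: "real^2"
  assumes lf: "locally_finite P" and P: "p \<in> P" "q \<in> P" "p \<noteq> q"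
    and near: "\<And>s. s \<in> P \<Longrightarrow> s \<noteq> p \<Longrightarrow> dist p q \<le> dist p s"
    and n: "n \<bullet> (q - p) = 0" and ex: "s0 \<in> P" "n \<bullet> (s0 - p) > 0"
  shows "\<exists>s\<in>P. {p, q, s} \<in> del P"
proof -
  define m where "m = (1/2) *\<^sub>R (p + q)"
  define A where "A s = (norm (s - m))\<^sup>2 - (norm (p - m))\<^sup>2" for s
  define B where "B s = 2 * (n \<bullet> (s - m))" for s
  have pm: "p - m = (-1/2) *\<^sub>R (q - p)" and qm: "q - m = (1/2) *\<^sub>R (q - p)"
    by (simp_all add: m_def vec2_eq_iff field_simps)
  have npm: "n \<bullet> (p - m) = 0" and nqm: "n \<bullet> (q - m) = 0" using n by (simp_all add: pm qm)
  have B_alt: "B s = 2 * (n \<bullet> (s - p))" for s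
  proof -
    have "n \<bullet> (s - m) = n \<bullet> (s - p) + n \<bullet> (p - m)" by (simp add: inner_diff_right)
    then show ?thesis by (simp add: B_def npm)
  qed
  have norm_eq: "norm (q - m) = norm (p - m)" by (simp add: pm qm)
  have dpq: "dist p q = 2 * norm (p - m)" by (simp add: pm dist_norm norm_minus_commute)
  \<comment> \<open>A point of negative power lies inside the disc with diameter \<open>p q\<close>
    and is therefore closer to \<open>p\<close> than \<open>q\<close> is.\<close>
  have A0: "A s \<ge> 0" if "s \<in> P" for s
  proof (rule ccontr)
    assume "\<not> A s \<ge> 0"
    then have "(norm (s - m))\<^sup>2 < (norm (p - m))\<^sup>2" unfolding A_def by linarith
    then have lt: "norm (s - m) < norm (p - m)" by (rule power2_less_imp_less) simp
    then have "s \<noteq> p" by auto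
    have "dist p s \<le> norm (p - m) + norm (s - m)"
      by (metis dist_norm dist_triangle2)
    with lt near[OF that \<open>s \<noteq> p\<close>] dpq show False by linarith
  qed
  have key: "(norm (s - (m + t *\<^sub>R n)))\<^sup>2 - (norm (p - (m + t *\<^sub>R n)))\<^sup>2 = A s - t * B s" for s t
  proof -
    have "(norm (s - (m + t *\<^sub>R n)))\<^sup>2 = (norm (s - m))\<^sup>2 - t * B s + t\<^sup>2 * (n \<bullet> n)" for s
    proof -
      have "s - (m + t *\<^sub>R n) = (s - m) - t *\<^sub>R n" by simp
      then show ?thesis
        by (simp only: power2_norm_eq_inner B_def) (simp add: inner_diff_left inner_diff_right
            inner_commute power2_eq_square algebra_simps)
    qed
    moreover have "B p = 0" by (simp add: B_def npm)
    ultimately show ?thesis by (simp add: A_def)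
  qed
  define S where "S = {s \<in> P. B s > 0}"
  have s0: "s0 \<in> S" using ex by (simp add: S_def B_alt)
  define k where "k = A s0 / B s0"
  have k0: "k \<ge> 0" using A0[OF ex(1)] s0 by (auto simp: k_def S_def)
  \<comment> \<open>\<open>A\<close> grows quadratically and \<open>B\<close> only linearly in the
    distance from \<open>m\<close>, so distant points are met late.\<close>
  have "bounded {s \<in> S. A s / B s \<le> A s0 / B s0}"
  proof (rule bounded_subset[OF bounded_cball])
    show "{s \<in> S. A s / B s \<le> A s0 / B s0} \<subseteq> cball m (2 * k * norm n + norm (p - m))"
    proof
      fix s assume s: "s \<in> {s \<in> S. A s / B s \<le> A s0 / B s0}"
      then have "A s \<le> k * B s" by (auto simp: k_def S_def pos_divide_le_eq)
      also have "\<dots> \<le> k * (2 * (norm n * norm (s - m)))"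
        unfolding B_def using k0 by (intro mult_left_mono) (auto intro: norm_cauchy_schwarz)
      finally have le: "(norm (s - m))\<^sup>2 \<le> (2 * k * norm n) * norm (s - m) + (norm (p - m))\<^sup>2"
        by (simp add: A_def algebra_simps)
      have "norm (s - m) \<le> 2 * k * norm n + norm (p - m)"
      proof (rule ccontr)
        assume "\<not> ?thesis"
        then have gt: "norm (s - m) > 2 * k * norm n + norm (p - m)" by simp
        have nn: "0 \<le> 2 * k * norm n" using k0 by simp
        have "norm (p - m) * norm (p - m) \<le> norm (p - m) * norm (s - m)"
          using gt nn by (intro mult_left_mono) auto
        moreover have "(2 * k * norm n + norm (p - m)) * norm (s - m) < norm (s - m) * norm (s - m)"
        proof (rule mult_strict_right_mono[OF gt])
          show "0 < norm (s - m)" using gt nn norm_ge_zero[of "p - m"] by linarith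
        qed
        ultimately show False using le by (simp add: power2_eq_square algebra_simps)
      qed
      then show "s \<in> cball m (2 * k * norm n + norm (p - m))"
        by (simp add: dist_norm norm_minus_commute)
    qed
  qed
  moreover have "S \<subseteq> P" by (auto simp: S_def)
  ultimately obtain s where s: "s \<in> S" "\<And>s'. s' \<in> S \<Longrightarrow> A s / B s \<le> A s' / B s'"
    using locally_finite_attains_min[OF lf _ s0, of "\<lambda>s. A s / B s"] by metis
  define t where "t = A s / B s"
  define c where "c = m + t *\<^sub>R n"
  have Bs: "B s > 0" and sP: "s \<in> P" using s by (auto simp: S_def)
  have t0: "t \<ge> 0" using A0[OF sP] Bs by (simp add: t_def)
  have ge: "norm (p - c) \<le> norm (s' - c)" if "s' \<in> P" for s'
  proof -
    have "A s' - t * B s' \<ge> 0"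
    proof (cases "B s' > 0")
      case True
      then have "t \<le> A s' / B s'" using s(2)[of s'] that by (simp add: S_def t_def)
      then show ?thesis using True by (simp add: pos_le_divide_eq)
    next
      case False
      then have "t * B s' \<le> 0" using t0 by (simp add: mult_nonneg_nonpos)
      then show ?thesis using A0[OF that] by simp
    qed
    then have "(norm (p - c))\<^sup>2 \<le> (norm (s' - c))\<^sup>2" using key[of s' t] unfolding c_def by linarith
    then show ?thesis by (rule power2_le_imp_le) simp
  qed
  have "A q - t * B q = 0" by (simp add: A_def B_def nqm norm_eq)
  then have "(norm (q - c))\<^sup>2 = (norm (p - c))\<^sup>2" using key[of q t] by (simp add: c_def)
  then have eq1: "norm (q - c) = norm (p - c)" by simp
  have "A s - t * B s = 0" using Bs by (simp add: t_def)
  then have "(norm (s - c))\<^sup>2 = (norm (p - c))\<^sup>2" using key[of s t] by (simp add: c_def)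
  then have eq2: "norm (s - c) = norm (p - c)" by simp
  have nc: "\<not> collinear {p, q, s}"
  proof (rule concyclic_noncollinear)
    show "p \<noteq> s" "q \<noteq> s" using Bs npm nqm by (auto simp: B_def)
    show "dist c p = norm (p - c)" "dist c q = norm (p - c)" "dist c s = norm (p - c)"
      using eq1 eq2 by (simp_all add: dist_norm norm_minus_commute)
  qed (use P in auto)
  have "{p, q, s} \<in> del P"
  proof (rule delI(1))
    show "card {p, q, s} = 3" "\<not> collinear {p, q, s}" using nc noncollinear_distinct by auto
    show "dist c p' = norm (p - c)" if "p' \<in> {p, q, s}" for p'
      using that eq1 eq2 by (auto simp: dist_norm norm_minus_commute)
    show "norm (p - c) \<le> dist c p'" if "p' \<in> P" for p'
      using ge[OF that] by (simp add: dist_norm norm_minus_commute)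
  qed (use P sP in auto)
  then show ?thesis using sP by blast
qed

text \<open>Since \<open>P\<close> is not collinear, some point lies off the line through
  \<open>p\<close> and \<open>q\<close>; the normal \<open>n\<close> is chosen to point to its
  side.\<close>

lemma nearest_neighbour_del:
  fixes p q :: "real^2"
  assumes lf: "locally_finite P" and P: "p \<in> P" "q \<in> P" "p \<noteq> q"
    and near: "\<And>s. s \<in> P \<Longrightarrow> s \<noteq> p \<Longrightarrow> dist p q \<le> dist p s"
    and nc: "\<not> collinear P"
  shows "\<exists>s\<in>P. {p, q, s} \<in> del P"
proof -
  have "\<exists>s\<in>P. rot (q - p) \<bullet> (s - p) \<noteq> 0"
  proof (rule ccontr)
    assume "\<not> ?thesis"
    then have "\<forall>x\<in>P. collinear {p, q, x}" by (simp add: collinear_3_rot)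
    then have "collinear (insert p (insert q P))" by (rule collinear_triples[OF P(3), THEN iffD2])
    moreover have "insert p (insert q P) = P" using P by auto
    ultimately show False using nc by simp
  qed
  then obtain s where s: "s \<in> P" "rot (q - p) \<bullet> (s - p) \<noteq> 0" by blast
  show ?thesis
  proof (cases "rot (q - p) \<bullet> (s - p) > 0")
    case True
    show ?thesis by (rule nearest_neighbour_del_aux[OF lf P near _ s(1) True]) auto
  next
    case False
    show ?thesis by (rule nearest_neighbour_del_aux[OF lf P near _ s(1), of "- rot (q - p)"])
       (use False s in auto)
  qed
qed

lemma exists_nearest_neighbour:
  assumes lf: "locally_finite P" and "q \<in> P" "q \<noteq> p"
  obtains q' where "q' \<in> P" "q' \<noteq> p" "dist p q' \<le> dist p q"
    "\<And>s. s \<in> P \<Longrightarrow> s \<noteq> p \<Longrightarrow> dist p q' \<le> dist p s"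
proof -
  have "bounded {s \<in> P - {p}. dist p s \<le> dist p q}"
    by (rule bounded_subset[OF bounded_cball[of p "dist p q"]]) auto
  moreover have "P - {p} \<subseteq> P" "q \<in> P - {p}" using assms by auto
  ultimately obtain s where "s \<in> P - {p}" "\<And>s'. s' \<in> P - {p} \<Longrightarrow> dist p s \<le> dist p s'"
    using locally_finite_attains_min[OF lf, of "P - {p}" q "dist p"] by metis
  then show ?thesis using assms by (intro that[of s]) auto
qed

text \<open>The shortest segment from \<open>p\<close> to another point is a side of a Delaunay
  triangle, so a lower bound on sides of triangles bounds the distances of all pairs.\<close>

lemma del_separated:
  assumes lf: "locally_finite P" and nc: "\<not> collinear P"
    and fine: "\<And>T. T \<in> del P \<Longrightarrow> min_side T > r"
    and P: "p \<in> P" "q \<in> P" "p \<noteq> q"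
  shows "dist p q > r"
proof -
  obtain q' where q': "q' \<in> P" "q' \<noteq> p" "dist p q' \<le> dist p q"
    "\<And>s. s \<in> P \<Longrightarrow> s \<noteq> p \<Longrightarrow> dist p q' \<le> dist p s"
    using exists_nearest_neighbour[OF lf P(2)] P(3) by metis
  obtain s where s: "{p, q', s} \<in> del P"
    using nearest_neighbour_del[OF lf P(1) q'(1) _ q'(4) nc] q'(2) by metis
  from fine[OF s] have "\<not> min_side {p, q', s} \<le> r" by simp
  then have "\<not> dist p q' \<le> r"
    unfolding min_side_le_iff[OF delD(2)[OF s]] using q'(2) by auto
  then show ?thesis using q'(3) by simp
qed


section \<open>Large empty discs and coverings\<close>

lemma finite_positive_lower_bound:
  fixes f :: "'b \<Rightarrow> real"
  assumes "finite A" "\<And>a. a \<in> A \<Longrightarrow> 0 < f a"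
  shows "\<exists>e>0. \<forall>a\<in>A. e \<le> f a"
proof (intro exI conjI ballI)
  show "0 < Min (insert 1 (f ` A))" using assms by (subst Min_gr_iff) auto
  show "Min (insert 1 (f ` A)) \<le> f a" if "a \<in> A" for a using assms(1) that by (intro Min_le) auto
qed

text \<open>In the plane this says that \<open>y\<close> is interior to the convex hull of
  \<open>P\<close>. Required at every \<open>y\<close>, it says that no closed half-plane contains
  \<open>P\<close>.\<close>

definition surrounded :: "'a::real_inner set \<Rightarrow> 'a \<Rightarrow> bool" where
  "surrounded P y \<longleftrightarrow> (\<forall>v. v \<noteq> 0 \<longrightarrow> (\<exists>p\<in>P. (p - y) \<bullet> v > 0))"

lemma surrounded_not_collinear:
  fixes P :: "(real^2) set"
  assumes "\<And>y. surrounded P y"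
  shows "\<not> collinear P"
proof
  assume "collinear P"
  then obtain u where u: "\<And>x y. x \<in> P \<Longrightarrow> y \<in> P \<Longrightarrow> \<exists>c. x - y = c *\<^sub>R u" by (auto simp: collinear_def)
  define v where "v = (if u = 0 then axis 1 1 else rot u)"
  have "axis 1 1 \<noteq> (0 :: real^2)" by (simp add: axis_eq_0_iff)
  then have v: "v \<noteq> 0" by (simp add: v_def)
  have uv: "u \<bullet> v = 0" by (simp add: v_def)
  obtain y where y: "y \<in> P" using assms[of 0] v by (auto simp: surrounded_def)
  obtain p where p: "p \<in> P" "(p - y) \<bullet> v > 0" using assms[of y] v by (auto simp: surrounded_def)
  obtain c where "p - y = c *\<^sub>R u" using u[OF p(1) y] by blast
  then show False using p(2) uv by simp
qed

text \<open>The condition on \<open>c\<close> means that \<open>c\<close> is at least as close to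
  \<open>y\<close> as to every point of \<open>P\<close>, that is, \<open>c\<close> lies in the
  Voronoi cell of \<open>y\<close>. In each direction some point of \<open>P\<close> ends the cell
  after finite time, and compactness of the unit sphere makes this time uniform.\<close>

lemma surrounded_bounded_centers:
  fixes y :: "'a::euclidean_space"
  assumes "surrounded P y"
  shows "\<exists>N. \<forall>c. (\<forall>p\<in>P. 0 \<le> (p - y) \<bullet> (p - y) - 2 * ((c - y) \<bullet> (p - y))) \<longrightarrow> dist c y \<le> N"
proof -
  \<comment> \<open>The directions \<open>v\<close> for which \<open>y + n v\<close> has already
    left the cell; a union of open sets, so the sphere is covered by finitely many of them.\<close>
  define U where "U n = (\<Union>p\<in>P. {v. (p - y) \<bullet> (p - y) < 2 * real n * ((p - y) \<bullet> v)})" for n :: nat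
  have op: "open (U n)" for n
    unfolding U_def by (intro open_UN ballI open_Collect_less continuous_intros)
  have cov: "sphere 0 1 \<subseteq> (\<Union>n. U n)"
  proof
    fix v :: 'a assume "v \<in> sphere 0 1"
    then have "v \<noteq> 0" by auto
    then obtain p where p: "p \<in> P" "(p - y) \<bullet> v > 0" using assms by (auto simp: surrounded_def)
    obtain n :: nat where "(p - y) \<bullet> (p - y) / (2 * ((p - y) \<bullet> v)) < real n"
      using reals_Archimedean2 by blast
    then have "(p - y) \<bullet> (p - y) < real n * (2 * ((p - y) \<bullet> v))"
      using p(2) by (simp add: pos_divide_less_eq)
    then have "v \<in> U n" using p(1) by (auto simp: U_def algebra_simps)
    then show "v \<in> (\<Union>n. U n)" by blast
  qed
  obtain C where C: "finite C" "sphere 0 1 \<subseteq> (\<Union>n\<in>C. U n)"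
    using compactE_image[OF compact_sphere[of "0::'a" 1], of UNIV U] op cov by metis
  define N where "N = Max (insert 0 C)"
  have key: "\<exists>p\<in>P. (p - y) \<bullet> (p - y) < 2 * real N * ((p - y) \<bullet> v)" if v: "v \<in> sphere 0 1" for v
  proof -
    obtain n p where n: "n \<in> C" "p \<in> P" "(p - y) \<bullet> (p - y) < 2 * real n * ((p - y) \<bullet> v)"
      using C(2) v unfolding U_def by blast
    have "0 \<le> (p - y) \<bullet> (p - y)" by simp
    then have "0 < 2 * real n * ((p - y) \<bullet> v)" using n(3) by linarith
    then have pos: "0 < (p - y) \<bullet> v" by (auto simp: zero_less_mult_iff)
    have "n \<le> N" using C(1) n(1) by (simp add: N_def)
    then have "2 * real n * ((p - y) \<bullet> v) \<le> 2 * real N * ((p - y) \<bullet> v)"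
      using pos by (intro mult_right_mono) auto
    then show ?thesis using n by force
  qed
  show ?thesis
  proof (intro exI[of _ "real N"] allI impI, rule ccontr)
    fix c assume c: "\<forall>p\<in>P. 0 \<le> (p - y) \<bullet> (p - y) - 2 * ((c - y) \<bullet> (p - y))"
      and "\<not> dist c y \<le> real N"
    then have gt: "norm (c - y) > real N" by (simp add: dist_norm)
    then have n0: "norm (c - y) > 0" by linarith
    define v where "v = (1 / norm (c - y)) *\<^sub>R (c - y)"
    have cv: "c - y = norm (c - y) *\<^sub>R v" using n0 by (simp add: v_def)
    have "v \<in> sphere 0 1" using n0 by (simp add: v_def)
    then obtain p where p: "p \<in> P" "(p - y) \<bullet> (p - y) < 2 * real N * ((p - y) \<bullet> v)"
      using key by blast
    have "0 \<le> (p - y) \<bullet> (p - y)" by simp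
    then have "0 < 2 * real N * ((p - y) \<bullet> v)" using p(2) by linarith
    then have pos: "0 < (p - y) \<bullet> v" by (auto simp: zero_less_mult_iff)
    have "2 * real N * ((p - y) \<bullet> v) \<le> 2 * norm (c - y) * ((p - y) \<bullet> v)"
      using pos gt by (intro mult_right_mono) auto
    also have "\<dots> = 2 * ((c - y) \<bullet> (p - y))"
      by (subst cv) (simp add: inner_commute)
    finally show False using bspec[OF c p(1)] p(2) by linarith
  qed
qed

text \<open>The power of \<open>y\<close> with respect to the largest empty disc centred at \<open>c\<close> is a concave piecewise
  affine function of \<open>c\<close>, which has bounded superlevel sets since \<open>y\<close> is surrounded. A maximiser as far
  as possible from \<open>y\<close> is a vertex, that is, the centre of a Delaunay disc.\<close>

lemma exists_large_delaunay_disc: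
  fixes P :: "(real^2) set"
  assumes lf: "locally_finite P" and sur: "surrounded P y"
    and d: "d > 0" "\<And>p. p \<in> P \<Longrightarrow> d \<le> dist y p"
  shows "\<exists>T\<in>del P. d \<le> circumradius T \<and> y \<in> circumball T"
proof -
  \<comment> \<open>The squared distance from \<open>c\<close> to \<open>p\<close> minus that from
    \<open>c\<close> to \<open>y\<close>: affine in \<open>c\<close>, so the minimum over
    \<open>p\<close> is the concave function to be maximised.\<close>
  define L where "L p c = (p - y) \<bullet> (p - y) - 2 * ((c - y) \<bullet> (p - y))" for p c
  have L_eq: "(dist c p)\<^sup>2 = (dist c y)\<^sup>2 + L p c" for c p
  proof -
    have "c - p = (c - y) - (p - y)" by simp
    then show ?thesis unfolding L_def dist_norm power2_norm_eq_inner
      by (simp only: inner_diff_left inner_diff_right) (simp add: inner_commute)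
  qed
  have L_move: "L p (c + t *\<^sub>R v) = L p c - 2 * t * (v \<bullet> (p - y))" for p c t v
    by (simp add: L_def inner_add_left inner_diff_left algebra_simps)
  obtain N where "\<forall>c. (\<forall>p\<in>P. 0 \<le> L p c) \<longrightarrow> dist c y \<le> N"
    using surrounded_bounded_centers[OF sur] unfolding L_def by blast
  then have N: "dist c y \<le> N" if "\<And>p. p \<in> P \<Longrightarrow> 0 \<le> L p c" for c
    using that by blast
  have "axis 1 1 \<noteq> (0 :: real^2)" by (simp add: axis_eq_0_iff)
  then obtain p0 where p0: "p0 \<in> P" using sur by (auto simp: surrounded_def)
  \<comment> \<open>The part of the hypograph above level \<open>d\<^sup>2\<close>. It is bounded
    because all \<open>L p c\<close> are nonnegative there, which puts \<open>c\<close> in the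
    Voronoi cell of \<open>y\<close>.\<close>
  define Z where "Z = (\<Inter>p\<in>P. {z. snd z \<le> L p (fst z)}) \<inter> {z. d\<^sup>2 \<le> snd z}"
  have Zsub: "Z \<subseteq> cball y N \<times> {d\<^sup>2 .. norm (p0 - y) * norm (p0 - y) + 2 * (N * norm (p0 - y))}"
  proof
    fix z assume z: "z \<in> Z"
    have h: "d\<^sup>2 \<le> snd z" "\<And>p. p \<in> P \<Longrightarrow> snd z \<le> L p (fst z)" using z by (auto simp: Z_def)
    have "0 \<le> L p (fst z)" if "p \<in> P" for p
      using h(2)[OF that] h(1) zero_le_power2[of d] by linarith
    then have n: "dist (fst z) y \<le> N" by (rule N)
    have "- ((fst z - y) \<bullet> (p0 - y)) \<le> norm (fst z - y) * norm (p0 - y)"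
      using Cauchy_Schwarz_ineq2[of "fst z - y" "p0 - y"] by linarith
    also have "\<dots> \<le> N * norm (p0 - y)" using n by (intro mult_right_mono) (auto simp: dist_norm)
    finally have "L p0 (fst z) \<le> norm (p0 - y) * norm (p0 - y) + 2 * (N * norm (p0 - y))"
      unfolding L_def by (simp add: dot_square_norm power2_eq_square)
    then show "z \<in> cball y N \<times> {d\<^sup>2 .. norm (p0 - y) * norm (p0 - y) + 2 * (N * norm (p0 - y))}"
      using n h(1) h(2)[OF p0] by (simp add: mem_Times_iff dist_commute)
  qed
  have "closed Z" unfolding Z_def L_def
    by (intro closed_Int closed_INT ballI closed_Collect_le continuous_intros)
  moreover have "bounded Z"
    by (rule bounded_subset[OF _ Zsub]) (intro bounded_Times bounded_cball bounded_closed_interval)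
  ultimately have cpZ: "compact Z" by (simp add: compact_eq_bounded_closed)
  have yZ: "(y, d\<^sup>2) \<in> Z"
  proof -
    have "d\<^sup>2 \<le> L p y" if "p \<in> P" for p
    proof -
      have "L p y = (dist y p)\<^sup>2" using L_eq[of y p] by simp
      then show ?thesis using d(2)[OF that] d(1) by (simp add: power_mono)
    qed
    then show ?thesis by (simp add: Z_def)
  qed
  have "Z \<noteq> {}" using yZ by blast
  then obtain z where z: "z \<in> Z" "\<And>z'. z' \<in> Z \<Longrightarrow> snd z' \<le> snd z"
    using continuous_attains_sup[OF cpZ, of snd] continuous_on_snd[OF continuous_on_id] by metis
  define h where "h = snd z"
  have hd: "d\<^sup>2 \<le> h" and hL: "\<And>p. p \<in> P \<Longrightarrow> h \<le> L p (fst z)" using z(1) by (auto simp: Z_def h_def)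
  have h0: "0 < h" using hd d(1) by (meson less_le_trans zero_less_power)
  have maxh: "h' \<le> h" if "\<And>p. p \<in> P \<Longrightarrow> h' \<le> L p c'" for h' c'
  proof (cases "d\<^sup>2 \<le> h'")
    case True
    then have "(c', h') \<in> Z" using that by (simp add: Z_def)
    from z(2)[OF this] show ?thesis by (simp add: h_def)
  qed (use hd in simp)
  define C where "C = (\<Inter>p\<in>P. {c. h \<le> L p c})"
  have "closed C" unfolding C_def L_def
    by (intro closed_INT ballI closed_Collect_le continuous_intros)
  moreover have "C \<subseteq> cball y N"
  proof
    fix c assume c: "c \<in> C"
    have "0 \<le> L p c" if "p \<in> P" for p
    proof -
      have "h \<le> L p c" using c that by (simp add: C_def)
      then show ?thesis using h0 by simp
    qed
    from N[OF this] show "c \<in> cball y N" by (simp add: dist_commute)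
  qed
  ultimately have cpC: "compact C"
    by (meson bounded_cball bounded_subset compact_eq_bounded_closed)
  have "C \<noteq> {}" using hL by (auto simp: C_def)
  \<comment> \<open>The maximisers may form a segment; the distance from \<open>y\<close> is convex,
    so a farthest maximiser is an extreme point.\<close>
  have "\<exists>c\<in>C. \<forall>c'\<in>C. dist c' y \<le> dist c y"
    by (rule continuous_attains_sup[OF cpC \<open>C \<noteq> {}\<close>]) (intro continuous_intros)
  then obtain c where c: "c \<in> C" "\<And>c'. c' \<in> C \<Longrightarrow> dist c' y \<le> dist c y" by blast
  have Lc: "h \<le> L p c" if "p \<in> P" for p using c(1) that by (simp add: C_def)
  \<comment> \<open>Constraints that are not tight at \<open>c\<close> stay uniformly loose near
    \<open>c\<close>: finitely many points lie within \<open>R\<close>, and for a point at distance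
    \<open>D > R\<close> from \<open>y\<close> the lower bound \<open>(D - a) * D\<close> exceeds
    \<open>h + 1\<close>.\<close>
  have slack: "\<exists>t0>0. \<forall>p\<in>P. L p c \<noteq> h \<longrightarrow> (\<forall>t. \<bar>t\<bar> \<le> t0 \<longrightarrow> h + t0 \<le> L p (c + t *\<^sub>R v))" for v
  proof -
    define a where "a = 2 * (norm (c - y) + norm v)"
    define R where "R = a + h + 2"
    have a0: "a \<ge> 0" by (simp add: a_def)
    have R0: "R \<ge> 0" using a0 h0 by (simp add: R_def)
    have fin: "finite (P \<inter> cball y R)" using lf by (simp add: locally_finite_def)
    then have fin': "finite {p \<in> P \<inter> cball y R. L p c \<noteq> h}" by (rule rev_finite_subset) auto
    define w where "w = 1 + 2 * norm v * R"
    have w: "w > 0" using R0 by (simp add: w_def add_pos_nonneg)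
    have "0 < (L p c - h) / w" if "p \<in> {p \<in> P \<inter> cball y R. L p c \<noteq> h}" for p
      using that Lc[of p] w by (intro divide_pos_pos) auto
    from finite_positive_lower_bound[OF fin', of "\<lambda>p. (L p c - h) / w", OF this]
    obtain e where e: "0 < e" "\<And>p. p \<in> {p \<in> P \<inter> cball y R. L p c \<noteq> h} \<Longrightarrow> e \<le> (L p c - h) / w"
      by blast
    have "h + min 1 e \<le> L p (c + t *\<^sub>R v)"
      if p: "p \<in> P" "L p c \<noteq> h" and t: "\<bar>t\<bar> \<le> min 1 e" for p t
    proof (cases "dist y p \<le> R")
      case True
      have "e \<le> (L p c - h) / w" using e(2)[of p] p True by simp
      then have e': "e * w \<le> L p c - h" using w by (simp add: pos_le_divide_eq)
      have "2 * t * (v \<bullet> (p - y)) \<le> 2 * (\<bar>t\<bar> * \<bar>v \<bullet> (p - y)\<bar>)"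
        by (simp add: abs_mult[symmetric])
      also have "\<dots> \<le> 2 * (e * (norm v * R))"
      proof -
        have "\<bar>v \<bullet> (p - y)\<bar> \<le> norm v * norm (p - y)" by (rule Cauchy_Schwarz_ineq2)
        also have "\<dots> \<le> norm v * R" using True by (intro mult_left_mono) (auto simp: dist_norm norm_minus_commute)
        finally show ?thesis using t e(1) by (intro mult_left_mono mult_mono) auto
      qed
      finally have "h + e \<le> L p (c + t *\<^sub>R v)" using e' unfolding L_move w_def by (simp add: algebra_simps)
      then show ?thesis by simp
    next
      case False
      define D where "D = norm (p - y)"
      have D: "D > R" using False by (simp add: D_def dist_norm norm_minus_commute)
      have "(c + t *\<^sub>R v - y) \<bullet> (p - y) \<le> norm (c + t *\<^sub>R v - y) * D"
        unfolding D_def by (rule norm_cauchy_schwarz)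
      also have "\<dots> \<le> (norm (c - y) + norm v) * D"
      proof (intro mult_right_mono)
        have "norm (c + t *\<^sub>R v - y) = norm ((c - y) + t *\<^sub>R v)" by (simp add: algebra_simps)
        also have "\<dots> \<le> norm (c - y) + \<bar>t\<bar> * norm v" by (metis norm_scaleR norm_triangle_ineq)
        also have "\<bar>t\<bar> * norm v \<le> 1 * norm v" using t by (intro mult_right_mono) auto
        finally show "norm (c + t *\<^sub>R v - y) \<le> norm (c - y) + norm v" by simp
      qed (simp add: D_def)
      finally have "L p (c + t *\<^sub>R v) \<ge> D * D - a * D"
        unfolding L_def a_def by (simp add: D_def dot_square_norm power2_eq_square algebra_simps)
      moreover have "(h + 1) * 1 \<le> (D - a) * D"
        using D a0 h0 by (intro mult_mono) (auto simp: R_def)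
      ultimately show ?thesis by (simp add: algebra_simps)
    qed
    then show ?thesis using e(1) by (intro exI[of _ "min 1 e"]) auto
  qed
  define Q where "Q = {p \<in> P. L p c = h}"
  \<comment> \<open>Moving \<open>c\<close> along \<open>v\<close> would change all tight
    constraints equally. If \<open>k \<noteq> 0\<close>, one of the two directions raises the
    maximum; if \<open>k = 0\<close>, both directions stay in \<open>C\<close> and one of them
    increases the distance from \<open>y\<close>.\<close>
  have no_const: False if v: "v \<noteq> 0" and k: "\<And>p. p \<in> Q \<Longrightarrow> v \<bullet> (p - y) = k" for v k
  proof -
    obtain t0 where t0: "t0 > 0" "\<And>p t. p \<in> P \<Longrightarrow> L p c \<noteq> h \<Longrightarrow> \<bar>t\<bar> \<le> t0 \<Longrightarrow> h + t0 \<le> L p (c + t *\<^sub>R v)"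
      using slack by blast
    show False
    proof (cases "k = 0")
      case True
      have "c + t *\<^sub>R v \<in> C" if "\<bar>t\<bar> \<le> t0" for t
        unfolding C_def
      proof safe
        fix p assume p: "p \<in> P"
        show "h \<le> L p (c + t *\<^sub>R v)"
        proof (cases "L p c = h")
          case t: True
          then have "v \<bullet> (p - y) = 0" using k[of p] p True by (simp add: Q_def)
          then show ?thesis using t by (simp add: L_move)
        next
          case False
          then show ?thesis using t0(1) t0(2)[OF p False that] by simp
        qed
      qed
      then have "c + t0 *\<^sub>R v \<in> C" "c + (- t0) *\<^sub>R v \<in> C" using t0(1) by (simp_all only: abs_minus_cancel abs_of_pos order_refl)
      then have "dist (c + t0 *\<^sub>R v) y \<le> dist c y" "dist (c + (- t0) *\<^sub>R v) y \<le> dist c y"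
        using c(2) by blast+
      then have "(dist (c + t0 *\<^sub>R v) y)\<^sup>2 \<le> (dist c y)\<^sup>2" "(dist (c + (- t0) *\<^sub>R v) y)\<^sup>2 \<le> (dist c y)\<^sup>2"
        by (auto intro: power_mono)
      moreover have exp: "(dist (c + t *\<^sub>R v) y)\<^sup>2 = (dist c y)\<^sup>2 + 2 * t * ((c - y) \<bullet> v) + t\<^sup>2 * (v \<bullet> v)" for t
      proof -
        have "c + t *\<^sub>R v - y = (c - y) + t *\<^sub>R v" by simp
        then show ?thesis unfolding dist_norm power2_norm_eq_inner
          by (simp only: inner_add_left inner_add_right) (simp add: inner_commute power2_eq_square)
      qed
      ultimately have "(dist c y)\<^sup>2 + 2 * t0 * ((c - y) \<bullet> v) + t0\<^sup>2 * (v \<bullet> v) \<le> (dist c y)\<^sup>2"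
        "(dist c y)\<^sup>2 + 2 * (- t0) * ((c - y) \<bullet> v) + (- t0)\<^sup>2 * (v \<bullet> v) \<le> (dist c y)\<^sup>2"
        by (simp_all only: exp)
      then have "t0\<^sup>2 * (v \<bullet> v) \<le> 0" by simp
      moreover have "t0\<^sup>2 * (v \<bullet> v) > 0" using t0(1) v by simp
      ultimately show False by linarith
    next
      case False
      define t where "t = - sgn k * t0"
      have at: "\<bar>t\<bar> \<le> t0" using t0(1) by (simp add: t_def abs_mult sgn_if)
      have tk: "- (t * k) = t0 * \<bar>k\<bar>" using False by (simp add: t_def sgn_if)
      have "h + min t0 (2 * (t0 * \<bar>k\<bar>)) \<le> h"
      proof (rule maxh)
        fix p assume p: "p \<in> P"
        show "h + min t0 (2 * (t0 * \<bar>k\<bar>)) \<le> L p (c + t *\<^sub>R v)"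
        proof (cases "L p c = h")
          case True
          then have "v \<bullet> (p - y) = k" using k[of p] p by (simp add: Q_def)
          then have "L p (c + t *\<^sub>R v) = h + 2 * (- (t * k))" using True by (simp add: L_move)
          then show ?thesis unfolding tk by simp
        next
          case False
          then show ?thesis using t0(2)[OF p False at] by simp
        qed
      qed
      moreover have "0 < min t0 (2 * (t0 * \<bar>k\<bar>))" using t0(1) False by simp
      ultimately show False by linarith
    qed
  qed
  have py: "p \<noteq> y" if "p \<in> P" for p using d that by fastforce
  \<comment> \<open>Each choice of \<open>v\<close> is constant on the tight points found so far, so
    \<open>no_const\<close> supplies a further one, until three points on one circle are
    available.\<close>
  obtain p1 where p1: "p1 \<in> Q"
    using no_const[OF \<open>axis 1 1 \<noteq> (0 :: real^2)\<close>, of 0] by blast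
  have "rot (p1 - y) \<noteq> 0" using py[of p1] p1 by (simp add: Q_def)
  then obtain p2 where p2: "p2 \<in> Q" "p2 \<noteq> p1"
    using no_const[of "rot (p1 - y)" 0] rot_inner_self(1) by blast
  have "rot (p1 - p2) \<noteq> 0" using p2 by simp
  moreover have "rot (p1 - p2) \<bullet> (p2 - y) = rot (p1 - p2) \<bullet> (p1 - y)"
  proof -
    have "rot (p1 - p2) \<bullet> (p1 - y) - rot (p1 - p2) \<bullet> (p2 - y) = rot (p1 - p2) \<bullet> (p1 - p2)"
      by (simp add: inner_diff_right[symmetric])
    then show ?thesis by simp
  qed
  ultimately obtain p3 where p3: "p3 \<in> Q" "p3 \<noteq> p1" "p3 \<noteq> p2"
    using no_const[of "rot (p1 - p2)" "rot (p1 - p2) \<bullet> (p1 - y)"] by blast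
  have sq: "(dist c p)\<^sup>2 = (dist c y)\<^sup>2 + h" if "p \<in> Q" for p
    using that L_eq[of c p] by (simp add: Q_def)
  define \<rho> where "\<rho> = dist c p1"
  have dQ: "dist c p = \<rho>" if "p \<in> Q" for p
    unfolding \<rho>_def using sq[OF that] sq[OF p1] by (intro power2_eq_imp_eq[of "dist c p"]) simp_all
  let ?T = "{p1, p2, p3}"
  have nc: "\<not> collinear ?T"
    by (rule concyclic_noncollinear[of _ _ _ c \<rho>]) (use p1 p2 p3 dQ in auto)
  have sub: "?T \<subseteq> P" using p1 p2 p3 by (auto simp: Q_def)
  have far: "\<rho> \<le> dist c p" if "p \<in> P" for p
  proof -
    have "\<rho>\<^sup>2 \<le> (dist c p)\<^sup>2"
      using Lc[OF that] L_eq[of c p] sq[OF p1] unfolding \<rho>_def by linarith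
    then show ?thesis by (rule power2_le_imp_le) simp
  qed
  have on: "dist c p = \<rho>" if "p \<in> ?T" for p using that p1 p2 p3 dQ by blast
  note T = delI[OF sub noncollinear_distinct(4)[OF nc] nc on far]
  have "d\<^sup>2 \<le> \<rho>\<^sup>2" using sq[OF p1] hd zero_le_power2[of "dist c y"] unfolding \<rho>_def by linarith
  then have "d \<le> \<rho>" by (rule power2_le_imp_le) (simp add: \<rho>_def)
  moreover have "dist c y < \<rho>"
  proof (rule power2_less_imp_less)
    show "(dist c y)\<^sup>2 < \<rho>\<^sup>2" using sq[OF p1] h0 unfolding \<rho>_def by linarith
  qed (simp add: \<rho>_def)
  ultimately show ?thesis using T by (intro bexI[of _ ?T]) (auto simp: circumball_def)
qed

section \<open>Separated and covering sets, and their robust modification\<close>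

definition separated :: "real \<Rightarrow> 'a::metric_space set \<Rightarrow> bool" where
  "separated r P \<longleftrightarrow> (\<forall>p\<in>P. \<forall>q\<in>P. p \<noteq> q \<longrightarrow> r < dist p q)"

definition covering :: "real \<Rightarrow> 'a::metric_space set \<Rightarrow> bool" where
  "covering \<alpha> P \<longleftrightarrow> (\<forall>y. \<exists>p\<in>P. dist y p < \<alpha>)"

text \<open>A ball of radius \<open>\<alpha>\<close> without points would force a Delaunay disc at
  least as large.\<close>

lemma covering_of_circumradius_less:
  fixes P :: "(real^2) set"
  assumes "locally_finite P" "\<And>y. surrounded P y" "\<alpha> > 0"
    and "\<And>T. T \<in> del P \<Longrightarrow> circumradius T < \<alpha>"
  shows "covering \<alpha> P"
  unfolding covering_def
proof (rule ccontr)
  assume "\<not> (\<forall>y. \<exists>p\<in>P. dist y p < \<alpha>)"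
  then obtain y where "\<And>p. p \<in> P \<Longrightarrow> \<alpha> \<le> dist y p" by (metis not_less)
  from exists_large_delaunay_disc[OF assms(1,2,3) this] assms(4) show False by fastforce
qed

text \<open>The centre of the disc has a point within \<open>\<alpha>\<close>, but the open disc is
  empty. Two sets occur because the bound is also applied after a point has been inserted.\<close>

lemma circumradius_less_of_covering:
  assumes "covering \<alpha> P" "T \<in> del P'" "P \<subseteq> P'"
  shows "circumradius T < \<alpha>"
proof -
  obtain p where "p \<in> P" "dist (circumcenter T) p < \<alpha>" using assms(1) by (auto simp: covering_def)
  then show ?thesis using delD(7)[OF assms(2), of p] assms(3) by force
qed

text \<open>Packing bound: finitely many balls of radius \<open>s / 2\<close> cover the set, and
  each contains at most one of the separated points.\<close>

lemma separated_card_bounded: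
  fixes S :: "'a::heine_borel set"
  assumes "bounded S" "s > 0"
  shows "\<exists>N. \<forall>A\<subseteq>S. (\<forall>a\<in>A. \<forall>b\<in>A. a \<noteq> b \<longrightarrow> s \<le> dist a b) \<longrightarrow> finite A \<and> card A \<le> N"
proof -
  have "compact (closure S)" using assms(1) by simp
  then obtain k where k: "finite k" "closure S \<subseteq> (\<Union>x\<in>k. ball x (s / 2))"
    using assms(2) unfolding compact_eq_totally_bounded by (metis half_gt_zero)
  show ?thesis
  proof (intro exI allI impI)
    fix A assume A: "A \<subseteq> S" and sep: "\<forall>a\<in>A. \<forall>b\<in>A. a \<noteq> b \<longrightarrow> s \<le> dist a b"
    have "\<forall>a\<in>A. \<exists>x\<in>k. a \<in> ball x (s / 2)"
      using A k(2) closure_subset[of S] by blast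
    then obtain g where g: "\<And>a. a \<in> A \<Longrightarrow> g a \<in> k" "\<And>a. a \<in> A \<Longrightarrow> dist (g a) a < s / 2"
      by (metis mem_ball)
    have "inj_on g A"
    proof (rule inj_onI, rule ccontr)
      fix a b assume ab: "a \<in> A" "b \<in> A" "g a = g b" "a \<noteq> b"
      have "dist a b \<le> dist (g a) a + dist (g a) b" by (rule dist_triangle3)
      also have "\<dots> < s" using g(2)[OF ab(1)] g(2)[OF ab(2)] ab(3) by simp
      finally show False using sep ab(1,2,4) by force
    qed
    moreover have "g ` A \<subseteq> k" using g(1) by auto
    ultimately show "finite A \<and> card A \<le> card k"
      using k(1) by (meson card_inj_on_le inj_on_finite)
  qed
qed

text \<open>Among the separated subsets of \<open>S\<close> that keep distance \<open>s\<close> from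
  the prescribed points \<open>F\<close>, one of largest cardinality cannot be extended; this is
  exactly the covering property.\<close>

lemma maximal_separated_subset:
  fixes S F :: "'a::heine_borel set"
  assumes "bounded S" "s > 0"
  shows "\<exists>A. finite A \<and> A \<subseteq> S \<and> (\<forall>a\<in>A. \<forall>b\<in>A. a \<noteq> b \<longrightarrow> s \<le> dist a b)
    \<and> (\<forall>a\<in>A. \<forall>f\<in>F. s \<le> dist a f) \<and> (\<forall>y\<in>S. \<exists>z\<in>A \<union> F. dist y z < s)"
proof -
  define Q where "Q A \<longleftrightarrow> A \<subseteq> S \<and> (\<forall>a\<in>A. \<forall>b\<in>A. a \<noteq> b \<longrightarrow> s \<le> dist a b) \<and> (\<forall>a\<in>A. \<forall>f\<in>F. s \<le> dist a f)"
    for A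
  obtain N where N: "\<forall>A\<subseteq>S. (\<forall>a\<in>A. \<forall>b\<in>A. a \<noteq> b \<longrightarrow> s \<le> dist a b) \<longrightarrow> finite A \<and> card A \<le> N"
    using separated_card_bounded[OF assms] by blast
  have QN: "finite A \<and> card A \<le> N" if "Q A" for A
    using that N by (simp add: Q_def)
  have Q0: "Q {}" by (simp add: Q_def)
  have "\<exists>A. Q A \<and> (\<forall>B. Q B \<longrightarrow> card B \<le> card A)"
  proof (rule ex_has_greatest_nat)
    show "Q {}" by (rule Q0)
    show "\<forall>B. Q B \<longrightarrow> card B < Suc N" using QN by (simp add: less_Suc_eq_le)
  qed
  then obtain A where A: "Q A" "\<And>B. Q B \<Longrightarrow> card B \<le> card A" by blast
  have AQ: "finite A" "A \<subseteq> S" "\<forall>a\<in>A. \<forall>b\<in>A. a \<noteq> b \<longrightarrow> s \<le> dist a b" "\<forall>a\<in>A. \<forall>f\<in>F. s \<le> dist a f"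
    using QN[OF A(1)] A(1) by (auto simp: Q_def)
  have "\<forall>y\<in>S. \<exists>z\<in>A \<union> F. dist y z < s"
  proof
    show "\<exists>z\<in>A \<union> F. dist y z < s" if y: "y \<in> S" for y
    proof (rule ccontr)
      assume "\<not> ?thesis"
      then have far: "s \<le> dist y z" if "z \<in> A \<union> F" for z using that by force
      have "y \<notin> A" using far[of y] assms(2) by auto
      have "Q (insert y A)"
        using A(1) y far unfolding Q_def by (auto simp: dist_commute)
      from A(2)[OF this] show False using \<open>y \<notin> A\<close> AQ(1) by simp
    qed
  qed
  with AQ show ?thesis by blast
qed

text \<open>A large empty disc: the disc of radius \<open>s\<close> is emptied, its circle is first filled with points
  at distance at least \<open>s\<close>, so that the arcs between neighbours are smaller than one sixth of the circle
  and the disc remains covered by the discs of radius \<open>s\<close> around these points.\<close>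

lemma exists_empty_disc_modification:
  fixes P :: "(real^2) set"
  assumes lf: "locally_finite P" and sep: "separated r P" and cov: "covering \<alpha> P"
    and s: "0 < s" "r < s" "s < \<alpha>" and M: "M = 2 * s + \<alpha> + 1"
  obtains Q where "locally_finite Q" "separated r Q" "covering \<alpha> Q" "\<And>q. q \<in> Q \<Longrightarrow> s \<le> norm q"
    "Q - ball 0 M = P - ball 0 M"
proof -
  obtain A1 where A1: "finite A1" "A1 \<subseteq> sphere (0::real^2) s"
    "\<forall>a\<in>A1. \<forall>b\<in>A1. a \<noteq> b \<longrightarrow> s \<le> dist a b"
    "\<forall>y\<in>sphere (0::real^2) s. \<exists>z\<in>A1 \<union> {}. dist y z < s"
    using maximal_separated_subset[OF bounded_sphere[of "0::real^2" s] s(1), of "{}"] by blast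
  \<comment> \<open>The radius \<open>2 * s\<close> keeps the retained points at distance at least
    \<open>s\<close> from the points on the circle of radius \<open>s\<close>.\<close>
  define P1 where "P1 = P - ball 0 (2 * s)"
  \<comment> \<open>The annulus extends to \<open>2 * s + \<alpha>\<close> because only beyond this
    norm are the old covering points certain to be in \<open>P1\<close>.\<close>
  define S where "S = cball (0::real^2) (2 * s + \<alpha>) - ball 0 s"
  have "bounded S" unfolding S_def by (rule bounded_subset[OF bounded_cball]) auto
  from maximal_separated_subset[OF this s(1), of "A1 \<union> P1"]
  obtain A2 where A2: "finite A2" "A2 \<subseteq> S"
    "\<forall>a\<in>A2. \<forall>b\<in>A2. a \<noteq> b \<longrightarrow> s \<le> dist a b"
    "\<forall>a\<in>A2. \<forall>f\<in>A1 \<union> P1. s \<le> dist a f"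
    "\<forall>y\<in>S. \<exists>z\<in>A2 \<union> (A1 \<union> P1). dist y z < s"
    by blast
  define Q where "Q = A1 \<union> A2 \<union> P1"
  show ?thesis
  proof
    show "locally_finite Q"
      using lf A1(1) A2(1) unfolding locally_finite_def Q_def P1_def
      by (auto simp: Int_Un_distrib2 Int_Diff Diff_Int_distrib2 intro: finite_subset[of "(P - _) \<inter> _" "P \<inter> _"])
    have s13: "s \<le> dist a p" if "a \<in> A1" "p \<in> P1" for a p
    proof -
      have "norm a = s" "2 * s \<le> norm p" using that A1(2) by (auto simp: P1_def)
      then show ?thesis using norm_triangle_ineq2[of p a] by (simp add: dist_norm norm_minus_commute)
    qed
    have sepQ: "s \<le> dist a b \<or> a \<in> P1 \<and> b \<in> P1" if ab: "a \<in> Q" "b \<in> Q" "a \<noteq> b" for a b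
    proof -
      consider "a \<in> P1 \<and> b \<in> P1" | "a \<in> A1 \<and> b \<in> A1" | "a \<in> A1 \<and> b \<in> P1" | "a \<in> P1 \<and> b \<in> A1"
        | "a \<in> A2 \<and> b \<in> A2" | "a \<in> A2 \<and> b \<in> A1 \<union> P1" | "b \<in> A2 \<and> a \<in> A1 \<union> P1"
        using ab(1,2) unfolding Q_def by blast
      then show ?thesis
      proof cases
        case 1 then show ?thesis by blast
      next
        case 2 then show ?thesis using A1(3) ab(3) by blast
      next
        case 3 then show ?thesis using s13 by blast
      next
        case 4 then show ?thesis using s13[of b a] by (simp add: dist_commute)
      next
        case 5 then show ?thesis using A2(3) ab(3) by blast
      next
        case 6 then show ?thesis using A2(4) by blast
      next
        case 7 then show ?thesis using bspec[OF bspec[OF A2(4)], of b a] by (simp add: dist_commute)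
      qed
    qed
    show "separated r Q"
      unfolding separated_def
    proof (intro ballI impI)
      fix a b assume ab: "a \<in> Q" "b \<in> Q" "a \<noteq> b"
      show "r < dist a b"
      proof (cases "a \<in> P1 \<and> b \<in> P1")
        case True
        then show ?thesis using sep ab(3) by (simp add: separated_def P1_def)
      next
        case False
        then show ?thesis using sepQ[OF ab] s(2) by linarith
      qed
    qed
    show "covering \<alpha> Q"
      unfolding covering_def
    proof
      fix y :: "real^2"
      consider "norm y < s" | "s \<le> norm y" "norm y \<le> 2 * s + \<alpha>" | "2 * s + \<alpha> < norm y" by linarith
      then show "\<exists>p\<in>Q. dist y p < \<alpha>"
      proof cases
        case 1
        obtain v where v: "norm v = 1" "y = norm y *\<^sub>R v"
        proof (cases "y = 0")
          case True
          then show ?thesis using that[of "axis 1 1"] by (simp add: norm_axis_1)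
        next
          case False
          then show ?thesis using that[of "(1 / norm y) *\<^sub>R y"] by simp
        qed
        have "s *\<^sub>R v \<in> sphere 0 s" using v(1) s(1) by simp
        \<comment> \<open>For \<open>y\<close> inside the emptied disc, \<open>a\<close> is chosen
          near the radial projection \<open>s v\<close> of \<open>y\<close>. Its angle with
          \<open>y\<close> is below 60 degrees, so \<open>v \<bullet> a > s / 2\<close> and the
          squared distance is at most \<open>t\<^sup>2 - t s + s\<^sup>2\<close>, which is at most
          \<open>s\<^sup>2\<close> for \<open>t\<close> between 0 and \<open>s\<close>.\<close>
        then obtain a where a: "a \<in> A1" "dist (s *\<^sub>R v) a < s" using A1(4) by blast
        have na: "norm a = s" using a(1) A1(2) by auto
        have vv: "v \<bullet> v = 1" "a \<bullet> a = s\<^sup>2" using v(1) na by (simp_all add: dot_square_norm)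
        have "(dist (s *\<^sub>R v) a)\<^sup>2 < s\<^sup>2" using a(2) by (intro power_strict_mono) auto
        then have "s\<^sup>2 - 2 * s * (v \<bullet> a) + s\<^sup>2 < s\<^sup>2"
          unfolding dist_norm power2_norm_eq_inner using vv
          by (simp add: inner_diff_left inner_diff_right inner_commute power2_eq_square algebra_simps)
        then have va: "s / 2 < v \<bullet> a" using s(1) by (simp add: power2_eq_square)
        define t where "t = norm y"
        have t: "0 \<le> t" "t < s" using 1 by (auto simp: t_def)
        have "(dist y a)\<^sup>2 = t\<^sup>2 - 2 * t * (v \<bullet> a) + s\<^sup>2"
          unfolding dist_norm power2_norm_eq_inner using vv
          by (subst (1 2) v(2)) (simp add: t_def[symmetric] inner_diff_left inner_diff_right inner_commute power2_eq_square algebra_simps)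
        also have "\<dots> \<le> t\<^sup>2 - 2 * t * (s / 2) + s\<^sup>2"
          using va t by (intro add_right_mono diff_left_mono mult_left_mono) auto
        also have "\<dots> \<le> s\<^sup>2" using t by (simp add: power2_eq_square mult_left_mono)
        finally have "dist y a \<le> s" by (rule power2_le_imp_le) (use s(1) in simp)
        then show ?thesis using a(1) s(3) by (intro bexI[of _ a]) (auto simp: Q_def)
      next
        case 2
        then have "y \<in> S" by (simp add: S_def)
        then obtain z where "z \<in> A2 \<union> (A1 \<union> P1)" "dist y z < s" using A2(5) by blast
        then show ?thesis using s(3) by (intro bexI[of _ z]) (auto simp: Q_def)
      next
        case 3
        obtain p where p: "p \<in> P" "dist y p < \<alpha>" using cov by (auto simp: covering_def)
        have "norm y \<le> dist y p + norm p" by (metis dist_norm norm_triangle_sub add.commute)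
        then have "p \<in> P1" using p 3 by (simp add: P1_def)
        then show ?thesis using p by (auto simp: Q_def)
      qed
    qed
    show "s \<le> norm q" if "q \<in> Q" for q
      using that A1(2) A2(2) s(1) by (auto simp: Q_def P1_def S_def)
    \<comment> \<open>All added points have norm at most \<open>2 * s + \<alpha>\<close>; the extra
      1 in \<open>M\<close> puts them strictly inside the open ball.\<close>
    have "A1 \<subseteq> ball 0 M" "A2 \<subseteq> ball 0 M" using A1(2) A2(2) s by (auto simp: M S_def)
    moreover have "P1 - ball 0 M = P - ball 0 M" using s by (auto simp: P1_def M)
    ultimately show "Q - ball 0 M = P - ball 0 M" by (auto simp: Q_def)
  qed
qed

text \<open>Separation, covering and emptiness hold with uniform slack inside a bounded region, so
  every point of \<open>Q\<close> in the ball may be moved by \<open>\<epsilon>\<close>. The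
  hypotheses on \<open>Q'\<close> only prescribe counts in disjoint sets, an event whose probability
  a Poisson process makes explicit.\<close>

lemma perturbation_stable:
  fixes Q :: "'a::euclidean_space set"
  assumes lf: "locally_finite Q" and sep: "separated r Q" and cov: "covering \<alpha> Q"
    and s: "\<And>q. q \<in> Q \<Longrightarrow> s \<le> norm q" and \<rho>: "\<rho> < s" and M: "s \<le> M" and r: "0 < r"
  obtains \<epsilon> where "\<epsilon> > 0" "\<And>p. p \<in> Q \<inter> ball 0 M \<Longrightarrow> ball p \<epsilon> \<subseteq> ball 0 M"
    "\<And>p q. p \<in> Q \<inter> ball 0 M \<Longrightarrow> q \<in> Q \<inter> ball 0 M \<Longrightarrow> p \<noteq> q \<Longrightarrow> ball p \<epsilon> \<inter> ball q \<epsilon> = {}"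
    "\<And>Q'. Q' - ball 0 M = Q - ball 0 M \<Longrightarrow> (\<And>p. p \<in> Q \<inter> ball 0 M \<Longrightarrow> \<exists>w. Q' \<inter> ball p \<epsilon> = {w})
      \<Longrightarrow> Q' \<inter> ball 0 M \<subseteq> (\<Union>p\<in>Q \<inter> ball 0 M. ball p \<epsilon>)
      \<Longrightarrow> separated r Q' \<and> covering \<alpha> Q' \<and> (\<forall>q\<in>Q'. \<rho> \<le> norm q)"
proof -
  define F where "F = Q \<inter> ball 0 M"
  have finF: "finite F" using lf by (simp add: F_def locally_finite_def)
  have "0 < M - norm p" if "p \<in> F" for p using that by (simp add: F_def)
  from finite_positive_lower_bound[OF finF, of "\<lambda>p. M - norm p", OF this]
  obtain e1 where e1: "0 < e1" "\<And>p. p \<in> F \<Longrightarrow> e1 \<le> M - norm p" by blast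
  \<comment> \<open>A point beyond \<open>M + r + 2\<close> is farther than \<open>r + 2\<close>
    from every movable point, so only finitely many pairs matter; half of the excess over
    \<open>r\<close> lets both points of a pair move.\<close>
  define G where "G = {(p, q). p \<in> F \<and> q \<in> Q \<inter> ball 0 (M + r + 2) \<and> p \<noteq> q}"
  have "finite (Q \<inter> ball 0 (M + r + 2))" using lf by (simp add: locally_finite_def)
  then have "finite (F \<times> (Q \<inter> ball 0 (M + r + 2)))" using finF by simp
  then have finG: "finite G" by (rule rev_finite_subset) (auto simp: G_def)
  have posG: "0 < (\<lambda>(p, q). (dist p q - r) / 2) g" if "g \<in> G" for g
    using that sep by (auto simp: G_def F_def separated_def)
  from finite_positive_lower_bound[OF finG, of "\<lambda>g. case g of (p, q) \<Rightarrow> (dist p q - r) / 2", OF posG]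
  obtain e2 where e2: "0 < e2" "\<And>g. g \<in> G \<Longrightarrow> e2 \<le> (\<lambda>(p, q). (dist p q - r) / 2) g" by blast
  have "Q \<noteq> {}" using cov by (auto simp: covering_def)
  have inf_less: "infdist y Q < \<alpha>" for y
  proof -
    obtain z where "z \<in> Q" "dist y z < \<alpha>" using cov by (auto simp: covering_def)
    then show ?thesis using infdist_le[of z Q y] by simp
  qed
  \<comment> \<open>The distance to \<open>Q\<close> is continuous and below
    \<open>\<alpha>\<close>, hence at most some \<open>m < \<alpha>\<close> on a compact ball.
    Outside that ball the covering points have norm at least \<open>M\<close> and do not
    move.\<close>
  obtain m where m: "m < \<alpha>" "\<And>y. y \<in> cball 0 (M + \<alpha>) \<Longrightarrow> infdist y Q \<le> m"
  proof (cases "cball (0::'a) (M + \<alpha>) = {}")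
    case True
    then show ?thesis using that[of "\<alpha> - 1"] by auto
  next
    case False
    have "continuous_on (cball (0::'a) (M + \<alpha>)) (\<lambda>y. infdist y Q)"
      by (intro continuous_on_infdist continuous_on_id)
    from continuous_attains_sup[OF compact_cball False this]
    obtain y0 :: 'a where "\<forall>y\<in>cball 0 (M + \<alpha>). infdist y Q \<le> infdist y0 Q" by blast
    then show ?thesis using that[of "infdist y0 Q"] inf_less by blast
  qed
  define e3 where "e3 = (\<alpha> - m) / 2"
  have e3: "0 < e3" using m(1) by (simp add: e3_def)
  define \<epsilon> where "\<epsilon> = min (min e1 (min e2 1)) (min e3 (s - \<rho>))"
  have \<epsilon>: "0 < \<epsilon>" "\<epsilon> \<le> e1" "\<epsilon> \<le> e2" "\<epsilon> \<le> 1" "\<epsilon> \<le> e3" "\<epsilon> \<le> s - \<rho>"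
    using e1(1) e2(1) e3 \<rho> by (auto simp: \<epsilon>_def)
  have far: "r + 2 * \<epsilon> \<le> dist p q" if "p \<in> F" "q \<in> Q" "p \<noteq> q" for p q
  proof (cases "q \<in> ball 0 (M + r + 2)")
    case True
    then have "(p, q) \<in> G" using that by (simp add: G_def)
    from e2(2)[OF this] show ?thesis using \<epsilon>(3) by simp
  next
    case False
    have "norm q \<le> dist p q + norm p" by (metis dist_commute dist_norm norm_triangle_sub add.commute)
    then show ?thesis using False that(1) \<epsilon>(4) by (simp add: F_def)
  qed
  have subM: "ball p \<epsilon> \<subseteq> ball 0 M" if "p \<in> F" for p
  proof
    fix w assume "w \<in> ball p \<epsilon>"
    then have "dist p w < \<epsilon>" by simp
    moreover have "norm w \<le> dist p w + norm p"
      by (metis dist_commute dist_norm norm_triangle_sub add.commute)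
    ultimately show "w \<in> ball 0 M" using e1(2)[OF that] \<epsilon>(2) by simp
  qed
  show ?thesis
  proof (rule that[OF \<epsilon>(1)])
    show "ball p \<epsilon> \<subseteq> ball 0 M" if "p \<in> Q \<inter> ball 0 M" for p using subM that by (simp add: F_def)
    show "ball p \<epsilon> \<inter> ball q \<epsilon> = {}" if "p \<in> Q \<inter> ball 0 M" "q \<in> Q \<inter> ball 0 M" "p \<noteq> q" for p q
    proof -
      have "2 * \<epsilon> \<le> dist p q" using far[of p q] that r by (simp add: F_def)
      then show ?thesis by (intro disjoint_ballI) simp
    qed
    fix Q' assume out: "Q' - ball 0 M = Q - ball 0 M"
      and one: "\<And>p. p \<in> Q \<inter> ball 0 M \<Longrightarrow> \<exists>w. Q' \<inter> ball p \<epsilon> = {w}"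
      and cover: "Q' \<inter> ball 0 M \<subseteq> (\<Union>p\<in>Q \<inter> ball 0 M. ball p \<epsilon>)"
    have inside: "\<exists>p\<in>F. dist p w < \<epsilon>" if "w \<in> Q'" "w \<in> ball 0 M" for w
      using cover that unfolding F_def by fastforce
    have out_iff: "w \<in> Q' \<longleftrightarrow> w \<in> Q" if "w \<notin> ball 0 M" for w
    proof -
      have "w \<in> Q' - ball 0 M \<longleftrightarrow> w \<in> Q - ball 0 M" by (simp only: out)
      then show ?thesis using that by simp
    qed
    have outside: "w \<in> Q" "w \<notin> F" if "w \<in> Q'" "w \<notin> ball 0 M" for w
      using that out_iff by (simp_all add: F_def)
    have mixed: "r < dist w w'" if w: "w \<in> Q'" "w \<in> ball 0 M" "w' \<in> Q'" "w' \<notin> ball 0 M" for w w'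
    proof -
      obtain p where p: "p \<in> F" "dist p w < \<epsilon>" using inside[OF w(1,2)] by blast
      have "r + 2 * \<epsilon> \<le> dist p w'" using far[OF p(1), of w'] outside[OF w(3,4)] p(1) by fastforce
      also have "\<dots> \<le> dist p w + dist w w'" by (rule dist_triangle)
      finally show ?thesis using p(2) \<epsilon>(1) by linarith
    qed
    have "separated r Q'"
      unfolding separated_def
    proof (intro ballI impI)
      fix w w' assume w: "w \<in> Q'" "w' \<in> Q'" "w \<noteq> w'"
      consider "w \<in> ball 0 M" "w' \<in> ball 0 M" | "w \<in> ball 0 M" "w' \<notin> ball 0 M"
        | "w \<notin> ball 0 M" "w' \<in> ball 0 M" | "w \<notin> ball 0 M" "w' \<notin> ball 0 M" by blast
      then show "r < dist w w'"
      proof cases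
        case 1
        obtain p where p: "p \<in> F" "dist p w < \<epsilon>" using inside[OF w(1) 1(1)] by blast
        obtain p' where p': "p' \<in> F" "dist p' w' < \<epsilon>" using inside[OF w(2) 1(2)] by blast
        have "p \<noteq> p'"
        proof
          assume eq: "p = p'"
          have "p \<in> Q \<inter> ball 0 M" using p(1) by (simp only: F_def)
          from one[OF this] obtain u where u: "Q' \<inter> ball p \<epsilon> = {u}" by (rule exE)
          have "w \<in> Q' \<inter> ball p \<epsilon>" "w' \<in> Q' \<inter> ball p \<epsilon>" using w(1,2) p(2) p'(2) eq by simp_all
          then have "w \<in> {u}" "w' \<in> {u}" unfolding u by simp_all
          then show False using w(3) by simp
        qed
        then have "r + 2 * \<epsilon> \<le> dist p p'" using far p(1) p'(1) by (simp add: F_def)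
        also have "\<dots> \<le> dist p w + (dist w w' + dist w' p')"
          by (metis add_left_mono dist_triangle order_trans)
        finally show ?thesis using p(2) p'(2) by (simp add: dist_commute)
      next
        case 2 then show ?thesis using mixed w by blast
      next
        case 3 then show ?thesis using mixed[of w' w] w by (simp add: dist_commute)
      next
        case 4 then show ?thesis using outside w sep by (auto simp: separated_def)
      qed
    qed
    moreover have "covering \<alpha> Q'"
      unfolding covering_def
    proof
      fix y :: 'a
      show "\<exists>p\<in>Q'. dist y p < \<alpha>"
      proof (cases "y \<in> cball 0 (M + \<alpha>)")
        case True
        have "infdist y Q < m + e3" using m(2)[OF True] e3 by linarith
        then have "(INF z\<in>Q. dist y z) < m + e3" using \<open>Q \<noteq> {}\<close> by (simp add: infdist_def)
        then obtain z where z: "z \<in> Q" "dist y z < m + e3"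
          using \<open>Q \<noteq> {}\<close> by (subst (asm) cINF_less_iff) auto
        have z': "dist y z + \<epsilon> < \<alpha>" using z(2) \<epsilon>(5) by (simp add: e3_def field_simps)
        show ?thesis
        proof (cases "z \<in> ball 0 M")
          case True
          then have "z \<in> Q \<inter> ball 0 M" using z(1) by simp
          from one[OF this] obtain w where "Q' \<inter> ball z \<epsilon> = {w}" by (rule exE)
          then have "w \<in> Q' \<inter> ball z \<epsilon>" by simp
          then have w: "w \<in> Q'" "dist z w < \<epsilon>" by simp_all
          have "dist y w \<le> dist y z + dist z w" by (rule dist_triangle)
          then show ?thesis using w z' by (intro bexI[of _ w]) auto
        next
          case False
          then have "z \<in> Q'" using out_iff z(1) by blast
          then show ?thesis using z' \<epsilon>(1) by (intro bexI[of _ z]) auto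
        qed
      next
        case False
        obtain z where z: "z \<in> Q" "dist y z < \<alpha>" using cov by (auto simp: covering_def)
        have "norm y \<le> dist y z + norm z" by (metis dist_norm norm_triangle_sub add.commute)
        then have "z \<notin> ball 0 M" using False z by simp
        then have "z \<in> Q'" using out_iff z(1) by blast
        then show ?thesis using z by blast
      qed
    qed
    moreover have "\<rho> \<le> norm q" if q: "q \<in> Q'" for q
    proof (cases "q \<in> ball 0 M")
      case True
      obtain p where p: "p \<in> F" "dist p q < \<epsilon>" using inside[OF q True] by blast
      have "s \<le> norm p" using s p(1) by (simp add: F_def)
      moreover have "norm p \<le> dist p q + norm q" by (metis dist_norm norm_triangle_sub add.commute)
      ultimately show ?thesis using p(2) \<epsilon>(6) by linarith
    next
      case False
      then show ?thesis using M \<rho> by simp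
    qed
    ultimately show "separated r Q' \<and> covering \<alpha> Q' \<and> (\<forall>q\<in>Q'. \<rho> \<le> norm q)" by blast
  qed
qed


section \<open>Delaunay energies and local energies\<close>

definition tame :: "real \<Rightarrow> real \<Rightarrow> (real^2) set \<Rightarrow> bool" where
  "tame r \<alpha> T \<longleftrightarrow> circumradius T < \<alpha> \<and> r < min_side T"

definition hit :: "(real^2) set \<Rightarrow> (real^2) set \<Rightarrow> (real^2) set set" where
  "hit P \<Lambda> = {T \<in> del P. circumball T \<inter> \<Lambda> \<noteq> {}}"

text \<open>Separates the hard constraints, which involve only \<open>r\<close> and
  \<open>\<alpha>\<close>, from a perimeter sum multiplied by \<open>\<theta>\<close>. (S1), (S2)
  and the comparisons of local energies rest on this form.\<close>

lemma delaunay_energy_eq: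
  "delaunay_energy r \<alpha> \<theta> \<Lambda> \<gamma> =
    (if \<forall>T\<in>hit (points \<gamma>) \<Lambda>. tame r \<alpha> T then ereal (\<theta> * (\<Sum>T\<in>hit (points \<gamma>) \<Lambda>. perimeter T)) else \<infinity>)"
proof -
  have te: "triangle_energy r \<alpha> \<theta> T = (if tame r \<alpha> T then ereal (\<theta> * perimeter T) else \<infinity>)" for T
    by (auto simp: triangle_energy_def tame_def)
  show ?thesis
  proof (cases "\<forall>T\<in>hit (points \<gamma>) \<Lambda>. tame r \<alpha> T")
    case True
    then have "(\<Sum>T\<in>hit (points \<gamma>) \<Lambda>. triangle_energy r \<alpha> \<theta> T) = (\<Sum>T\<in>hit (points \<gamma>) \<Lambda>. ereal (\<theta> * perimeter T))"
      by (intro sum.cong) (simp_all add: te)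
    also have "\<dots> = ereal (\<theta> * (\<Sum>T\<in>hit (points \<gamma>) \<Lambda>. perimeter T))"
      by (simp add: sum_distrib_left)
    finally show ?thesis using True
      by (simp add: delaunay_energy_def Let_def delaunay_eq_del te flip: hit_def)
  next
    case False
    then show ?thesis
      by (auto simp: delaunay_energy_def Let_def delaunay_eq_del te simp flip: hit_def)
  qed
qed

lemma delaunay_energy_finite_iff:
  "delaunay_energy r \<alpha> \<theta> \<Lambda> \<gamma> < \<infinity> \<longleftrightarrow> (\<forall>T\<in>hit (points \<gamma>) \<Lambda>. tame r \<alpha> T)"
  by (simp add: delaunay_energy_eq)

lemma delaunay_energy_infinite_iff:
  "delaunay_energy r \<alpha> \<theta> \<Lambda> \<gamma> = \<infinity> \<longleftrightarrow> \<not> (\<forall>T\<in>hit (points \<gamma>) \<Lambda>. tame r \<alpha> T)"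
  by (simp add: delaunay_energy_eq)

lemma hit_Un: "hit P (\<Lambda> \<union> \<Lambda>') = hit P \<Lambda> \<union> hit P \<Lambda>'"
  by (auto simp: hit_def)

lemma hit_del: "T \<in> hit P \<Lambda> \<Longrightarrow> T \<in> del P"
  by (simp add: hit_def)

lemma del_subset_cball:
  assumes "T \<in> del P" "circumradius T < \<alpha>" "dist x (circumcenter T) \<le> d"
  shows "T \<subseteq> P \<inter> cball x (d + \<alpha>)"
proof
  fix p assume p: "p \<in> T"
  have "dist x p \<le> dist x (circumcenter T) + dist (circumcenter T) p" by (rule dist_triangle)
  then show "p \<in> P \<inter> cball x (d + \<alpha>)"
    using delD(6)[OF assms(1) p] delD(1)[OF assms(1)] p assms(2,3) by auto
qed

text \<open>If the disc meets \<open>cball 0 B\<close> and has radius below \<open>\<alpha>\<close>,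
  the vertices lie within \<open>B + 2 \<alpha>\<close> of the origin, where there are finitely many
  points.\<close>

lemma finite_small_hit:
  assumes lf: "locally_finite P" and "bounded \<Lambda>"
  shows "finite {T \<in> hit P \<Lambda>. circumradius T < \<alpha>}"
proof -
  obtain B where B: "\<Lambda> \<subseteq> cball 0 B"
    using bounded_subset_ballD[OF assms(2), of 0] ball_subset_cball by blast
  have "{T \<in> hit P \<Lambda>. circumradius T < \<alpha>} \<subseteq> Pow (P \<inter> cball 0 (B + \<alpha> + \<alpha>))"
  proof
    fix T assume T: "T \<in> {T \<in> hit P \<Lambda>. circumradius T < \<alpha>}"
    then have d: "T \<in> del P" and R: "circumradius T < \<alpha>" by (simp_all add: hit_def)
    have "circumball T \<inter> \<Lambda> \<noteq> {}" using T by (simp add: hit_def)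
    then obtain z where z: "z \<in> circumball T" "z \<in> \<Lambda>" by blast
    have "dist 0 (circumcenter T) \<le> dist 0 z + dist z (circumcenter T)" by (rule dist_triangle)
    moreover have "dist 0 z \<le> B" using z(2) B by auto
    moreover have "dist z (circumcenter T) < circumradius T" using z(1) by (simp add: circumball_def dist_commute)
    ultimately have "dist 0 (circumcenter T) \<le> B + \<alpha>" using R by linarith
    from del_subset_cball[OF d R this] show "T \<in> Pow (P \<inter> cball 0 (B + \<alpha> + \<alpha>))" by simp
  qed
  moreover have "finite (P \<inter> cball 0 (B + \<alpha> + \<alpha>))" using lf by (simp add: locally_finite_def)
  ultimately show ?thesis by (meson finite_Pow_iff finite_subset)
qed

lemma finite_hit:
  assumes "locally_finite P" "bounded \<Lambda>" "\<forall>T\<in>hit P \<Lambda>. tame r \<alpha> T"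
  shows "finite (hit P \<Lambda>)"
proof -
  have "{T \<in> hit P \<Lambda>. circumradius T < \<alpha>} = hit P \<Lambda>" using assms(3) by (auto simp: tame_def)
  then show ?thesis using finite_small_hit[OF assms(1,2), of \<alpha>] by simp
qed

text \<open>The 9 is crude: nine ordered pairs of vertices, each at distance at most
  \<open>2 * \<alpha>\<close>, halved.\<close>

lemma perimeter_bounds:
  assumes "T \<in> del P" "circumradius T < \<alpha>"
  shows "0 \<le> perimeter T" "perimeter T \<le> 9 * \<alpha>"
proof -
  have "dist x y \<le> 2 * \<alpha>" if "x \<in> T" "y \<in> T" for x y
  proof -
    have "dist x y \<le> dist (circumcenter T) x + dist (circumcenter T) y" by (rule dist_triangle3)
    then show ?thesis using delD(6)[OF assms(1)] that assms(2) by fastforce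
  qed
  then have "(\<Sum>x\<in>T. \<Sum>y\<in>T. dist x y) \<le> (\<Sum>x\<in>T. \<Sum>y\<in>T. 2 * \<alpha>)" by (intro sum_mono) auto
  then show "perimeter T \<le> 9 * \<alpha>" using delD(2)[OF assms(1)] by (simp add: perimeter_def)
  show "0 \<le> perimeter T" unfolding perimeter_def by (intro divide_nonneg_nonneg sum_nonneg) auto
qed

lemma delaunay_energy_smaller_radius:
  assumes "\<gamma> \<in> configurations" "bounded \<Lambda>" "0 < \<alpha>'" "delaunay_energy r \<alpha>' \<theta> \<Lambda> \<gamma> < \<infinity>"
  shows "\<exists>\<alpha>. 0 < \<alpha> \<and> \<alpha> < \<alpha>' \<and> delaunay_energy r \<alpha> \<theta> \<Lambda> \<gamma> < \<infinity>"
proof -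
  have f: "\<forall>T\<in>hit (points \<gamma>) \<Lambda>. tame r \<alpha>' T" using assms(4) unfolding delaunay_energy_finite_iff .
  have fin: "finite (hit (points \<gamma>) \<Lambda>)"
    using finite_hit[OF locally_finite_points[OF assms(1)] assms(2) f] .
  have "0 < \<alpha>' - circumradius T" if "T \<in> hit (points \<gamma>) \<Lambda>" for T using f that by (simp add: tame_def)
  from finite_positive_lower_bound[OF fin, of "\<lambda>T. \<alpha>' - circumradius T", OF this]
  obtain e where e: "0 < e" "\<forall>T\<in>hit (points \<gamma>) \<Lambda>. e \<le> \<alpha>' - circumradius T" by blast
  \<comment> \<open>The second term leaves half of the slack \<open>e\<close> above all radii; the
    first keeps the new parameter positive when \<open>e\<close> is large.\<close>
  define \<alpha> where "\<alpha> = max (\<alpha>' / 2) (\<alpha>' - e / 2)"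
  have "tame r \<alpha> T" if "T \<in> hit (points \<gamma>) \<Lambda>" for T
    using f e that by (fastforce simp: tame_def \<alpha>_def)
  moreover have "0 < \<alpha>" "\<alpha> < \<alpha>'" using assms(3) e(1) by (auto simp: \<alpha>_def)
  ultimately show ?thesis unfolding delaunay_energy_finite_iff by blast
qed

section \<open>The effect of inserting a point\<close>

definition new_triangles :: "(real^2) set \<Rightarrow> real^2 \<Rightarrow> (real^2) set set" where
  "new_triangles P x = {T \<in> del (insert x P). x \<in> T}"

definition cavity :: "(real^2) set \<Rightarrow> real^2 \<Rightarrow> (real^2) set set" where
  "cavity P x = {T \<in> del P. x \<in> circumball T}"

text \<open>This is the quantity \<open>D(x)\<close> of the overview.\<close>

definition perimeter_change :: "(real^2) set \<Rightarrow> real^2 \<Rightarrow> real" where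
  "perimeter_change P x = (\<Sum>T\<in>new_triangles P x. perimeter T) - (\<Sum>T\<in>cavity P x. perimeter T)"

text \<open>A triangle without the vertex \<open>x\<close> survives exactly when \<open>x\<close> is
  outside its open disc; a point on the circle destroys nothing.\<close>

lemma del_insert:
  assumes "x \<notin> P"
  shows "del (insert x P) = new_triangles P x \<union> (del P - cavity P x)"
proof (rule set_eqI)
  fix T
  show "T \<in> del (insert x P) \<longleftrightarrow> T \<in> new_triangles P x \<union> (del P - cavity P x)"
  proof (cases "x \<in> T")
    case True
    then have "T \<notin> del P" using assms by (auto simp: del_def)
    then show ?thesis using True by (simp add: new_triangles_def)
  next
    case False
    then have "T \<subseteq> insert x P \<longleftrightarrow> T \<subseteq> P" by blast
    then show ?thesis using False by (auto simp: new_triangles_def cavity_def del_def)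
  qed
qed

text \<open>The vertex \<open>x\<close> lies on the boundary of the disc. Consequently a set
  containing some ball around \<open>x\<close> counts every new triangle, while \<open>{x}\<close>
  alone counts none.\<close>

lemma new_triangle_meets_ball:
  assumes "T \<in> new_triangles P x" "0 < e"
  shows "circumball T \<inter> ball x e \<noteq> {}"
proof -
  have T: "T \<in> del (insert x P)" "x \<in> T" using assms by (auto simp: new_triangles_def)
  have "dist (circumcenter T) x = circumradius T" "0 < circumradius T" using delD(5,6)[OF T(1)] T(2) by auto
  then have "x \<in> closure (circumball T)" by (simp add: circumball_def)
  then have "ball x e \<inter> closure (circumball T) \<noteq> {}" using assms(2) centre_in_ball by blast
  then have "ball x e \<inter> circumball T \<noteq> {}" using open_Int_closure_eq_empty[OF open_ball] by metis
  then show ?thesis by blast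
qed

lemma hit_insert:
  assumes "x \<notin> P" "ball x e \<subseteq> \<Lambda>" "0 < e"
  shows "hit (insert x P) \<Lambda> = new_triangles P x \<union> (hit P \<Lambda> - cavity P x)"
proof -
  have "circumball T \<inter> \<Lambda> \<noteq> {}" if "T \<in> new_triangles P x" for T
    using new_triangle_meets_ball[OF that assms(3)] assms(2) by blast
  then show ?thesis unfolding hit_def del_insert[OF assms(1)] by blast
qed

lemma cavity_subset_hit: "x \<in> \<Lambda> \<Longrightarrow> cavity P x \<subseteq> hit P \<Lambda>"
  by (auto simp: cavity_def hit_def)

lemma new_triangles_disjoint: "x \<notin> P \<Longrightarrow> new_triangles P x \<inter> del P = {}"
  by (auto simp: new_triangles_def del_def)

text \<open>When \<open>\<Lambda>\<close> contains a ball around \<open>x\<close>, every created or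
  destroyed triangle is counted and the surviving ones cancel, so the difference no longer depends
  on \<open>\<Lambda>\<close>.\<close>

lemma delaunay_energy_add_point:
  assumes \<gamma>: "\<gamma> \<in> configurations" and x: "x \<notin> points \<gamma>"
    and L: "bounded \<Lambda>" "ball x e \<subseteq> \<Lambda>" "0 < e" and f: "\<forall>T\<in>hit (points \<gamma>) \<Lambda>. tame r \<alpha> T"
  shows "delaunay_energy r \<alpha> \<theta> \<Lambda> (add_point \<gamma> x) - delaunay_energy r \<alpha> \<theta> \<Lambda> \<gamma> =
    (if \<forall>T\<in>new_triangles (points \<gamma>) x. tame r \<alpha> T then ereal (\<theta> * perimeter_change (points \<gamma>) x) else \<infinity>)"
proof -
  define P where "P = points \<gamma>"
  have lf: "locally_finite P" using \<gamma> by (simp add: P_def locally_finite_points)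
  note h = hit_insert[OF x[folded P_def] L(2,3)]
  have e: "points (add_point \<gamma> x) = insert x P" by (simp add: P_def points_add_point[OF \<gamma>])
  have E\<gamma>: "delaunay_energy r \<alpha> \<theta> \<Lambda> \<gamma> = ereal (\<theta> * (\<Sum>T\<in>hit P \<Lambda>. perimeter T))"
    using f by (simp add: delaunay_energy_eq P_def)
  show ?thesis
  proof (cases "\<forall>T\<in>new_triangles P x. tame r \<alpha> T")
    case True
    have "\<forall>T\<in>hit P \<Lambda>. tame r \<alpha> T" using f by (simp only: P_def)
    with True have f': "\<forall>T\<in>hit (insert x P) \<Lambda>. tame r \<alpha> T" unfolding h by blast
    have fin: "finite (hit (insert x P) \<Lambda>)" using finite_hit[OF locally_finite_insert[OF lf] L(1) f'] .
    have fin': "finite (hit P \<Lambda>)" using finite_hit[OF lf L(1)] f by (simp add: P_def)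
    have c: "cavity P x \<subseteq> hit P \<Lambda>" using L by (intro cavity_subset_hit) auto
    have "(\<Sum>T\<in>hit (insert x P) \<Lambda>. perimeter T) = (\<Sum>T\<in>new_triangles P x. perimeter T) + (\<Sum>T\<in>hit P \<Lambda> - cavity P x. perimeter T)"
      unfolding h using fin new_triangles_disjoint[OF x] hit_del unfolding h P_def[symmetric]
      by (intro sum.union_disjoint) auto
    also have "(\<Sum>T\<in>hit P \<Lambda> - cavity P x. perimeter T) = (\<Sum>T\<in>hit P \<Lambda>. perimeter T) - (\<Sum>T\<in>cavity P x. perimeter T)"
      by (rule sum_diff[OF fin' c])
    finally have s: "(\<Sum>T\<in>hit (insert x P) \<Lambda>. perimeter T) = (\<Sum>T\<in>hit P \<Lambda>. perimeter T) + perimeter_change P x"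
      by (simp add: perimeter_change_def)
    have "delaunay_energy r \<alpha> \<theta> \<Lambda> (add_point \<gamma> x) = ereal (\<theta> * (\<Sum>T\<in>hit (insert x P) \<Lambda>. perimeter T))"
      using f' by (simp add: delaunay_energy_eq e)
    then show ?thesis using True unfolding E\<gamma> s P_def[symmetric] by (simp add: algebra_simps)
  next
    case False
    then have "\<not> (\<forall>T\<in>hit (insert x P) \<Lambda>. tame r \<alpha> T)" unfolding h by blast
    then have "delaunay_energy r \<alpha> \<theta> \<Lambda> (add_point \<gamma> x) = \<infinity>" by (simp only: delaunay_energy_infinite_iff e not_False_eq_True)
    then show ?thesis using False unfolding E\<gamma> P_def[symmetric] by simp
  qed
qed

lemma bounded_borel_Un: "A \<in> bounded_borel \<Longrightarrow> B \<in> bounded_borel \<Longrightarrow> A \<union> B \<in> bounded_borel"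
  by (auto simp: bounded_borel_def)

lemma admissible_Un:
  assumes "\<Lambda> \<in> admissible (delaunay_energy r \<alpha> \<theta>) x \<gamma>" "\<Lambda>' \<in> admissible (delaunay_energy r \<alpha> \<theta>) x \<gamma>"
  shows "\<Lambda> \<union> \<Lambda>' \<in> admissible (delaunay_energy r \<alpha> \<theta>) x \<gamma>"
  using assms unfolding admissible_def delaunay_energy_finite_iff
  by (auto intro: bounded_borel_Un simp: hit_Un)

text \<open>\<open>\<Lambda>\<^sub>0\<close> itself is the threshold that shows existence; another
  candidate value is compared on the union of the two thresholds, which is again admissible.\<close>

lemma delaunay_local_energy_eq:
  assumes \<gamma>: "\<gamma> \<in> configurations" and x: "x \<notin> points \<gamma>"
    and adm: "\<Lambda>\<^sub>0 \<in> admissible (delaunay_energy r \<alpha> \<theta>) x \<gamma>" and b: "ball x e \<subseteq> \<Lambda>\<^sub>0" "0 < e"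
  shows "delaunay_local_energy r \<alpha> \<theta> x \<gamma> =
    (if \<forall>T\<in>new_triangles (points \<gamma>) x. tame r \<alpha> T then ereal (\<theta> * perimeter_change (points \<gamma>) x) else \<infinity>)"
    (is "_ = ?e")
proof -
  let ?H = "delaunay_energy r \<alpha> \<theta>"
  have val: "?H \<Lambda> (add_point \<gamma> x) - ?H \<Lambda> \<gamma> = ?e" if "\<Lambda> \<in> admissible ?H x \<gamma>" "\<Lambda>\<^sub>0 \<subseteq> \<Lambda>" for \<Lambda>
  proof (rule delaunay_energy_add_point[OF \<gamma> x _ _ b(2)])
    show "bounded \<Lambda>" using that(1) by (simp add: admissible_def bounded_borel_def)
    show "ball x e \<subseteq> \<Lambda>" using b(1) that(2) by blast
    have "?H \<Lambda> \<gamma> < \<infinity>" using that(1) by (simp add: admissible_def)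
    then show "\<forall>T\<in>hit (points \<gamma>) \<Lambda>. tame r \<alpha> T" unfolding delaunay_energy_finite_iff .
  qed
  show ?thesis unfolding local_energy_def
  proof (rule the_equality)
    show "\<exists>\<Lambda>\<^sub>0\<in>admissible ?H x \<gamma>. \<forall>\<Lambda>\<in>admissible ?H x \<gamma>. \<Lambda>\<^sub>0 \<subseteq> \<Lambda> \<longrightarrow> ?e = ?H \<Lambda> (add_point \<gamma> x) - ?H \<Lambda> \<gamma>"
      using adm val by (intro bexI[of _ \<Lambda>\<^sub>0] ballI impI) (simp_all only:)
    fix e' assume "\<exists>\<Lambda>\<^sub>0\<in>admissible ?H x \<gamma>. \<forall>\<Lambda>\<in>admissible ?H x \<gamma>. \<Lambda>\<^sub>0 \<subseteq> \<Lambda> \<longrightarrow> e' = ?H \<Lambda> (add_point \<gamma> x) - ?H \<Lambda> \<gamma>"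
    then obtain \<Lambda>\<^sub>1 where 1: "\<Lambda>\<^sub>1 \<in> admissible ?H x \<gamma>"
      "\<And>\<Lambda>. \<Lambda> \<in> admissible ?H x \<gamma> \<Longrightarrow> \<Lambda>\<^sub>1 \<subseteq> \<Lambda> \<Longrightarrow> e' = ?H \<Lambda> (add_point \<gamma> x) - ?H \<Lambda> \<gamma>" by blast
    have u: "\<Lambda>\<^sub>0 \<union> \<Lambda>\<^sub>1 \<in> admissible ?H x \<gamma>" by (rule admissible_Un[OF adm 1(1)])
    have "e' = ?H (\<Lambda>\<^sub>0 \<union> \<Lambda>\<^sub>1) (add_point \<gamma> x) - ?H (\<Lambda>\<^sub>0 \<union> \<Lambda>\<^sub>1) \<gamma>" by (rule 1(2)[OF u]) simp
    also have "\<dots> = ?e" by (rule val[OF u]) simp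
    finally show "e' = ?e" .
  qed
qed

text \<open>Every triangle is counted by its own disc, which is a bounded Borel set.\<close>

lemma finite_energy_iff:
  "\<gamma> \<in> finite_energy (delaunay_energy r \<alpha> \<theta>) \<longleftrightarrow> \<gamma> \<in> configurations \<and> (\<forall>T\<in>del (points \<gamma>). tame r \<alpha> T)"
proof -
  have "(\<forall>\<Lambda>\<in>bounded_borel. \<forall>T\<in>hit (points \<gamma>) \<Lambda>. tame r \<alpha> T) \<longleftrightarrow> (\<forall>T\<in>del (points \<gamma>). tame r \<alpha> T)"
  proof (intro iffI ballI)
    fix T assume *: "\<forall>\<Lambda>\<in>bounded_borel. \<forall>T\<in>hit (points \<gamma>) \<Lambda>. tame r \<alpha> T" and T: "T \<in> del (points \<gamma>)"
    have "circumball T \<in> bounded_borel" by (simp add: circumball_def)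
    moreover have "T \<in> hit (points \<gamma>) (circumball T)"
      using T delD(5)[OF T] by (simp add: hit_def circumball_def)
    ultimately show "tame r \<alpha> T" using * by blast
  qed (auto dest: hit_del)
  then show ?thesis unfolding finite_energy_def delaunay_energy_finite_iff by simp
qed

text \<open>Degenerate configurations, for instance collinear ones, have no triangles and finite
  energy vacuously; being surrounded excludes them and turns finite energy into covering and
  separation.\<close>

lemma finite_energy_surrounded:
  assumes "\<gamma> \<in> finite_energy (delaunay_energy r \<alpha> \<theta>)" "\<And>y. surrounded (points \<gamma>) y" "0 < \<alpha>"
  shows "locally_finite (points \<gamma>)" "covering \<alpha> (points \<gamma>)" "separated r (points \<gamma>)"
proof -
  have t: "\<gamma> \<in> configurations" "\<And>T. T \<in> del (points \<gamma>) \<Longrightarrow> tame r \<alpha> T"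
    using assms(1) by (auto simp: finite_energy_iff)
  show lf: "locally_finite (points \<gamma>)" using t(1) by (rule locally_finite_points)
  show "covering \<alpha> (points \<gamma>)"
    using t(2) by (intro covering_of_circumradius_less lf assms(2,3)) (auto simp: tame_def)
  show "separated r (points \<gamma>)"
    unfolding separated_def
    using del_separated[OF lf surrounded_not_collinear[OF assms(2)]] t(2) by (auto simp: tame_def)
qed

lemma admissible_ball:
  assumes "\<gamma> \<in> finite_energy (delaunay_energy r \<alpha> \<theta>)"
  shows "ball x 1 \<in> admissible (delaunay_energy r \<alpha> \<theta>) x \<gamma>"
  using assms by (simp add: admissible_def finite_energy_def)

lemma local_energy_finite_energy:
  assumes "\<gamma> \<in> finite_energy (delaunay_energy r \<alpha> \<theta>)" "x \<notin> points \<gamma>"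
  shows "delaunay_local_energy r \<alpha> \<theta> x \<gamma> =
    (if \<forall>T\<in>new_triangles (points \<gamma>) x. tame r \<alpha> T then ereal (\<theta> * perimeter_change (points \<gamma>) x) else \<infinity>)"
proof (rule delaunay_local_energy_eq[OF _ assms(2) admissible_ball[OF assms(1)] subset_refl])
  show "\<gamma> \<in> configurations" using assms(1) by (simp add: finite_energy_def)
qed simp

lemma separated_card_ball_bounded:
  fixes A :: real
  assumes "0 < r"
  shows "\<exists>N. \<forall>(x :: 'a::euclidean_space) Q. separated r Q \<longrightarrow> finite (Q \<inter> cball x A) \<and> card (Q \<inter> cball x A) \<le> N"
proof -
  obtain N where N: "\<forall>B\<subseteq>cball (0::'a) A. (\<forall>a\<in>B. \<forall>b\<in>B. a \<noteq> b \<longrightarrow> r \<le> dist a b) \<longrightarrow> finite B \<and> card B \<le> N"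
    using separated_card_bounded[OF bounded_cball assms] by blast
  have "finite (Q \<inter> cball x A) \<and> card (Q \<inter> cball x A) \<le> N" if sep: "separated r Q" for x :: 'a and Q
  proof -
    let ?B = "(\<lambda>z. z - x) ` (Q \<inter> cball x A)"
    have inj: "inj_on (\<lambda>z. z - x) (Q \<inter> cball x A)" by (simp add: inj_on_def)
    have "?B \<subseteq> cball 0 A" by (auto simp: dist_norm norm_minus_commute)
    moreover have "\<forall>a\<in>?B. \<forall>b\<in>?B. a \<noteq> b \<longrightarrow> r \<le> dist a b"
      using sep by (auto simp: separated_def dist_norm intro: less_imp_le)
    ultimately have "finite ?B \<and> card ?B \<le> N" using N by blast
    then show ?thesis using card_image[OF inj] finite_imageD[OF _ inj] by simp
  qed
  then show ?thesis by blast
qed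

text \<open>All triangles created or destroyed have their vertices within \<open>2 A\<close> of
  \<open>x\<close>. Since \<open>insert x P\<close> is \<open>r\<close>-separated, at most
  \<open>N\<close> points lie there, with \<open>N\<close> depending only on \<open>r\<close> and
  \<open>A\<close>; so there are at most \<open>2 ^ N\<close> triangles, each of perimeter at most
  \<open>9 * \<bar>A\<bar>\<close>.\<close>

lemma perimeter_change_bounded:
  assumes "0 < r"
  obtains C where "0 \<le> C" "\<And>P x \<alpha>. locally_finite P \<Longrightarrow> x \<notin> P \<Longrightarrow> \<alpha> \<le> A \<Longrightarrow> \<forall>T\<in>del P. tame r \<alpha> T
    \<Longrightarrow> \<forall>T\<in>new_triangles P x. tame r \<alpha> T \<Longrightarrow> \<bar>perimeter_change P x\<bar> \<le> C"
proof -
  obtain N where N: "\<forall>(x :: real^2) Q. separated r Q \<longrightarrow> finite (Q \<inter> cball x (A + A)) \<and> card (Q \<inter> cball x (A + A)) \<le> N"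
    using separated_card_ball_bounded[OF assms] by blast
  define C where "C = real (2 ^ N) * (9 * \<bar>A\<bar>)"
  have C0: "0 \<le> C" by (simp add: C_def)
  have "\<bar>perimeter_change P x\<bar> \<le> C"
    if lf: "locally_finite P" and x: "x \<notin> P" and A: "\<alpha> \<le> A" and f: "\<forall>T\<in>del P. tame r \<alpha> T"
      and n: "\<forall>T\<in>new_triangles P x. tame r \<alpha> T" for P x \<alpha>
  proof (cases "collinear (insert x P)")
    case True
    \<comment> \<open>Without triangles the constraints do not imply separation, but both sums are
      then empty.\<close>
    have "del Q = {}" if "Q \<subseteq> insert x P" for Q
    proof -
      have "collinear T" if "T \<subseteq> Q" for T
        using that \<open>Q \<subseteq> insert x P\<close> True by (meson collinear_subset subset_trans)
      then show ?thesis by (auto simp: del_def)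
    qed
    then have "del P = {}" "del (insert x P) = {}" by auto
    then show ?thesis using C0 by (simp add: perimeter_change_def new_triangles_def cavity_def)
  next
    case False
    have f': "\<forall>T\<in>del (insert x P). tame r \<alpha> T" using f n unfolding del_insert[OF x] by blast
    have "separated r (insert x P)"
      unfolding separated_def
      using del_separated[OF locally_finite_insert[OF lf] False] f' by (auto simp: tame_def)
    then have F: "finite (insert x P \<inter> cball x (A + A))" "card (insert x P \<inter> cball x (A + A)) \<le> N"
      using N by blast+
    \<comment> \<open>Stated for triangles of any subset \<open>Q\<close> with \<open>x\<close> in
      the closed disc, so as to serve the new triangles, where \<open>x\<close> is on the circle,
      and the cavity, where it is inside. Both sums lie in \<open>[0, C]\<close>, hence so does the
      absolute value of their difference.\<close>
    have bound: "0 \<le> (\<Sum>T\<in>S. perimeter T) \<and> (\<Sum>T\<in>S. perimeter T) \<le> C"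
      if S: "\<And>T. T \<in> S \<Longrightarrow> \<exists>Q\<subseteq>insert x P. T \<in> del Q \<and> circumradius T < \<alpha> \<and> dist x (circumcenter T) \<le> circumradius T"
      for S
    proof -
      have T: "T \<subseteq> insert x P \<inter> cball x (A + A)" "0 \<le> perimeter T" "perimeter T \<le> 9 * \<bar>A\<bar>" if TS: "T \<in> S" for T
      proof -
        obtain Q where Q: "Q \<subseteq> insert x P" "T \<in> del Q" "circumradius T < \<alpha>" "dist x (circumcenter T) \<le> circumradius T"
          using S[OF TS] by blast
        have R: "circumradius T < A" "dist x (circumcenter T) \<le> A" using Q A by auto
        show "T \<subseteq> insert x P \<inter> cball x (A + A)" using del_subset_cball[OF Q(2) R] Q(1) by blast
        show "0 \<le> perimeter T" "perimeter T \<le> 9 * \<bar>A\<bar>" using perimeter_bounds[OF Q(2) R(1)] by auto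
      qed
      have sub: "S \<subseteq> Pow (insert x P \<inter> cball x (A + A))" using T(1) by blast
      have fin: "finite S" using F(1) sub by (meson finite_Pow_iff finite_subset)
      have "card S \<le> card (Pow (insert x P \<inter> cball x (A + A)))"
        using F(1) by (intro card_mono[OF _ sub]) (simp only: finite_Pow_iff)
      also have "\<dots> = 2 ^ card (insert x P \<inter> cball x (A + A))" by (rule card_Pow[OF F(1)])
      also have "\<dots> \<le> 2 ^ N" using F(2) by (intro power_increasing) auto
      finally have c: "card S \<le> 2 ^ N" .
      have "(\<Sum>T\<in>S. perimeter T) \<le> real (card S) * (9 * \<bar>A\<bar>)" using T(3) by (rule sum_bounded_above)
      also have "\<dots> \<le> real (2 ^ N) * (9 * \<bar>A\<bar>)" using c by (intro mult_right_mono of_nat_mono) auto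
      finally show ?thesis using T(2) by (auto simp: C_def intro: sum_nonneg)
    qed
    have "0 \<le> (\<Sum>T\<in>new_triangles P x. perimeter T) \<and> (\<Sum>T\<in>new_triangles P x. perimeter T) \<le> C"
    proof (rule bound)
      fix T assume T: "T \<in> new_triangles P x"
      then have "T \<in> del (insert x P)" "x \<in> T" by (auto simp: new_triangles_def)
      moreover from this have "dist x (circumcenter T) = circumradius T" using delD(6) by (metis dist_commute)
      ultimately show "\<exists>Q\<subseteq>insert x P. T \<in> del Q \<and> circumradius T < \<alpha> \<and> dist x (circumcenter T) \<le> circumradius T"
        using n T by (intro exI[of _ "insert x P"]) (auto simp: tame_def)
    qed
    moreover have "0 \<le> (\<Sum>T\<in>cavity P x. perimeter T) \<and> (\<Sum>T\<in>cavity P x. perimeter T) \<le> C"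
    proof (rule bound)
      fix T assume T: "T \<in> cavity P x"
      then show "\<exists>Q\<subseteq>insert x P. T \<in> del Q \<and> circumradius T < \<alpha> \<and> dist x (circumcenter T) \<le> circumradius T"
        using f by (intro exI[of _ P]) (auto simp: tame_def cavity_def circumball_def dist_commute)
    qed
    ultimately show ?thesis by (simp add: perimeter_change_def abs_le_iff)
  qed
  then show ?thesis by (rule that[OF C0])
qed

section \<open>Translation covariance\<close>

lemma
  assumes "card T = 3" "\<not> collinear T"
  shows card_translate_3: "card ((\<lambda>z. z + y) ` T) = 3"
    and noncollinear_translate: "\<not> collinear ((\<lambda>z. z + y) ` T)"
    and circumcenter_translate: "circumcenter ((\<lambda>z. z + y) ` T) = circumcenter T + y"
    and circumradius_translate: "circumradius ((\<lambda>z. z + y) ` T) = circumradius T"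
    and min_side_translate: "min_side ((\<lambda>z. z + y) ` T) = min_side T"
    and perimeter_translate: "perimeter ((\<lambda>z. z + y) ` T) = perimeter T"
proof -
  let ?t = "\<lambda>z. z + y"
  have inj: "inj_on ?t T" by (simp add: inj_on_def)
  show c: "card (?t ` T) = 3" using assms(1) by (simp add: card_image[OF inj])
  have "collinear T" if "collinear (?t ` T)"
    using that by (auto simp: collinear_def)
  then show n: "\<not> collinear (?t ` T)" using assms(2) by blast
  have d: "dist (a + y) (b + y) = dist a b" for a b by (simp add: dist_norm)
  have "dist (circumcenter T + y) p = circumradius T" if "p \<in> ?t ` T" for p
    using that dist_circumcenter[OF assms] by (auto simp: d)
  from circum_unique[OF c n this]
  show "circumcenter (?t ` T) = circumcenter T + y" "circumradius (?t ` T) = circumradius T" by auto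
  have "{dist a b | a b. a \<in> ?t ` T \<and> b \<in> ?t ` T \<and> a \<noteq> b} = {dist a b | a b. a \<in> T \<and> b \<in> T \<and> a \<noteq> b}"
  proof (rule set_eqI, rule iffI)
    fix u assume "u \<in> {dist a b | a b. a \<in> ?t ` T \<and> b \<in> ?t ` T \<and> a \<noteq> b}"
    then obtain a b where "a \<in> T" "b \<in> T" "a \<noteq> b" "u = dist (a + y) (b + y)" by blast
    then show "u \<in> {dist a b | a b. a \<in> T \<and> b \<in> T \<and> a \<noteq> b}" unfolding d by blast
  next
    fix u assume "u \<in> {dist a b | a b. a \<in> T \<and> b \<in> T \<and> a \<noteq> b}"
    then obtain a b where ab: "a \<in> T" "b \<in> T" "a \<noteq> b" "u = dist a b" by blast
    then have "u = dist (a + y) (b + y)" "a + y \<noteq> b + y" by (simp_all add: d)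
    then show "u \<in> {dist a b | a b. a \<in> ?t ` T \<and> b \<in> ?t ` T \<and> a \<noteq> b}" using ab by blast
  qed
  then show "min_side (?t ` T) = min_side T" by (simp only: min_side_def)
  show "perimeter (?t ` T) = perimeter T"
    by (simp add: perimeter_def sum.reindex[OF inj] d)
qed

lemma circumball_translate:
  assumes "card T = 3" "\<not> collinear T"
  shows "circumball ((\<lambda>z. z + y) ` T) = (\<lambda>z. z + y) ` circumball T"
  unfolding circumball_def circumcenter_translate[OF assms] circumradius_translate[OF assms]
proof (rule set_eqI)
  fix u
  have "u \<in> (\<lambda>z. z + y) ` ball (circumcenter T) (circumradius T) \<longleftrightarrow> u - y \<in> ball (circumcenter T) (circumradius T)"
    by (force simp: image_iff)
  moreover have "dist (circumcenter T + y) u = dist (circumcenter T) (u - y)"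
    by (simp add: dist_norm algebra_simps)
  ultimately show "u \<in> ball (circumcenter T + y) (circumradius T) \<longleftrightarrow> u \<in> (\<lambda>z. z + y) ` ball (circumcenter T) (circumradius T)"
    by simp
qed

lemma hit_translate_subset:
  "(\<lambda>T. (\<lambda>z. z + y) ` T) ` hit P \<Lambda> \<subseteq> hit ((\<lambda>z. z + y) ` P) ((\<lambda>z. z + y) ` \<Lambda>)"
proof
  let ?t = "\<lambda>z. z + y"
  have inj: "inj ?t" by (simp add: inj_on_def)
  fix T' assume "T' \<in> (\<lambda>T. ?t ` T) ` hit P \<Lambda>"
  then obtain T where T: "T' = ?t ` T" "T \<in> del P" "circumball T \<inter> \<Lambda> \<noteq> {}" by (auto simp: hit_def)
  note c = delD(2,3)[OF T(2)]
  have "T \<subseteq> P" "circumball T \<inter> P = {}" using T(2) by (auto simp: del_def)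
  then have "?t ` T \<subseteq> ?t ` P" "?t ` circumball T \<inter> ?t ` P = {}"
    by (simp_all add: image_mono flip: image_Int[OF inj])
  moreover have "?t ` circumball T \<inter> ?t ` \<Lambda> \<noteq> {}"
    using T(3) by (simp flip: image_Int[OF inj])
  ultimately show "T' \<in> hit (?t ` P) (?t ` \<Lambda>)"
    using card_translate_3[OF c] noncollinear_translate[OF c]
    by (simp add: T(1) hit_def del_def circumball_translate[OF c])
qed

text \<open>The reverse inclusion is the previous lemma for the translation by
  \<open>- y\<close>.\<close>

lemma hit_translate:
  "hit ((\<lambda>z. z + y) ` P) ((\<lambda>z. z + y) ` \<Lambda>) = (\<lambda>T. (\<lambda>z. z + y) ` T) ` hit P \<Lambda>"
proof (rule equalityI[OF _ hit_translate_subset], rule subsetI)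
  let ?t = "\<lambda>z. z + y" and ?s = "\<lambda>z. z + (- y)"
  have st: "?s ` ?t ` A = A" "?t ` ?s ` A = A" for A :: "(real^2) set" by (simp_all add: image_image)
  fix T assume T: "T \<in> hit (?t ` P) (?t ` \<Lambda>)"
  then have "?s ` T \<in> (\<lambda>T. ?s ` T) ` hit (?t ` P) (?t ` \<Lambda>)" by (rule imageI)
  then have "?s ` T \<in> hit P \<Lambda>" using hit_translate_subset[of "- y" "?t ` P" "?t ` \<Lambda>"] unfolding st by blast
  then have "?t ` ?s ` T \<in> (\<lambda>T. ?t ` T) ` hit P \<Lambda>" by (rule imageI)
  then show "T \<in> (\<lambda>T. ?t ` T) ` hit P \<Lambda>" unfolding st .
qed

lemma delaunay_energy_translate:
  assumes "points \<gamma>' = (\<lambda>z. z + y) ` points \<gamma>"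
  shows "delaunay_energy r \<alpha> \<theta> ((\<lambda>z. z + y) ` \<Lambda>) \<gamma>' = delaunay_energy r \<alpha> \<theta> \<Lambda> \<gamma>"
proof -
  let ?t = "\<lambda>z. z + y"
  have h: "hit (points \<gamma>') (?t ` \<Lambda>) = (\<lambda>T. ?t ` T) ` hit (points \<gamma>) \<Lambda>"
    unfolding assms by (rule hit_translate)
  have c: "card T = 3" "\<not> collinear T" if "T \<in> hit (points \<gamma>) \<Lambda>" for T
    using delD(2,3)[OF hit_del[OF that]] by auto
  have f: "tame r \<alpha> (?t ` T) \<longleftrightarrow> tame r \<alpha> T" if "T \<in> hit (points \<gamma>) \<Lambda>" for T
    by (simp add: tame_def circumradius_translate[OF c[OF that]] min_side_translate[OF c[OF that]])
  have inj: "inj_on (\<lambda>T. ?t ` T) (hit (points \<gamma>) \<Lambda>)"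
    by (rule inj_onI) (simp add: inj_image_eq_iff)
  have "(\<Sum>T\<in>hit (points \<gamma>') (?t ` \<Lambda>). perimeter T) = (\<Sum>T\<in>hit (points \<gamma>) \<Lambda>. perimeter (?t ` T))"
    unfolding h by (subst sum.reindex[OF inj]) simp
  also have "\<dots> = (\<Sum>T\<in>hit (points \<gamma>) \<Lambda>. perimeter T)"
    by (intro sum.cong) (simp_all add: perimeter_translate[OF c])
  finally show ?thesis unfolding delaunay_energy_eq using f by (simp add: h)
qed

lemma bounded_borel_translate:
  fixes \<Lambda> :: "'a::euclidean_space set"
  assumes "\<Lambda> \<in> bounded_borel"
  shows "(\<lambda>z. z + y) ` \<Lambda> \<in> bounded_borel"
proof -
  have "(\<lambda>z. z + y) ` \<Lambda> = (\<lambda>z. z - y) -` \<Lambda> \<inter> space borel" by (force simp: image_iff)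
  moreover have "(\<lambda>z. z - y) -` \<Lambda> \<inter> space borel \<in> sets borel"
    using assms by (intro measurable_sets[of _ borel borel]) (simp_all add: bounded_borel_def)
  ultimately have "(\<lambda>z. z + y) ` \<Lambda> \<in> sets borel" by (simp only:)
  moreover have "(\<lambda>z. z + y) ` \<Lambda> = (\<lambda>z. y + z) ` \<Lambda>" by (simp add: add.commute)
  then have "bounded ((\<lambda>z. z + y) ` \<Lambda>)" using assms by (simp only: bounded_borel_def) (auto intro: bounded_translation)
  ultimately show ?thesis by (simp add: bounded_borel_def)
qed

lemma admissible_translate_subset:
  assumes "\<gamma> \<in> configurations"
  shows "(\<lambda>\<Lambda>. (\<lambda>z. z + y) ` \<Lambda>) ` admissible (delaunay_energy r \<alpha> \<theta>) x \<gamma>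
    \<subseteq> admissible (delaunay_energy r \<alpha> \<theta>) (x + y) (translate \<gamma> y)"
  using bounded_borel_translate delaunay_energy_translate[OF points_translate[OF assms]]
  by (auto simp: admissible_def)

text \<open>Translation maps the admissible sets onto each other and preserves inclusions and energy
  differences, so the two definite descriptions have equivalent bodies.\<close>

lemma local_energy_translate:
  assumes \<gamma>: "\<gamma> \<in> configurations"
  shows "delaunay_local_energy r \<alpha> \<theta> (x + y) (translate \<gamma> y) = delaunay_local_energy r \<alpha> \<theta> x \<gamma>"
proof -
  let ?t = "\<lambda>z. z + y" and ?s = "\<lambda>z. z + (- y)" and ?H = "delaunay_energy r \<alpha> \<theta>"
  have st: "?s ` ?t ` A = A" "?t ` ?s ` A = A" for A :: "(real^2) set" by (simp_all add: image_image)
  have adm: "admissible ?H (x + y) (translate \<gamma> y) = (\<lambda>\<Lambda>. ?t ` \<Lambda>) ` admissible ?H x \<gamma>"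
  proof (rule equalityI[OF subsetI admissible_translate_subset[OF \<gamma>]])
    fix \<Lambda> assume \<Lambda>: "\<Lambda> \<in> admissible ?H (x + y) (translate \<gamma> y)"
    have "?H (?t ` ?s ` \<Lambda>) (translate \<gamma> y) = ?H (?s ` \<Lambda>) \<gamma>"
      by (rule delaunay_energy_translate[OF points_translate[OF \<gamma>]])
    moreover have "x \<in> ?s ` \<Lambda>" using \<Lambda> by (force simp: admissible_def image_iff)
    ultimately have "?s ` \<Lambda> \<in> admissible ?H x \<gamma>"
      using \<Lambda> bounded_borel_translate[of \<Lambda> "- y"] unfolding st by (simp add: admissible_def)
    then have "?t ` ?s ` \<Lambda> \<in> (\<lambda>\<Lambda>. ?t ` \<Lambda>) ` admissible ?H x \<gamma>" by (rule imageI)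
    then show "\<Lambda> \<in> (\<lambda>\<Lambda>. ?t ` \<Lambda>) ` admissible ?H x \<gamma>" unfolding st .
  qed
  have p: "points (add_point (translate \<gamma> y) (x + y)) = ?t ` points (add_point \<gamma> x)"
    by (simp add: points_add_point \<gamma> translate_configuration points_translate)
  have e: "?H (?t ` \<Lambda>) (add_point (translate \<gamma> y) (x + y)) - ?H (?t ` \<Lambda>) (translate \<gamma> y)
      = ?H \<Lambda> (add_point \<gamma> x) - ?H \<Lambda> \<gamma>" for \<Lambda>
    by (simp add: delaunay_energy_translate[OF p] delaunay_energy_translate[OF points_translate[OF \<gamma>]])
  have sub: "?t ` A \<subseteq> ?t ` B \<longleftrightarrow> A \<subseteq> B" for A B :: "(real^2) set"
    by (simp add: inj_image_subset_iff)
  have "(\<exists>\<Lambda>\<^sub>0\<in>admissible ?H (x + y) (translate \<gamma> y). \<forall>\<Lambda>\<in>admissible ?H (x + y) (translate \<gamma> y).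
      \<Lambda>\<^sub>0 \<subseteq> \<Lambda> \<longrightarrow> w = ?H \<Lambda> (add_point (translate \<gamma> y) (x + y)) - ?H \<Lambda> (translate \<gamma> y))
    \<longleftrightarrow> (\<exists>\<Lambda>\<^sub>0\<in>admissible ?H x \<gamma>. \<forall>\<Lambda>\<in>admissible ?H x \<gamma>. \<Lambda>\<^sub>0 \<subseteq> \<Lambda> \<longrightarrow> w = ?H \<Lambda> (add_point \<gamma> x) - ?H \<Lambda> \<gamma>)" for w
    unfolding adm by (simp add: e sub)
  then show ?thesis unfolding local_energy_def by simp
qed


section \<open>Measurability of the Delaunay energies\<close>

lemma borel_measurable_rot [measurable]: "rot \<in> borel_measurable borel"
proof -
  have "linear rot" by (rule linearI) (simp_all add: vec2_eq_iff)
  then show ?thesis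
    by (intro borel_measurable_continuous_onI linear_continuous_on) (simp add: linear_conv_bounded_linear)
qed

lemma borel_measurable_circ [measurable]:
  assumes [measurable]: "f \<in> borel_measurable M" "g \<in> borel_measurable M" "h \<in> borel_measurable M"
  shows "(\<lambda>x. circ (f x) (g x) (h x)) \<in> borel_measurable M"
  unfolding circ_def by measurable

lemma collinear_measurable [measurable]:
  fixes f g h :: "'b \<Rightarrow> real^2"
  assumes [measurable]: "f \<in> borel_measurable M" "g \<in> borel_measurable M" "h \<in> borel_measurable M"
  shows "Measurable.pred M (\<lambda>x. collinear {f x, g x, h x})"
proof -
  define d where "d x = rot (g x - f x) \<bullet> (h x - f x)" for x
  have "d \<in> borel_measurable M" unfolding d_def by measurable
  then have "d -` {0} \<inter> space M \<in> sets M" by (rule measurable_sets) simp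
  moreover have "d -` {0} \<inter> space M = {x \<in> space M. collinear {f x, g x, h x}}"
    by (auto simp: collinear_3_rot d_def)
  ultimately show ?thesis by (simp add: pred_def)
qed

text \<open>Emptiness of the open disc is expressed through a count, which is measurable in the
  configuration. For collinear triples \<open>circ\<close> is meaningless, so \<open>G\<close> has
  to vanish there.\<close>

definition triple_weight ::
    "(real^2 \<Rightarrow> real^2 \<Rightarrow> real^2 \<Rightarrow> ennreal) \<Rightarrow> (real^2) measure \<Rightarrow> real^2 \<Rightarrow> real^2 \<Rightarrow> real^2 \<Rightarrow> ennreal" where
  "triple_weight G \<gamma> x y z =
     G x y z * indicator {0} (emeasure \<gamma> (ball (circ x y z) (dist (circ x y z) x)))"

text \<open>A sum over Delaunay triangles written as an iterated integral against the configuration;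
  each triangle occurs six times, once per ordering of its vertices.\<close>

definition triple_sum :: "(real^2 \<Rightarrow> real^2 \<Rightarrow> real^2 \<Rightarrow> ennreal) \<Rightarrow> (real^2) measure \<Rightarrow> ennreal" where
  "triple_sum G \<gamma> = (\<integral>\<^sup>+x. \<integral>\<^sup>+y. \<integral>\<^sup>+z. triple_weight G \<gamma> x y z \<partial>\<gamma> \<partial>\<gamma> \<partial>\<gamma>)"

context
  fixes G :: "real^2 \<Rightarrow> real^2 \<Rightarrow> real^2 \<Rightarrow> ennreal"
  assumes G [measurable]: "(\<lambda>(x, y, z). G x y z) \<in> borel_measurable (borel \<Otimes>\<^sub>M borel \<Otimes>\<^sub>M borel)"
begin

lemma measurable_triple_weight:
  "(\<lambda>(((\<gamma>, x), y), z). triple_weight G \<gamma> x y z)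
    \<in> borel_measurable (((conf \<Otimes>\<^sub>M borel) \<Otimes>\<^sub>M borel) \<Otimes>\<^sub>M borel)"
proof -
  let ?M = "(((conf :: (real^2) measure measure) \<Otimes>\<^sub>M (borel :: (real^2) measure)) \<Otimes>\<^sub>M (borel :: (real^2) measure)) \<Otimes>\<^sub>M (borel :: (real^2) measure)"
  have "(\<lambda>\<omega>. case (snd (fst (fst \<omega>)), snd (fst \<omega>), snd \<omega>) of (x, y, z) \<Rightarrow> G x y z) \<in> borel_measurable ?M"
    by (rule measurable_compose[OF _ G]) measurable
  then have 1: "(\<lambda>\<omega>. G (snd (fst (fst \<omega>))) (snd (fst \<omega>)) (snd \<omega>)) \<in> borel_measurable ?M" by simp
  have 2: "(\<lambda>\<omega>. emeasure (fst (fst (fst \<omega>))) (ball (circ (snd (fst (fst \<omega>))) (snd (fst \<omega>)) (snd \<omega>))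
      (dist (circ (snd (fst (fst \<omega>))) (snd (fst \<omega>)) (snd \<omega>)) (snd (fst (fst \<omega>)))))) \<in> borel_measurable ?M"
    by (rule measurable_emeasure_configuration) (simp_all add: mem_ball)
  have "(\<lambda>\<omega>. triple_weight G (fst (fst (fst \<omega>))) (snd (fst (fst \<omega>))) (snd (fst \<omega>)) (snd \<omega>)) \<in> borel_measurable ?M"
    unfolding triple_weight_def
    by (intro borel_measurable_times_ennreal 1 measurable_compose[OF 2]) simp
  then show ?thesis by (simp add: split_beta')
qed

text \<open>The variables are integrated out one at a time, the configuration remaining both
  parameter and integrator.\<close>

lemma measurable_triple_weight_integral:
  "(\<lambda>((\<gamma>, x), y). \<integral>\<^sup>+z. triple_weight G \<gamma> x y z \<partial>\<gamma>) \<in> borel_measurable ((conf \<Otimes>\<^sub>M borel) \<Otimes>\<^sub>M borel)"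
proof -
  have "(\<lambda>\<omega>. \<integral>\<^sup>+z. (case \<omega> of ((\<gamma>, x), y) \<Rightarrow> triple_weight G \<gamma> x y) z \<partial>fst (fst \<omega>))
      \<in> borel_measurable (((conf :: (real^2) measure measure) \<Otimes>\<^sub>M (borel :: (real^2) measure)) \<Otimes>\<^sub>M (borel :: (real^2) measure))"
  proof (rule measurable_nn_integral_configuration)
    show "(\<lambda>\<omega>. fst (fst \<omega>)) \<in> (conf \<Otimes>\<^sub>M borel) \<Otimes>\<^sub>M borel \<rightarrow>\<^sub>M conf" by measurable
    show "(\<lambda>(\<omega>, z). (case \<omega> of ((\<gamma>, x), y) \<Rightarrow> triple_weight G \<gamma> x y) z) \<in> borel_measurable (((conf \<Otimes>\<^sub>M borel) \<Otimes>\<^sub>M borel) \<Otimes>\<^sub>M borel)"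
      using measurable_triple_weight by (simp add: split_beta')
  qed
  then show ?thesis by (simp add: split_beta')
qed

lemma measurable_triple_weight_integral2:
  "(\<lambda>(\<gamma>, x). \<integral>\<^sup>+y. \<integral>\<^sup>+z. triple_weight G \<gamma> x y z \<partial>\<gamma> \<partial>\<gamma>) \<in> borel_measurable (conf \<Otimes>\<^sub>M borel)"
proof -
  have "(\<lambda>\<omega>. \<integral>\<^sup>+y. (case \<omega> of (\<gamma>, x) \<Rightarrow> \<lambda>y. \<integral>\<^sup>+z. triple_weight G \<gamma> x y z \<partial>\<gamma>) y \<partial>fst \<omega>)
      \<in> borel_measurable ((conf :: (real^2) measure measure) \<Otimes>\<^sub>M (borel :: (real^2) measure))"
  proof (rule measurable_nn_integral_configuration)
    show "(\<lambda>(\<omega>, y). (case \<omega> of (\<gamma>, x) \<Rightarrow> \<lambda>y. \<integral>\<^sup>+z. triple_weight G \<gamma> x y z \<partial>\<gamma>) y) \<in> borel_measurable ((conf \<Otimes>\<^sub>M borel) \<Otimes>\<^sub>M borel)"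
      using measurable_triple_weight_integral by (simp add: split_beta')
  qed measurable
  then show ?thesis by (simp add: split_beta')
qed

lemma measurable_triple_sum: "triple_sum G \<in> borel_measurable conf"
proof -
  have "(\<lambda>\<gamma>. \<integral>\<^sup>+x. (\<lambda>x. \<integral>\<^sup>+y. \<integral>\<^sup>+z. triple_weight G \<gamma> x y z \<partial>\<gamma> \<partial>\<gamma>) x \<partial>\<gamma>) \<in> borel_measurable conf"
    by (rule measurable_nn_integral_configuration[where g = "\<lambda>\<gamma>. \<gamma>"])
       (use measurable_triple_weight_integral2 in simp_all)
  then show ?thesis by (simp add: triple_sum_def[abs_def])
qed

lemma triple_sum_eq:
  assumes \<gamma>: "\<gamma> \<in> configurations"
  shows "triple_sum G \<gamma> = (\<integral>\<^sup>+x. \<integral>\<^sup>+y. \<integral>\<^sup>+z. triple_weight G \<gamma> x y z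
    \<partial>count_space (points \<gamma>) \<partial>count_space (points \<gamma>) \<partial>count_space (points \<gamma>))"
proof -
  have s: "\<gamma> \<in> space conf" using \<gamma> by simp
  have 3: "(\<lambda>z. triple_weight G \<gamma> x y z) \<in> borel_measurable borel" for x y
    using measurable_compose[OF measurable_Pair1'[of "((\<gamma>, x), y)" "(conf \<Otimes>\<^sub>M borel) \<Otimes>\<^sub>M borel" borel] measurable_triple_weight] s
    by (simp add: space_pair_measure)
  have 2: "(\<lambda>y. \<integral>\<^sup>+z. triple_weight G \<gamma> x y z \<partial>\<gamma>) \<in> borel_measurable borel" for x
    using measurable_compose[OF measurable_Pair1'[of "(\<gamma>, x)" "conf \<Otimes>\<^sub>M borel" borel] measurable_triple_weight_integral] s
    by (simp add: space_pair_measure)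
  have 1: "(\<lambda>x. \<integral>\<^sup>+y. \<integral>\<^sup>+z. triple_weight G \<gamma> x y z \<partial>\<gamma> \<partial>\<gamma>) \<in> borel_measurable borel"
    using measurable_compose[OF measurable_Pair1'[of \<gamma> conf borel] measurable_triple_weight_integral2] s
    by simp
  show ?thesis
    unfolding triple_sum_def nn_integral_configuration[OF \<gamma> 1]
    unfolding nn_integral_configuration[OF \<gamma> 2]
    unfolding nn_integral_configuration[OF \<gamma> 3] ..
qed

lemma triple_weight_eq:
  assumes "\<gamma> \<in> configurations"
  shows "triple_weight G \<gamma> x y z = (if points \<gamma> \<inter> ball (circ x y z) (dist (circ x y z) x) = {} then G x y z else 0)"
  using emeasure_configuration_eq_0_iff[OF assms, of "ball (circ x y z) (dist (circ x y z) x)"]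
  by (auto simp: triple_weight_def indicator_def)

text \<open>A sum of nonnegative terms vanishes only if every term does; this turns quantification
  over all Delaunay triangles into a measurable condition.\<close>

lemma triple_sum_eq_0_iff:
  assumes \<gamma>: "\<gamma> \<in> configurations" and nc: "\<And>x y z. collinear {x, y, z} \<Longrightarrow> G x y z = 0"
  shows "triple_sum G \<gamma> = 0 \<longleftrightarrow> (\<forall>x y z. {x, y, z} \<in> del (points \<gamma>) \<longrightarrow> G x y z = 0)"
proof -
  have "triple_sum G \<gamma> = 0 \<longleftrightarrow> (\<forall>x\<in>points \<gamma>. \<forall>y\<in>points \<gamma>. \<forall>z\<in>points \<gamma>. triple_weight G \<gamma> x y z = 0)"
    unfolding triple_sum_eq[OF \<gamma>] by (simp add: nn_integral_0_iff_AE AE_count_space)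
  also have "\<dots> \<longleftrightarrow> (\<forall>x y z. {x, y, z} \<in> del (points \<gamma>) \<longrightarrow> G x y z = 0)"
  proof -
    have "x \<in> points \<gamma> \<and> y \<in> points \<gamma> \<and> z \<in> points \<gamma> \<and> triple_weight G \<gamma> x y z \<noteq> 0
      \<longleftrightarrow> {x, y, z} \<in> del (points \<gamma>) \<and> G x y z \<noteq> 0" for x y z
    proof (cases "collinear {x, y, z}")
      case True
      then show ?thesis using nc[OF True] by (simp add: triple_weight_def)
    next
      case False
      then show ?thesis
        unfolding triple_weight_eq[OF \<gamma>] del_def
        using noncollinear_distinct(4)[OF False] by (auto simp: circumball_def circum_eq[OF False] Int_commute)
    qed
    then show ?thesis by blast
  qed
  finally show ?thesis .
qed

end

lemma card_orderings_3:
  fixes T :: "'a set"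
  assumes "card T = 3"
  shows "finite {(x, y, z). {x, y, z} = T}" "card {(x, y, z). {x, y, z} = T} = 6"
proof -
  obtain a b c where T: "T = {a, b, c}" "a \<noteq> b" "a \<noteq> c" "b \<noteq> c" using assms by (auto simp: card_3_iff)
  have "{(x, y, z). {x, y, z} = T} = {(a, b, c), (a, c, b), (b, a, c), (b, c, a), (c, a, b), (c, b, a)}"
  proof (rule set_eqI)
    fix t :: "'a \<times> 'a \<times> 'a"
    obtain x y z where t: "t = (x, y, z)" by (cases t) auto
    have A: "t \<in> {(a, b, c), (a, c, b), (b, a, c), (b, c, a), (c, a, b), (c, b, a)}" if xyz: "{x, y, z} = T"
    proof -
      have eq: "{a, b, c} = {x, y, z}" using xyz by (simp only: T(1))
      have "x \<in> {a, b, c}" "y \<in> {a, b, c}" "z \<in> {a, b, c}" unfolding eq by simp_all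
      moreover have "a \<in> {x, y, z}" "b \<in> {x, y, z}" "c \<in> {x, y, z}" unfolding eq[symmetric] by simp_all
      ultimately show ?thesis unfolding t using T(2-4) by (simp only: insert_iff empty_iff simp_thms prod.inject) metis
    qed
    have B: "{x, y, z} = T" if "t \<in> {(a, b, c), (a, c, b), (b, a, c), (b, c, a), (c, a, b), (c, b, a)}"
      using that unfolding t T(1) by (simp; elim disjE; simp add: insert_commute)
    have C: "t \<in> {(x, y, z). {x, y, z} = T} \<longleftrightarrow> {x, y, z} = T" by (simp add: t)
    show "t \<in> {(x, y, z). {x, y, z} = T} \<longleftrightarrow> t \<in> {(a, b, c), (a, c, b), (b, a, c), (b, c, a), (c, a, b), (c, b, a)}"
      unfolding C by (rule iffI[OF A B])
  qed
  then show "finite {(x, y, z). {x, y, z} = T}" "card {(x, y, z). {x, y, z} = T} = 6"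
    using T(2-4) by simp_all
qed

lemma nn_integral_count_space_finite_support:
  assumes "finite S" "S \<subseteq> P" "\<And>x. x \<in> P \<Longrightarrow> x \<notin> S \<Longrightarrow> f x = 0"
  shows "(\<integral>\<^sup>+x. f x \<partial>count_space P) = (\<Sum>x\<in>S. f x)"
  using assms by (intro nn_integral_count_space') auto

text \<open>The three sums are restricted to the finite set of vertices that occur, and the ordered
  triples are then grouped by the triangle they form, six to each.\<close>

lemma triple_sum_finite:
  fixes w :: "(real^2) set \<Rightarrow> real" and G :: "real^2 \<Rightarrow> real^2 \<Rightarrow> real^2 \<Rightarrow> ennreal"
  assumes G: "(\<lambda>(x, y, z). G x y z) \<in> borel_measurable (borel \<Otimes>\<^sub>M borel \<Otimes>\<^sub>M borel)"
    and \<gamma>: "\<gamma> \<in> configurations" and nc: "\<And>x y z. collinear {x, y, z} \<Longrightarrow> G x y z = 0"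
    and \<T>: "finite \<T>" "\<T> \<subseteq> del (points \<gamma>)" and w: "\<And>T. T \<in> \<T> \<Longrightarrow> 0 \<le> w T"
    and Gw: "\<And>x y z. {x, y, z} \<in> del (points \<gamma>) \<Longrightarrow> G x y z = (if {x, y, z} \<in> \<T> then ennreal (w {x, y, z}) else 0)"
  shows "triple_sum G \<gamma> = ennreal (6 * (\<Sum>T\<in>\<T>. w T))"
proof -
  define S where "S = \<Union>\<T>"
  have finT: "finite T" if "T \<in> \<T>" for T using delD(4) \<T>(2) that by blast
  have S: "finite S" "S \<subseteq> points \<gamma>"
    using \<T> finT delD(1) unfolding S_def by blast+
  define K where "K x y z = (if {x, y, z} \<in> \<T> then ennreal (w {x, y, z}) else 0)" for x y z
  have K: "triple_weight G \<gamma> x y z = K x y z" if "x \<in> points \<gamma>" "y \<in> points \<gamma>" "z \<in> points \<gamma>" for x y z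
  proof (cases "{x, y, z} \<in> del (points \<gamma>)")
    case True
    have c: "\<not> collinear {x, y, z}" using delD(3)[OF True] .
    have "circumball {x, y, z} \<inter> points \<gamma> = {}" using True by (simp add: del_def)
    then show ?thesis unfolding triple_weight_eq[OF G \<gamma>] K_def using Gw[OF True]
      by (simp add: circumball_def circum_eq[OF c] Int_commute)
  next
    case False
    then have "K x y z = 0" using \<T>(2) by (auto simp: K_def)
    moreover have "triple_weight G \<gamma> x y z = 0"
    proof (cases "collinear {x, y, z}")
      case True
      then show ?thesis by (simp add: triple_weight_def nc)
    next
      case c: False
      then have "circumball {x, y, z} \<inter> points \<gamma> \<noteq> {}"
        using False that noncollinear_distinct(4)[OF c] by (simp add: del_def)
      then show ?thesis unfolding triple_weight_eq[OF G \<gamma>]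
        by (simp add: circumball_def circum_eq[OF c] Int_commute)
    qed
    ultimately show ?thesis by simp
  qed
  have K0: "K x y z = 0" if "x \<notin> S \<or> y \<notin> S \<or> z \<notin> S" for x y z
    using that by (auto simp: K_def S_def)
  have "triple_sum G \<gamma> = (\<integral>\<^sup>+x. \<integral>\<^sup>+y. \<integral>\<^sup>+z. K x y z
    \<partial>count_space (points \<gamma>) \<partial>count_space (points \<gamma>) \<partial>count_space (points \<gamma>))"
    unfolding triple_sum_eq[OF G \<gamma>] by (intro nn_integral_cong) (simp add: K)
  also have "\<dots> = (\<Sum>x\<in>S. \<Sum>y\<in>S. \<Sum>z\<in>S. K x y z)"
    by (simp add: nn_integral_count_space_finite_support[OF S] K0)
  also have "\<dots> = (\<Sum>t\<in>S \<times> S \<times> S. case t of (x, y, z) \<Rightarrow> K x y z)"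
    by (simp add: sum.cartesian_product)
  also have "\<dots> = (\<Sum>t\<in>{t \<in> S \<times> S \<times> S. (case t of (x, y, z) \<Rightarrow> {x, y, z}) \<in> \<T>}. case t of (x, y, z) \<Rightarrow> K x y z)"
    using S(1) by (intro sum.mono_neutral_right) (auto simp: K_def split: if_splits)
  also have "\<dots> = (\<Sum>T\<in>\<T>. \<Sum>t\<in>{t \<in> {t \<in> S \<times> S \<times> S. (case t of (x, y, z) \<Rightarrow> {x, y, z}) \<in> \<T>}. (case t of (x, y, z) \<Rightarrow> {x, y, z}) = T}. case t of (x, y, z) \<Rightarrow> K x y z)"
    using S(1) \<T>(1) by (intro sum.group[symmetric]) auto
  also have "\<dots> = (\<Sum>T\<in>\<T>. ennreal (6 * w T))"
  proof (rule sum.cong[OF refl])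
    fix T assume T: "T \<in> \<T>"
    have "{t \<in> {t \<in> S \<times> S \<times> S. (case t of (x, y, z) \<Rightarrow> {x, y, z}) \<in> \<T>}. (case t of (x, y, z) \<Rightarrow> {x, y, z}) = T}
      = {(x, y, z). {x, y, z} = T}"
      using T unfolding S_def by auto
    moreover have "(\<Sum>t\<in>{(x, y, z). {x, y, z} = T}. case t of (x, y, z) \<Rightarrow> K x y z) = (\<Sum>t\<in>{(x, y, z). {x, y, z} = T}. ennreal (w T))"
      using T by (intro sum.cong) (auto simp: K_def)
    moreover have "\<dots> = ennreal (6 * w T)"
      using card_orderings_3(2)[OF delD(2)] \<T>(2) T w[OF T] by (auto simp: ennreal_mult subsetD)
    ultimately show "(\<Sum>t\<in>{t \<in> {t \<in> S \<times> S \<times> S. (case t of (x, y, z) \<Rightarrow> {x, y, z}) \<in> \<T>}. (case t of (x, y, z) \<Rightarrow> {x, y, z}) = T}. case t of (x, y, z) \<Rightarrow> K x y z)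
      = ennreal (6 * w T)" by simp
  qed
  also have "\<dots> = ennreal (6 * (\<Sum>T\<in>\<T>. w T))"
    using w by (simp add: sum_ennreal sum_distrib_left)
  finally show ?thesis .
qed

lemma ball_Int_ball_nonempty_iff:
  fixes c :: "'a::real_normed_vector"
  assumes "0 < \<rho>" "0 < R"
  shows "ball c \<rho> \<inter> ball 0 R \<noteq> {} \<longleftrightarrow> norm c < \<rho> + R"
proof
  assume "ball c \<rho> \<inter> ball 0 R \<noteq> {}"
  then obtain z where "dist c z < \<rho>" "norm z < R" by auto
  moreover have "norm c \<le> dist c z + norm z" by (metis dist_norm norm_triangle_sub add.commute)
  ultimately show "norm c < \<rho> + R" by linarith
next
  assume l: "norm c < \<rho> + R"
  \<comment> \<open>The point dividing the segment from the origin to \<open>c\<close> in the ratio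
    of the two radii; it lies in both balls.\<close>
  define z where "z = (R / (\<rho> + R)) *\<^sub>R c"
  have "c - z = (\<rho> / (\<rho> + R)) *\<^sub>R c"
  proof -
    have "c - z = (1 - R / (\<rho> + R)) *\<^sub>R c" by (simp add: z_def scaleR_left_diff_distrib)
    also have "1 - R / (\<rho> + R) = \<rho> / (\<rho> + R)" using assms by (simp add: field_simps)
    finally show ?thesis .
  qed
  then have d: "dist c z = \<rho> * (norm c / (\<rho> + R))" using assms by (simp add: dist_norm)
  have n: "norm z = R * (norm c / (\<rho> + R))" using assms by (simp add: z_def)
  define u where "u = norm c / (\<rho> + R)"
  have "u < 1" using l assms by (simp add: u_def)
  then have "\<rho> * u < \<rho>" "R * u < R" using assms by simp_all
  then have "dist c z < \<rho>" "norm z < R" unfolding d n u_def .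
  then show "ball c \<rho> \<inter> ball 0 R \<noteq> {}" by auto
qed

lemma perimeter_3:
  assumes "x \<noteq> y" "x \<noteq> z" "y \<noteq> z"
  shows "perimeter {x, y, z} = dist x y + dist y z + dist z x"
  using assms by (simp add: perimeter_def dist_commute)

lemma hit_ball_iff:
  assumes "0 < R"
  shows "{x, y, z} \<in> hit P (ball 0 R) \<longleftrightarrow> {x, y, z} \<in> del P \<and> norm (circ x y z) < dist (circ x y z) x + R"
proof (cases "{x, y, z} \<in> del P")
  case True
  note c = delD(3)[OF True]
  have "0 < dist (circ x y z) x" using delD(5)[OF True] by (simp add: circum_eq[OF c])
  then show ?thesis using True by (simp add: hit_def circumball_def circum_eq[OF c] ball_Int_ball_nonempty_iff[OF _ assms])
qed (simp add: hit_def)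

lemma tame_3_iff:
  assumes "\<not> collinear {x, y, z}"
  shows "tame r \<alpha> {x, y, z} \<longleftrightarrow> dist (circ x y z) x < \<alpha> \<and> r < dist x y \<and> r < dist y z \<and> r < dist z x"
  using min_side_le_iff[OF noncollinear_distinct(4)[OF assms], of r] noncollinear_distinct(1,2,3)[OF assms]
  by (auto simp: tame_def circum_eq[OF assms] not_le[symmetric] dist_commute)

text \<open>Its triple sum vanishes exactly when the energy in \<open>ball 0 R\<close> is
  finite.\<close>

definition wild_weight :: "real \<Rightarrow> real \<Rightarrow> real \<Rightarrow> real^2 \<Rightarrow> real^2 \<Rightarrow> real^2 \<Rightarrow> ennreal" where
  "wild_weight r \<alpha> R x y z = (if \<not> collinear {x, y, z} \<and> norm (circ x y z) < dist (circ x y z) x + R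
     \<and> \<not> (dist (circ x y z) x < \<alpha> \<and> r < dist x y \<and> r < dist y z \<and> r < dist z x) then 1 else 0)"

definition perimeter_weight :: "real \<Rightarrow> real^2 \<Rightarrow> real^2 \<Rightarrow> real^2 \<Rightarrow> ennreal" where
  "perimeter_weight R x y z = (if \<not> collinear {x, y, z} \<and> norm (circ x y z) < dist (circ x y z) x + R
     then ennreal (dist x y + dist y z + dist z x) else 0)"

lemma measurable_weights:
  "(\<lambda>(x, y, z). wild_weight r \<alpha> R x y z) \<in> borel_measurable (borel \<Otimes>\<^sub>M borel \<Otimes>\<^sub>M borel)"
  "(\<lambda>(x, y, z). perimeter_weight R x y z) \<in> borel_measurable (borel \<Otimes>\<^sub>M borel \<Otimes>\<^sub>M borel)"
  unfolding wild_weight_def perimeter_weight_def split_beta' by measurable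

text \<open>The energy is a measurable function of two triple sums: one decides finiteness, the
  other gives the total perimeter.\<close>

lemma measurable_delaunay_energy:
  assumes R: "0 < R"
  shows "delaunay_energy r \<alpha> \<theta> (ball 0 R) \<in> borel_measurable conf"
proof -
  let ?W = "triple_sum (wild_weight r \<alpha> R)" and ?P = "triple_sum (perimeter_weight R)"
  have [measurable]: "?W \<in> borel_measurable conf" "?P \<in> borel_measurable conf"
    by (rule measurable_triple_sum[OF measurable_weights(1)] measurable_triple_sum[OF measurable_weights(2)])+
  \<comment> \<open>Division by 6 compensates for the six orderings of each triangle.\<close>
  have eq: "delaunay_energy r \<alpha> \<theta> (ball 0 R) \<gamma> = (if ?W \<gamma> = 0 then ereal (\<theta> * (enn2real (?P \<gamma>) / 6)) else \<infinity>)"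
    if \<gamma>: "\<gamma> \<in> configurations" for \<gamma>
  proof -
    let ?H = "hit (points \<gamma>) (ball 0 R)"
    have W: "?W \<gamma> = 0 \<longleftrightarrow> (\<forall>T\<in>?H. tame r \<alpha> T)"
    proof -
      have "?W \<gamma> = 0 \<longleftrightarrow> (\<forall>x y z. {x, y, z} \<in> del (points \<gamma>) \<longrightarrow> wild_weight r \<alpha> R x y z = 0)"
        by (rule triple_sum_eq_0_iff[OF measurable_weights(1) \<gamma>]) (simp add: wild_weight_def)
      also have "\<dots> \<longleftrightarrow> (\<forall>x y z. {x, y, z} \<in> ?H \<longrightarrow> tame r \<alpha> {x, y, z})"
      proof -
        have "({x, y, z} \<in> del (points \<gamma>) \<longrightarrow> wild_weight r \<alpha> R x y z = 0) \<longleftrightarrow> ({x, y, z} \<in> ?H \<longrightarrow> tame r \<alpha> {x, y, z})" for x y z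
        proof (cases "{x, y, z} \<in> del (points \<gamma>)")
          case True
          note c = delD(3)[OF True]
          show ?thesis using True c by (simp add: hit_ball_iff[OF R] wild_weight_def tame_3_iff[OF c])
        qed (simp add: hit_def)
        then show ?thesis by simp
      qed
      also have "\<dots> \<longleftrightarrow> (\<forall>T\<in>?H. tame r \<alpha> T)"
      proof (intro iffI ballI)
        fix T assume *: "\<forall>x y z. {x, y, z} \<in> ?H \<longrightarrow> tame r \<alpha> {x, y, z}" and T: "T \<in> ?H"
        obtain x y z where "T = {x, y, z}" using delD(2)[OF hit_del[OF T]] by (auto simp: card_3_iff)
        then show "tame r \<alpha> T" using * T by blast
      qed blast
      finally show ?thesis .
    qed
    show ?thesis
    proof (cases "\<forall>T\<in>?H. tame r \<alpha> T")
      case True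
      have fin: "finite ?H" using finite_hit[OF locally_finite_points[OF \<gamma>] bounded_ball True] .
      have pos: "0 \<le> perimeter T" for T :: "(real^2) set"
        unfolding perimeter_def by (intro divide_nonneg_nonneg sum_nonneg) auto
      have "?P \<gamma> = ennreal (6 * (\<Sum>T\<in>?H. perimeter T))"
      proof (rule triple_sum_finite[OF measurable_weights(2) \<gamma> _ fin])
        show "?H \<subseteq> del (points \<gamma>)" by (auto simp: hit_def)
        fix x y z :: "real^2"
        show "perimeter_weight R x y z = 0" if "collinear {x, y, z}" using that by (simp add: perimeter_weight_def)
        show "perimeter_weight R x y z = (if {x, y, z} \<in> ?H then ennreal (perimeter {x, y, z}) else 0)"
          if T: "{x, y, z} \<in> del (points \<gamma>)"
          using T noncollinear_distinct(1,2,3)[OF delD(3)[OF T]] delD(3)[OF T]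
          by (simp add: hit_ball_iff[OF R] perimeter_weight_def perimeter_3)
      qed (rule pos)
      moreover have "0 \<le> (\<Sum>T\<in>?H. perimeter T)" using pos by (intro sum_nonneg)
      ultimately have "enn2real (?P \<gamma>) / 6 = (\<Sum>T\<in>?H. perimeter T)" by simp
      then show ?thesis using True W by (simp add: delaunay_energy_eq)
    next
      case False
      then have "delaunay_energy r \<alpha> \<theta> (ball 0 R) \<gamma> = \<infinity>" by (simp only: delaunay_energy_infinite_iff not_False_eq_True)
      moreover have "?W \<gamma> \<noteq> 0" using False W by blast
      ultimately show ?thesis by simp
    qed
  qed
  have "(\<lambda>\<gamma>. if ?W \<gamma> = 0 then ereal (\<theta> * (enn2real (?P \<gamma>) / 6)) else \<infinity>) \<in> borel_measurable conf"
    by measurable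
  then show ?thesis by (rule measurable_cong[THEN iffD1, rotated]) (simp add: eq)
qed

definition cocircular_weight :: "real \<Rightarrow> real^2 \<Rightarrow> real^2 \<Rightarrow> real^2 \<Rightarrow> ennreal" where
  "cocircular_weight \<alpha> x y z = (if \<not> collinear {x, y, z} \<and> norm (circ x y z) = dist (circ x y z) x
     \<and> dist (circ x y z) x < \<alpha> then 1 else 0)"

text \<open>This event is shown below to be null. Outside it, a disc of radius below
  \<open>\<alpha>\<close> either contains the origin or keeps a positive distance from it.\<close>

lemma origin_on_delaunay_circle_measurable:
  "{\<gamma> \<in> configurations. 0 \<in> points \<gamma> \<or> (\<exists>T\<in>del (points \<gamma>). norm (circumcenter T) = circumradius T \<and> circumradius T < \<alpha>)} \<in> sets conf"
proof -
  have m: "(\<lambda>(x, y, z). cocircular_weight \<alpha> x y z) \<in> borel_measurable (borel \<Otimes>\<^sub>M borel \<Otimes>\<^sub>M borel)"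
    unfolding cocircular_weight_def split_beta' by measurable
  have [measurable]: "triple_sum (cocircular_weight \<alpha>) \<in> borel_measurable conf"
    by (rule measurable_triple_sum[OF m])
  have [measurable]: "(\<lambda>\<gamma>. emeasure \<gamma> {0 :: real^2}) \<in> borel_measurable conf" by simp
  have "(\<exists>T\<in>del (points \<gamma>). norm (circumcenter T) = circumradius T \<and> circumradius T < \<alpha>) \<longleftrightarrow> triple_sum (cocircular_weight \<alpha>) \<gamma> \<noteq> 0"
    if \<gamma>: "\<gamma> \<in> configurations" for \<gamma>
  proof -
    have "triple_sum (cocircular_weight \<alpha>) \<gamma> = 0 \<longleftrightarrow> (\<forall>x y z. {x, y, z} \<in> del (points \<gamma>) \<longrightarrow> cocircular_weight \<alpha> x y z = 0)"
      by (rule triple_sum_eq_0_iff[OF m \<gamma>]) (simp add: cocircular_weight_def)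
    also have "\<dots> \<longleftrightarrow> (\<forall>x y z. {x, y, z} \<in> del (points \<gamma>) \<longrightarrow>
        \<not> (norm (circumcenter {x, y, z}) = circumradius {x, y, z} \<and> circumradius {x, y, z} < \<alpha>))"
    proof -
      have "({x, y, z} \<in> del (points \<gamma>) \<longrightarrow> cocircular_weight \<alpha> x y z = 0) \<longleftrightarrow> ({x, y, z} \<in> del (points \<gamma>) \<longrightarrow>
        \<not> (norm (circumcenter {x, y, z}) = circumradius {x, y, z} \<and> circumradius {x, y, z} < \<alpha>))" for x y z
        using delD(3)[of "{x, y, z}" "points \<gamma>"] by (cases "{x, y, z} \<in> del (points \<gamma>)") (simp_all add: cocircular_weight_def circum_eq)
      then show ?thesis by simp
    qed
    also have "\<dots> \<longleftrightarrow> \<not> (\<exists>T\<in>del (points \<gamma>). norm (circumcenter T) = circumradius T \<and> circumradius T < \<alpha>)"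
    proof (intro iffI notI allI impI)
      assume *: "\<forall>x y z. {x, y, z} \<in> del (points \<gamma>) \<longrightarrow>
        \<not> (norm (circumcenter {x, y, z}) = circumradius {x, y, z} \<and> circumradius {x, y, z} < \<alpha>)"
        and "\<exists>T\<in>del (points \<gamma>). norm (circumcenter T) = circumradius T \<and> circumradius T < \<alpha>"
      then obtain T where T: "T \<in> del (points \<gamma>)" "norm (circumcenter T) = circumradius T \<and> circumradius T < \<alpha>" by blast
      obtain x y z where "T = {x, y, z}" using delD(2)[OF T(1)] by (auto simp: card_3_iff)
      then show False using * T by blast
    qed blast
    finally show ?thesis by simp
  qed
  moreover have "0 \<in> points \<gamma> \<longleftrightarrow> emeasure \<gamma> {0} \<noteq> 0" for \<gamma> :: "(real^2) measure"
    by (simp add: points_def zero_less_iff_neq_zero)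
  ultimately have "{\<gamma> \<in> configurations. 0 \<in> points \<gamma> \<or> (\<exists>T\<in>del (points \<gamma>). norm (circumcenter T) = circumradius T \<and> circumradius T < \<alpha>)}
    = {\<gamma> \<in> space conf. emeasure \<gamma> {0 :: real^2} \<noteq> 0 \<or> triple_sum (cocircular_weight \<alpha>) \<gamma> \<noteq> 0}"
    by (simp cong: conj_cong)
  also have "\<dots> \<in> sets conf" by measurable
  finally show ?thesis .
qed


section \<open>Gibbs measures and stationarity\<close>

lemma borel_measurable_boltzmann [measurable]: "boltzmann \<in> borel_measurable borel"
  unfolding boltzmann_def by measurable

lemma boltzmann_nonneg [simp]: "0 \<le> boltzmann e"
  by (simp add: boltzmann_def)

lemma boltzmann_eq_0_iff: "boltzmann e = 0 \<longleftrightarrow> e = \<infinity>"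
  by (simp add: boltzmann_def)

lemma poisson_process_space:
  assumes "poisson_process \<Lambda> \<pi>"
  shows "prob_space \<pi>" "sets \<pi> = sets conf" "space \<pi> = configurations"
  using assms sets_eq_imp_space_eq[of \<pi> conf] by (auto simp: poisson_process_def)

text \<open>By independence the probability is a product of Poisson weights. A weight for count 0 is
  positive even if the volume is 0, since it is then \<open>exp 0\<close>.\<close>

lemma poisson_process_counts_positive:
  fixes I :: "nat set"
  assumes \<pi>: "poisson_process \<Lambda> \<pi>" and I: "finite I" "disjoint_family_on B I"
    and B: "\<And>i. i \<in> I \<Longrightarrow> B i \<in> bounded_borel"
    and k: "\<And>i. i \<in> I \<Longrightarrow> k i = 0 \<or> 0 < measure lborel (B i \<inter> \<Lambda>)"
  shows "0 < measure \<pi> {\<gamma> \<in> space \<pi>. \<forall>i\<in>I. emeasure \<gamma> (B i) = of_nat (k i)}"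
proof (cases "I = {}")
  case True
  interpret prob_space \<pi> using poisson_process_space(1)[OF \<pi>] .
  show ?thesis using True prob_space by simp
next
  case False
  interpret prob_space \<pi> using poisson_process_space(1)[OF \<pi>] .
  have "B ` I \<subseteq> bounded_borel" using B by blast
  then have ind: "indep_vars (\<lambda>_. borel) (\<lambda>i \<gamma>. emeasure \<gamma> (B i)) I"
    using \<pi> I by (simp add: poisson_process_def)
  have "prob (\<Inter>i\<in>I. (\<lambda>\<gamma>. emeasure \<gamma> (B i)) -` {of_nat (k i)} \<inter> space \<pi>)
      = (\<Prod>i\<in>I. prob ((\<lambda>\<gamma>. emeasure \<gamma> (B i)) -` {of_nat (k i)} \<inter> space \<pi>))"
    by (rule indep_varsD[OF ind False I(1)]) auto
  also have "\<dots> > 0"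
  proof (rule prod_pos)
    fix i assume i: "i \<in> I"
    have "(\<lambda>\<gamma>. emeasure \<gamma> (B i)) -` {of_nat (k i)} \<inter> space \<pi> = {\<gamma> \<in> space \<pi>. emeasure \<gamma> (B i) = of_nat (k i)}"
      by auto
    then have "prob ((\<lambda>\<gamma>. emeasure \<gamma> (B i)) -` {of_nat (k i)} \<inter> space \<pi>)
      = exp (- measure lborel (B i \<inter> \<Lambda>)) * measure lborel (B i \<inter> \<Lambda>) ^ k i / fact (k i)"
      using \<pi> B[OF i] by (simp add: poisson_process_def)
    also have "\<dots> > 0" using k[OF i] by auto
    finally show "0 < prob ((\<lambda>\<gamma>. emeasure \<gamma> (B i)) -` {of_nat (k i)} \<inter> space \<pi>)" .
  qed
  also have "(\<Inter>i\<in>I. (\<lambda>\<gamma>. emeasure \<gamma> (B i)) -` {of_nat (k i)} \<inter> space \<pi>)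
      = {\<gamma> \<in> space \<pi>. \<forall>i\<in>I. emeasure \<gamma> (B i) = of_nat (k i)}"
    using False by auto
  finally show ?thesis .
qed

lemma (in prob_space) AE_positive_obtain:
  assumes "AE x in M. P x" "0 < measure M A"
  obtains x where "x \<in> A" "P x"
proof -
  \<comment> \<open>The value of \<open>measure\<close> outside the sigma-algebra is 0 by default,
    so a positive value implies measurability.\<close>
  have "A \<in> sets M" using assms(2) measure_notin_sets by force
  have "\<not> (\<forall>x\<in>A. \<not> P x)"
  proof
    assume *: "\<forall>x\<in>A. \<not> P x"
    have "AE x in M. x \<notin> A" using assms(1) by eventually_elim (use * in blast)
    then have "prob A = 0" using prob_eq_0[OF \<open>A \<in> sets M\<close>] by simp
    then show False using assms(2) by simp
  qed
  then show ?thesis using that by blast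
qed

context
  fixes H :: "'a::euclidean_space energy" and \<nu> :: "'a measure measure"
  assumes gibbs: "gibbs_measure H \<nu>"
begin

lemma gibbs_space: "prob_space \<nu>" "sets \<nu> = sets conf" "space \<nu> = configurations"
proof -
  show "prob_space \<nu>" by (rule conjunct1[OF gibbs[unfolded gibbs_measure_def]])
  show "sets \<nu> = sets conf" by (rule conjunct1[OF conjunct2[OF gibbs[unfolded gibbs_measure_def]]])
  from sets_eq_imp_space_eq[OF this] show "space \<nu> = configurations" by simp
qed

lemma gibbs_equation:
  assumes "\<Lambda> \<in> bounded_borel"
  obtains \<pi> where "poisson_process \<Lambda> \<pi>"
    and "AE \<gamma> in \<nu>. 0 < partition_fun H \<Lambda> \<pi> \<gamma> \<and> partition_fun H \<Lambda> \<pi> \<gamma> < \<infinity>"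
    and "\<forall>f :: 'a measure \<Rightarrow> real. f \<in> borel_measurable conf \<and> bounded (f ` space conf) \<longrightarrow>
       (\<integral>\<gamma>. f \<gamma> \<partial>\<nu>) = (\<integral>\<gamma>. (\<integral>\<gamma>'. f (glue \<Lambda> \<gamma>' \<gamma>)
         * (boltzmann (H \<Lambda> (glue \<Lambda> \<gamma>' \<gamma>)) / enn2real (partition_fun H \<Lambda> \<pi> \<gamma>)) \<partial>\<pi>) \<partial>\<nu>)"
  using bspec[OF conjunct2[OF conjunct2[OF gibbs[unfolded gibbs_measure_def]]] assms]
  by (elim exE conjE) (rule that)

text \<open>With the indicator of \<open>E\<close> in the Gibbs equation, the integral of a
  nonnegative function is 0, so the function vanishes almost everywhere; the Boltzmann factor
  vanishes only at infinite energy. Used by contraposition: resamplings of finite energy that enter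
  \<open>E\<close> with positive Poisson probability make \<open>E\<close> non-null.\<close>

lemma gibbs_null_event:
  assumes L: "\<Lambda> \<in> bounded_borel" and H [measurable]: "H \<Lambda> \<in> borel_measurable conf"
    and E [measurable]: "E \<in> sets conf" and null: "measure \<nu> E = 0"
  shows "\<exists>\<pi>. poisson_process \<Lambda> \<pi> \<and>
    (AE \<gamma> in \<nu>. AE \<gamma>' in \<pi>. glue \<Lambda> \<gamma>' \<gamma> \<in> E \<longrightarrow> H \<Lambda> (glue \<Lambda> \<gamma>' \<gamma>) = \<infinity>)"
proof -
  obtain \<pi> where \<pi>: "poisson_process \<Lambda> \<pi>"
    and Z: "AE \<gamma> in \<nu>. 0 < partition_fun H \<Lambda> \<pi> \<gamma> \<and> partition_fun H \<Lambda> \<pi> \<gamma> < \<infinity>"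
    and eq: "\<forall>f :: 'a measure \<Rightarrow> real. f \<in> borel_measurable conf \<and> bounded (f ` space conf) \<longrightarrow>
       (\<integral>\<gamma>. f \<gamma> \<partial>\<nu>) = (\<integral>\<gamma>. (\<integral>\<gamma>'. f (glue \<Lambda> \<gamma>' \<gamma>)
         * (boltzmann (H \<Lambda> (glue \<Lambda> \<gamma>' \<gamma>)) / enn2real (partition_fun H \<Lambda> \<pi> \<gamma>)) \<partial>\<pi>) \<partial>\<nu>)"
    by (rule gibbs_equation[OF L])
  interpret \<nu>: prob_space \<nu> by (rule gibbs_space(1))
  interpret \<pi>: prob_space \<pi> by (rule poisson_process_space(1)[OF \<pi>])
  note [measurable_cong] = gibbs_space(2) poisson_process_space(2)[OF \<pi>]
  have [measurable]: "\<Lambda> \<in> sets borel" using L by (simp add: bounded_borel_def)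
  let ?Z = "partition_fun H \<Lambda> \<pi>"
  define w where "w \<gamma> \<gamma>' = boltzmann (H \<Lambda> (glue \<Lambda> \<gamma>' \<gamma>))" for \<gamma> \<gamma>'
  define g where "g \<gamma> \<gamma>' = indicator E (glue \<Lambda> \<gamma>' \<gamma>) * (w \<gamma> \<gamma>' / enn2real (?Z \<gamma>))" for \<gamma> \<gamma>'
  have gl [measurable]: "(\<lambda>p. glue \<Lambda> (snd p) (fst p)) \<in> measurable (\<nu> \<Otimes>\<^sub>M \<pi>) conf"
    by (intro measurable_glue) measurable
  have wm [measurable]: "(\<lambda>(\<gamma>, \<gamma>'). w \<gamma> \<gamma>') \<in> borel_measurable (\<nu> \<Otimes>\<^sub>M \<pi>)"
  proof -
    have "(\<lambda>p. boltzmann (H \<Lambda> (glue \<Lambda> (snd p) (fst p)))) \<in> borel_measurable (\<nu> \<Otimes>\<^sub>M \<pi>)"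
      by (intro measurable_compose[OF _ borel_measurable_boltzmann] measurable_compose[OF gl H])
    then show ?thesis by (simp add: w_def split_beta')
  qed
  have Zm [measurable]: "?Z \<in> borel_measurable \<nu>"
  proof -
    have "(\<lambda>\<gamma>. \<integral>\<^sup>+\<gamma>'. ennreal (w \<gamma> \<gamma>') \<partial>\<pi>) \<in> borel_measurable \<nu>"
      by (rule \<pi>.borel_measurable_nn_integral) measurable
    then show ?thesis by (simp add: partition_fun_def[abs_def] w_def)
  qed
  have gm [measurable]: "(\<lambda>(\<gamma>, \<gamma>'). g \<gamma> \<gamma>') \<in> borel_measurable (\<nu> \<Otimes>\<^sub>M \<pi>)"
  proof -
    have 1: "(\<lambda>p. w (fst p) (snd p)) \<in> borel_measurable (\<nu> \<Otimes>\<^sub>M \<pi>)" using wm by (simp add: split_beta')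
    have 2: "(\<lambda>p. indicator E (glue \<Lambda> (snd p) (fst p)) :: real) \<in> borel_measurable (\<nu> \<Otimes>\<^sub>M \<pi>)"
      by (rule measurable_compose[OF gl]) simp
    have 3: "(\<lambda>p. enn2real (?Z (fst p))) \<in> borel_measurable (\<nu> \<Otimes>\<^sub>M \<pi>)" by measurable
    have "(\<lambda>p. g (fst p) (snd p)) \<in> borel_measurable (\<nu> \<Otimes>\<^sub>M \<pi>)"
      unfolding g_def using 1 2 3 by simp
    then show ?thesis by (simp add: split_beta')
  qed
  have g0: "0 \<le> g \<gamma> \<gamma>'" for \<gamma> \<gamma>' by (simp add: g_def w_def)
  have gm1: "g \<gamma> \<in> borel_measurable \<pi>" if "\<gamma> \<in> space \<nu>" for \<gamma>
    using measurable_compose[OF measurable_Pair1'[OF that] gm] by simp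
  have wm1: "w \<gamma> \<in> borel_measurable \<pi>" if "\<gamma> \<in> space \<nu>" for \<gamma>
    using measurable_compose[OF measurable_Pair1'[OF that] wm] by simp
  \<comment> \<open>\<open>g\<close> is at most the normalised Boltzmann density, whose mass is 1.
    The resulting integrability is needed before a zero Bochner integral allows the conclusion that
    the integrand vanishes.\<close>
  have le1: "(\<integral>\<^sup>+\<gamma>'. ennreal (g \<gamma> \<gamma>') \<partial>\<pi>) \<le> 1"
    if \<gamma>: "\<gamma> \<in> space \<nu>" and z: "0 < ?Z \<gamma>" "?Z \<gamma> < \<infinity>" for \<gamma>
  proof -
    have zp: "0 < enn2real (?Z \<gamma>)" using z by (simp add: enn2real_positive_iff)
    have "(\<integral>\<^sup>+\<gamma>'. ennreal (g \<gamma> \<gamma>') \<partial>\<pi>) \<le> (\<integral>\<^sup>+\<gamma>'. ennreal (w \<gamma> \<gamma>') / ennreal (enn2real (?Z \<gamma>)) \<partial>\<pi>)"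
    proof (rule nn_integral_mono)
      fix \<gamma>'
      have "g \<gamma> \<gamma>' \<le> w \<gamma> \<gamma>' / enn2real (?Z \<gamma>)"
        using zp by (cases "glue \<Lambda> \<gamma>' \<gamma> \<in> E") (simp_all add: g_def w_def)
      then show "ennreal (g \<gamma> \<gamma>') \<le> ennreal (w \<gamma> \<gamma>') / ennreal (enn2real (?Z \<gamma>))"
        using zp by (simp add: divide_ennreal w_def)
    qed
    also have "\<dots> = (\<integral>\<^sup>+\<gamma>'. ennreal (w \<gamma> \<gamma>') \<partial>\<pi>) / ennreal (enn2real (?Z \<gamma>))"
      using wm1[OF \<gamma>] by (intro nn_integral_divide) simp
    also have "\<dots> = ?Z \<gamma> / ?Z \<gamma>" using z by (simp add: partition_fun_def w_def)
    also have "\<dots> = 1" using z by (intro ennreal_divide_self) auto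
    finally show ?thesis .
  qed
  have intF: "(\<integral>\<gamma>'. g \<gamma> \<gamma>' \<partial>\<pi>) = enn2real (\<integral>\<^sup>+\<gamma>'. ennreal (g \<gamma> \<gamma>') \<partial>\<pi>)" if "\<gamma> \<in> space \<nu>" for \<gamma>
    using gm1[OF that] g0 by (intro integral_eq_nn_integral) auto
  have Fm [measurable]: "(\<lambda>\<gamma>. \<integral>\<gamma>'. g \<gamma> \<gamma>' \<partial>\<pi>) \<in> borel_measurable \<nu>"
    using gm by (rule \<pi>.borel_measurable_lebesgue_integral)
  have "AE \<gamma> in \<nu>. norm (\<integral>\<gamma>'. g \<gamma> \<gamma>' \<partial>\<pi>) \<le> 1"
    using Z AE_space
  proof eventually_elim
    case (elim \<gamma>)
    have "enn2real (\<integral>\<^sup>+\<gamma>'. ennreal (g \<gamma> \<gamma>') \<partial>\<pi>) \<le> enn2real 1"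
      using le1[OF elim(2)] elim(1) by (intro enn2real_mono) auto
    then show ?case using intF[OF elim(2)] by simp
  qed
  then have int: "integrable \<nu> (\<lambda>\<gamma>. \<integral>\<gamma>'. g \<gamma> \<gamma>' \<partial>\<pi>)"
    by (rule \<nu>.integrable_const_bound) measurable
  have bd: "bounded ((indicator E :: 'a measure \<Rightarrow> real) ` space conf)"
    by (rule bounded_subset[of "{0, 1}"]) (auto simp: indicator_def)
  have "(\<integral>\<gamma>. (\<integral>\<gamma>'. g \<gamma> \<gamma>' \<partial>\<pi>) \<partial>\<nu>) = (\<integral>\<gamma>. indicator E \<gamma> \<partial>\<nu>)"
    unfolding g_def w_def by (rule eq[rule_format, symmetric]) (use bd in simp_all)
  also have "\<dots> = 0" using null E by (simp add: gibbs_space(2))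
  finally have "(\<integral>\<gamma>. (\<integral>\<gamma>'. g \<gamma> \<gamma>' \<partial>\<pi>) \<partial>\<nu>) = 0" .
  moreover have "AE \<gamma> in \<nu>. 0 \<le> (\<integral>\<gamma>'. g \<gamma> \<gamma>' \<partial>\<pi>)"
    using g0 by (intro AE_I2 integral_nonneg_AE) auto
  ultimately have "AE \<gamma> in \<nu>. (\<integral>\<gamma>'. g \<gamma> \<gamma>' \<partial>\<pi>) = 0"
    using integral_nonneg_eq_0_iff_AE[OF int] by simp
  then have "AE \<gamma> in \<nu>. AE \<gamma>' in \<pi>. glue \<Lambda> \<gamma>' \<gamma> \<in> E \<longrightarrow> H \<Lambda> (glue \<Lambda> \<gamma>' \<gamma>) = \<infinity>"
    using Z AE_space
  proof eventually_elim
    case (elim \<gamma>)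
    have zp: "0 < enn2real (?Z \<gamma>)" using elim(2) by (simp add: enn2real_positive_iff)
    have "(\<integral>\<^sup>+\<gamma>'. ennreal (g \<gamma> \<gamma>') \<partial>\<pi>) \<noteq> \<infinity>"
      using le1[OF elim(3)] elim(2) by (auto simp: top_unique)
    moreover have "enn2real (\<integral>\<^sup>+\<gamma>'. ennreal (g \<gamma> \<gamma>') \<partial>\<pi>) = 0" using elim(1) intF[OF elim(3)] by simp
    ultimately have "(\<integral>\<^sup>+\<gamma>'. ennreal (g \<gamma> \<gamma>') \<partial>\<pi>) = 0" by (simp add: enn2real_eq_0_iff)
    then have "AE \<gamma>' in \<pi>. ennreal (g \<gamma> \<gamma>') = 0"
      using gm1[OF elim(3)] by (subst (asm) nn_integral_0_iff_AE) auto
    then show ?case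
    proof eventually_elim
      case (elim \<gamma>')
      then have "g \<gamma> \<gamma>' = 0" using g0[of \<gamma> \<gamma>'] by (simp add: ennreal_eq_0_iff)
      then show ?case using zp by (auto simp: g_def w_def boltzmann_eq_0_iff)
    qed
  qed
  then show ?thesis using \<pi> by blast
qed

text \<open>For the indicator of infinite energy, the right-hand side of the Gibbs equation vanishes
  identically, because the Boltzmann factor is 0 wherever the indicator is 1.\<close>

lemma gibbs_AE_finite:
  assumes L: "\<Lambda> \<in> bounded_borel" and H [measurable]: "H \<Lambda> \<in> borel_measurable conf"
  shows "AE \<gamma> in \<nu>. H \<Lambda> \<gamma> \<noteq> \<infinity>"
proof -
  interpret \<nu>: prob_space \<nu> by (rule gibbs_space(1))
  define E where "E = {\<gamma> \<in> space conf. H \<Lambda> \<gamma> = \<infinity>}"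
  have E [measurable]: "E \<in> sets conf" unfolding E_def by measurable
  obtain \<pi> where eq: "\<forall>f :: 'a measure \<Rightarrow> real. f \<in> borel_measurable conf \<and> bounded (f ` space conf) \<longrightarrow>
       (\<integral>\<gamma>. f \<gamma> \<partial>\<nu>) = (\<integral>\<gamma>. (\<integral>\<gamma>'. f (glue \<Lambda> \<gamma>' \<gamma>)
         * (boltzmann (H \<Lambda> (glue \<Lambda> \<gamma>' \<gamma>)) / enn2real (partition_fun H \<Lambda> \<pi> \<gamma>)) \<partial>\<pi>) \<partial>\<nu>)"
    by (rule gibbs_equation[OF L])
  have bd: "bounded ((indicator E :: 'a measure \<Rightarrow> real) ` space conf)"
    by (rule bounded_subset[of "{0, 1}"]) (auto simp: indicator_def)
  have z: "indicator E \<gamma> * boltzmann (H \<Lambda> \<gamma>) = (0 :: real)" for \<gamma>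
    by (simp add: E_def indicator_def boltzmann_def)
  have "(\<integral>\<gamma>. indicator E \<gamma> \<partial>\<nu>) = (0 :: real)"
    using eq[rule_format, OF conjI[OF _ bd]] by (simp add: z)
  then have "measure \<nu> E = 0" using E by (simp add: gibbs_space(2))
  then have "AE \<gamma> in \<nu>. \<gamma> \<notin> E" using \<nu>.prob_eq_0[of E] E by (simp add: gibbs_space(2))
  then show ?thesis using AE_space by eventually_elim (simp add: E_def gibbs_space(3))
qed

end

context
  fixes \<nu> :: "'a::euclidean_space measure measure"
  assumes prob: "prob_space \<nu>" and sets_\<nu>: "sets \<nu> = sets conf" and stat: "stationary \<nu>"
begin

lemma stationary_space: "space \<nu> = configurations"
  using sets_eq_imp_space_eq[OF sets_\<nu>] by simp

lemma stationary_measure_translate: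
  assumes "E \<in> sets conf"
  shows "{\<gamma> \<in> configurations. translate \<gamma> y \<in> E} \<in> sets \<nu>"
    "measure \<nu> {\<gamma> \<in> configurations. translate \<gamma> y \<in> E} = measure \<nu> E"
proof -
  have t: "(\<lambda>\<gamma>. translate \<gamma> y) \<in> measurable \<nu> conf"
    using measurable_translate by (simp cong: measurable_cong_sets add: sets_\<nu>)
  have s: "(\<lambda>\<gamma>. translate \<gamma> y) -` E \<inter> space \<nu> = {\<gamma> \<in> configurations. translate \<gamma> y \<in> E}"
    by (auto simp: stationary_space)
  show "{\<gamma> \<in> configurations. translate \<gamma> y \<in> E} \<in> sets \<nu>"
    using measurable_sets[OF t assms] by (simp only: s)
  have "measure \<nu> E = measure (distr \<nu> conf (\<lambda>\<gamma>. translate \<gamma> y)) E"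
    using stat by (simp add: stationary_def)
  also have "\<dots> = measure \<nu> ((\<lambda>\<gamma>. translate \<gamma> y) -` E \<inter> space \<nu>)"
    by (rule measure_distr[OF t assms])
  finally show "measure \<nu> {\<gamma> \<in> configurations. translate \<gamma> y \<in> E} = measure \<nu> E" by (simp only: s)
qed

lemma stationary_AE_translate:
  assumes "AE \<gamma> in \<nu>. \<gamma> \<in> E" "E \<in> sets conf"
  shows "AE \<gamma> in \<nu>. translate \<gamma> y \<in> E"
proof -
  interpret prob_space \<nu> by (rule prob)
  have "measure \<nu> E = 1" using assms by (subst prob_eq_1) (auto simp: sets_\<nu>)
  then have "measure \<nu> {\<gamma> \<in> configurations. translate \<gamma> y \<in> E} = 1"
    using stationary_measure_translate(2)[OF assms(2)] by simp
  then have "AE \<gamma> in \<nu>. \<gamma> \<in> {\<gamma> \<in> configurations. translate \<gamma> y \<in> E}"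
    by (rule AE_prob_1)
  then show ?thesis by eventually_elim simp
qed

text \<open>If the event had positive probability, then with positive probability infinitely many of its
  translates would occur.\<close>

lemma stationary_finitely_many_translates_null:
  fixes y :: "nat \<Rightarrow> 'a"
  assumes E: "E \<in> sets conf" and fin: "\<And>\<gamma>. \<gamma> \<in> configurations \<Longrightarrow> finite {n. translate \<gamma> (y n) \<in> E}"
  shows "AE \<gamma> in \<nu>. \<gamma> \<notin> E"
proof -
  interpret prob_space \<nu> by (rule prob)
  define A where "A n = {\<gamma> \<in> configurations. translate \<gamma> (y n) \<in> E}" for n
  have A: "A n \<in> sets \<nu>" "measure \<nu> (A n) = measure \<nu> E" for n
    using stationary_measure_translate[OF E] by (auto simp: A_def)
  define U where "U N = (\<Union>n\<in>{N..}. A n)" for N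
  have U: "U N \<in> sets \<nu>" for N unfolding U_def using A(1) by (intro sets.countable_UN') auto
  have dec: "decseq U" unfolding decseq_def U_def by (intro allI impI UN_mono) auto
  \<comment> \<open>The intersection is the limit superior of the translated events, which the
    finiteness hypothesis makes empty; yet every \<open>U N\<close> has at least the probability of
    \<open>E\<close>.\<close>
  have "(\<Inter>N. U N) = {}"
  proof (rule ccontr)
    assume "(\<Inter>N. U N) \<noteq> {}"
    then obtain \<gamma> where \<gamma>: "\<gamma> \<in> U N" for N by blast
    then have "\<gamma> \<in> configurations" by (auto simp: U_def A_def)
    then have "finite {n. translate \<gamma> (y n) \<in> E}" by (rule fin)
    then have "\<exists>N. \<forall>n\<in>{n. translate \<gamma> (y n) \<in> E}. n < N" by (simp only: finite_nat_set_iff_bounded)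
    then obtain N where "\<forall>n\<in>{n. translate \<gamma> (y n) \<in> E}. n < N" by (rule exE)
    then have N: "translate \<gamma> (y n) \<in> E \<Longrightarrow> n < N" for n by simp
    obtain n where "N \<le> n" "\<gamma> \<in> A n" using \<gamma>[of N] by (auto simp: U_def)
    then show False using N[of n] by (simp add: A_def)
  qed
  then have "(\<lambda>N. measure \<nu> (U N)) \<longlonglongrightarrow> 0"
    using finite_Lim_measure_decseq[OF _ dec] U by auto
  moreover have "measure \<nu> E \<le> measure \<nu> (U N)" for N
  proof -
    have "A N \<subseteq> U N" by (auto simp: U_def)
    then show ?thesis using finite_measure_mono[OF _ U] A(2) by metis
  qed
  ultimately have "measure \<nu> E \<le> 0" by (intro LIMSEQ_le_const) auto
  then have "measure \<nu> E = 0" by (simp add: measure_le_0_iff)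
  then show ?thesis using prob_eq_0[of E] E by (simp add: sets_\<nu>)
qed

end

section \<open>Quadrants as witnesses against half-planes\<close>

definition quadrant :: "real^2 \<Rightarrow> real \<Rightarrow> (real^2) set" where
  "quadrant \<sigma> m = {x. m < \<sigma> $ 1 * x $ 1 \<and> m < \<sigma> $ 2 * x $ 2}"

definition signs :: "(real^2) set" where
  "signs = {\<sigma>. \<bar>\<sigma> $ 1\<bar> = 1 \<and> \<bar>\<sigma> $ 2\<bar> = 1}"

lemma quadrant_borel [measurable]: "quadrant \<sigma> m \<in> sets borel"
proof -
  have "quadrant \<sigma> m = {x. m < \<sigma> $ 1 * x $ 1} \<inter> {x. m < \<sigma> $ 2 * x $ 2}" by (auto simp: quadrant_def)
  moreover have "open \<dots>" by (intro open_Int open_Collect_less continuous_intros)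
  ultimately show ?thesis by simp
qed

lemma signs_square: "\<sigma> \<in> signs \<Longrightarrow> \<sigma> $ 1 * \<sigma> $ 1 = 1 \<and> \<sigma> $ 2 * \<sigma> $ 2 = 1"
  by (auto simp: signs_def abs_if split: if_splits)

lemma finite_signs: "finite signs"
proof -
  have "signs \<subseteq> (\<lambda>(a, b). a *\<^sub>R axis 1 1 + b *\<^sub>R axis 2 1) ` ({1, -1} \<times> {1, -1})"
  proof
    fix \<sigma> assume s: "\<sigma> \<in> signs"
    have "\<sigma> = \<sigma> $ 1 *\<^sub>R axis 1 1 + \<sigma> $ 2 *\<^sub>R axis 2 1" by (simp add: vec2_eq_iff axis_def)
    moreover have "\<sigma> $ 1 \<in> {1, -1}" "\<sigma> $ 2 \<in> {1, -1}" using s by (auto simp: signs_def abs_if split: if_splits)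
    ultimately show "\<sigma> \<in> (\<lambda>(a, b). a *\<^sub>R axis 1 1 + b *\<^sub>R axis 2 1) ` ({1, -1} \<times> {1, -1})"
      by (intro image_eqI[of _ _ "(\<sigma> $ 1, \<sigma> $ 2)"]) auto
  qed
  then show ?thesis by (rule finite_subset) simp
qed

text \<open>The signs of \<open>v\<close> select a quadrant on which both coordinates contribute
  nonnegatively; a point beyond \<open>y\<close> in both coordinates then has positive inner
  product, since some coordinate of \<open>v\<close> is nonzero. A zero coordinate may receive
  either sign.\<close>

lemma surrounded_of_quadrants:
  assumes "\<And>\<sigma> n. \<sigma> \<in> signs \<Longrightarrow> P \<inter> quadrant \<sigma> (real n) \<noteq> {}"
  shows "surrounded P y"
  unfolding surrounded_def
proof (intro allI impI)
  fix v :: "real^2" assume v: "v \<noteq> 0"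
  define s where "s x = (if x < 0 then -1 else 1 :: real)" for x :: real
  define \<sigma> where "\<sigma> = s (v $ 1) *\<^sub>R axis 1 1 + s (v $ 2) *\<^sub>R (axis 2 1 :: real^2)"
  have \<sigma>: "\<sigma> $ 1 = s (v $ 1)" "\<sigma> $ 2 = s (v $ 2)" by (simp_all add: \<sigma>_def axis_def)
  have "\<sigma> \<in> signs" by (simp add: signs_def \<sigma> s_def)
  moreover obtain n :: nat where n: "\<bar>y $ 1\<bar> + \<bar>y $ 2\<bar> < real n" using reals_Archimedean2 by blast
  ultimately obtain p where p: "p \<in> P" "p \<in> quadrant \<sigma> (real n)" using assms by blast
  have "\<sigma> $ i * y $ i \<le> \<bar>y $ 1\<bar> + \<bar>y $ 2\<bar>" if "i = 1 \<or> i = 2" for i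
    using that by (auto simp: \<sigma> s_def)
  then have pos: "0 < \<sigma> $ 1 * (p - y) $ 1" "0 < \<sigma> $ 2 * (p - y) $ 2"
    using p(2) n by (fastforce simp: quadrant_def algebra_simps)+
  have a: "v $ 1 = \<bar>v $ 1\<bar> * \<sigma> $ 1" "v $ 2 = \<bar>v $ 2\<bar> * \<sigma> $ 2" by (simp_all add: \<sigma> s_def)
  have "(p - y) \<bullet> v = \<bar>v $ 1\<bar> * (\<sigma> $ 1 * (p - y) $ 1) + \<bar>v $ 2\<bar> * (\<sigma> $ 2 * (p - y) $ 2)"
    unfolding inner_real2 by (subst a(1), subst a(2)) (simp add: algebra_simps)
  moreover have "v $ 1 \<noteq> 0 \<or> v $ 2 \<noteq> 0" using v by (auto simp: vec2_eq_iff)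
  ultimately have "0 < (p - y) \<bullet> v" using pos by (auto intro: add_pos_nonneg add_nonneg_pos)
  then show "\<exists>p\<in>P. 0 < (p - y) \<bullet> v" using p(1) by blast
qed

lemma missing_quadrant_event:
  "{\<gamma> \<in> configurations. emeasure \<gamma> (quadrant \<sigma> m) = 0} \<in> sets conf"
proof -
  have "{\<gamma> \<in> space conf. emeasure \<gamma> (quadrant \<sigma> m) = 0} \<in> sets conf" by measurable
  then show ?thesis by simp
qed

text \<open>The quadrant has its apex at \<open>m *\<^sub>R \<sigma>\<close>, so translations along
  \<open>\<sigma>\<close> turn the missing-quadrant events for different \<open>m\<close> into each
  other.\<close>

lemma missing_quadrant_translate:
  assumes "\<sigma> \<in> signs"
  shows "{\<gamma> \<in> configurations. translate \<gamma> (k *\<^sub>R \<sigma>) \<in> {\<gamma> \<in> configurations. emeasure \<gamma> (quadrant \<sigma> m) = 0}}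
    = {\<gamma> \<in> configurations. emeasure \<gamma> (quadrant \<sigma> (m - k)) = 0}"
proof -
  have s: "\<sigma> $ 1 * \<sigma> $ 1 = 1" "\<sigma> $ 2 * \<sigma> $ 2 = 1" using signs_square[OF assms] by auto
  have "x + k *\<^sub>R \<sigma> \<in> quadrant \<sigma> m \<longleftrightarrow> x \<in> quadrant \<sigma> (m - k)" for x
  proof -
    have "\<sigma> $ 1 * (x $ 1 + k * \<sigma> $ 1) = \<sigma> $ 1 * x $ 1 + k" "\<sigma> $ 2 * (x $ 2 + k * \<sigma> $ 2) = \<sigma> $ 2 * x $ 2 + k"
      using s by (simp_all add: distrib_left mult.left_commute)
    then show ?thesis by (auto simp: quadrant_def)
  qed
  then have "points (translate \<gamma> (k *\<^sub>R \<sigma>)) \<inter> quadrant \<sigma> m = {} \<longleftrightarrow> points \<gamma> \<inter> quadrant \<sigma> (m - k) = {}"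
    if "\<gamma> \<in> configurations" for \<gamma>
    using points_translate[OF that] by auto
  then show ?thesis
    using translate_configuration emeasure_configuration_eq_0_iff[OF translate_configuration quadrant_borel]
      emeasure_configuration_eq_0_iff[OF _ quadrant_borel] by (intro Collect_cong) auto
qed

section \<open>Almost sure geometry of stationary Gibbs configurations, and empty discs\<close>

context
  fixes \<nu> :: "(real^2) measure measure" and r \<alpha> \<theta> :: real
  assumes gibbs: "gibbs_measure (delaunay_energy r \<alpha> \<theta>) \<nu>" and stat: "stationary \<nu>"
    and r: "0 < r" and \<alpha>: "r < \<alpha>"
begin

interpretation prob_space \<nu> by (rule gibbs_space(1)[OF gibbs])

lemmas sets_\<nu> = gibbs_space(2)[OF gibbs]
lemmas space_\<nu> = gibbs_space(3)[OF gibbs]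

text \<open>Countably many balls suffice: every Delaunay disc meets a ball of integer radius around
  the origin that contains its centre. \<open>Suc\<close> keeps the radius positive, as
  measurability requires.\<close>

lemma AE_finite_energy: "AE \<gamma> in \<nu>. \<gamma> \<in> finite_energy (delaunay_energy r \<alpha> \<theta>)"
proof -
  have "AE \<gamma> in \<nu>. delaunay_energy r \<alpha> \<theta> (ball 0 (real (Suc n))) \<gamma> \<noteq> \<infinity>" for n
    by (rule gibbs_AE_finite[OF gibbs]) (simp_all add: measurable_delaunay_energy)
  then have "AE \<gamma> in \<nu>. \<forall>n. delaunay_energy r \<alpha> \<theta> (ball 0 (real (Suc n))) \<gamma> \<noteq> \<infinity>"
    by (simp add: AE_all_countable)
  then show ?thesis using AE_space
  proof eventually_elim
    case (elim \<gamma>)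
    have "tame r \<alpha> T" if T: "T \<in> del (points \<gamma>)" for T
    proof -
      obtain n where n: "norm (circumcenter T) < real n" using reals_Archimedean2 by blast
      then have "circumcenter T \<in> circumball T \<inter> ball 0 (real (Suc n))"
        using delD(5)[OF T] by (simp add: circumball_def)
      then have "T \<in> hit (points \<gamma>) (ball 0 (real (Suc n)))" using T by (auto simp: hit_def)
      then show ?thesis using elim(1) unfolding delaunay_energy_infinite_iff by blast
    qed
    then show ?case using elim(2) by (simp add: finite_energy_iff space_\<nu>)
  qed
qed

lemma prob_missing_quadrant_const:
  assumes "\<sigma> \<in> signs"
  shows "prob {\<gamma> \<in> configurations. emeasure \<gamma> (quadrant \<sigma> m) = 0} = prob {\<gamma> \<in> configurations. emeasure \<gamma> (quadrant \<sigma> 0) = 0}"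
  using stationary_measure_translate(2)[OF prob_space_axioms sets_\<nu> stat missing_quadrant_event, of "m *\<^sub>R \<sigma>" \<sigma> m]
  unfolding missing_quadrant_translate[OF assms] by simp

text \<open>The event of missing the quadrant with apex parameter -2 is contained in that for 1, and
  both have the same probability, so their difference is null. From the empty configuration it is
  entered by a single Poisson point in the unit ball, whose coordinates lie between -1 and 1; no
  triangle arises, so the energy is finite.\<close>

lemma AE_nonempty: "AE \<gamma> in \<nu>. points \<gamma> \<noteq> {}"
proof -
  define \<sigma> :: "real^2" where "\<sigma> = axis 1 1 + axis 2 1"
  have \<sigma>: "\<sigma> $ 1 = 1" "\<sigma> $ 2 = 1" by (simp_all add: \<sigma>_def axis_def)
  have \<sigma>s: "\<sigma> \<in> signs" by (simp add: signs_def \<sigma>)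
  define A where "A m = {\<gamma> \<in> configurations. emeasure \<gamma> (quadrant \<sigma> m) = 0}" for m
  have A [measurable]: "A m \<in> sets conf" for m unfolding A_def by (rule missing_quadrant_event)
  have sub: "quadrant \<sigma> 1 \<subseteq> quadrant \<sigma> (-2)" by (auto simp: quadrant_def)
  have "A (-2) \<subseteq> A 1"
    using sub by (auto simp: A_def emeasure_configuration_eq_0_iff disjoint_iff subset_iff)
  then have "prob (A 1 - A (-2)) = 0"
    using prob_missing_quadrant_const[OF \<sigma>s, of 1] prob_missing_quadrant_const[OF \<sigma>s, of "-2"] A
    by (subst finite_measure_Diff) (simp_all add: sets_\<nu> A_def)
  moreover have "A 1 - A (-2) \<in> sets conf" using A by blast
  moreover have "delaunay_energy r \<alpha> \<theta> (ball 0 1) \<in> borel_measurable conf"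
    by (rule measurable_delaunay_energy) simp
  ultimately have "\<exists>\<pi>. poisson_process (ball (0::real^2) 1) \<pi> \<and> (AE \<gamma> in \<nu>. AE \<gamma>' in \<pi>. glue (ball 0 1) \<gamma>' \<gamma> \<in> A 1 - A (-2) \<longrightarrow>
       delaunay_energy r \<alpha> \<theta> (ball 0 1) (glue (ball 0 1) \<gamma>' \<gamma>) = \<infinity>)"
    by (intro gibbs_null_event[OF gibbs ball_bounded_borel])
  then
  obtain \<pi> where \<pi>: "poisson_process (ball (0::real^2) 1) \<pi>"
    and ae: "AE \<gamma> in \<nu>. AE \<gamma>' in \<pi>. glue (ball 0 1) \<gamma>' \<gamma> \<in> A 1 - A (-2) \<longrightarrow>
       delaunay_energy r \<alpha> \<theta> (ball 0 1) (glue (ball 0 1) \<gamma>' \<gamma>) = \<infinity>" by blast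
  interpret \<pi>: prob_space \<pi> by (rule poisson_process_space(1)[OF \<pi>])
  have "0 < measure \<pi> {\<gamma>' \<in> space \<pi>. \<forall>i\<in>{0::nat}. emeasure \<gamma>' ((\<lambda>_. ball 0 1) i) = of_nat ((\<lambda>_. 1) i)}"
    by (rule poisson_process_counts_positive[OF \<pi>]) (simp_all add: disjoint_family_on_def content_ball_pos)
  then have pos: "0 < measure \<pi> {\<gamma>' \<in> space \<pi>. emeasure \<gamma>' (ball 0 1) = of_nat 1}" by simp
  show ?thesis using ae AE_space
  proof eventually_elim
    case (elim \<gamma>)
    show ?case
    proof
      assume empty: "points \<gamma> = {}"
      obtain \<gamma>' where \<gamma>': "\<gamma>' \<in> {\<gamma>' \<in> space \<pi>. emeasure \<gamma>' (ball 0 1) = of_nat 1}"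
        and imp: "glue (ball 0 1) \<gamma>' \<gamma> \<in> A 1 - A (-2) \<longrightarrow> delaunay_energy r \<alpha> \<theta> (ball 0 1) (glue (ball 0 1) \<gamma>' \<gamma>) = \<infinity>"
        using \<pi>.AE_positive_obtain[OF elim(1) pos] by blast
      have c: "\<gamma> \<in> configurations" "\<gamma>' \<in> configurations" "ball (0::real^2) 1 \<in> sets borel"
        using elim(2) \<gamma>' poisson_process_space(3)[OF \<pi>] by (simp_all add: space_\<nu>)
      have "card (points \<gamma>' \<inter> ball 0 1) = 1"
        using \<gamma>' emeasure_configuration_card[OF c(2) ball_bounded_borel, of 0 1] by simp
      then obtain w where w: "points \<gamma>' \<inter> ball 0 1 = {w}" by (auto simp: card_1_singleton_iff)
      define \<eta> where "\<eta> = glue (ball 0 1) \<gamma>' \<gamma>"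
      have \<eta>: "\<eta> \<in> configurations" "points \<eta> = {w}"
        using glue_configuration[OF c] points_glue[OF c] w empty by (simp_all add: \<eta>_def)
      have "w \<in> ball 0 1" using w by blast
      then have "norm w < 1" by simp
      then have "\<bar>w $ 1\<bar> < 1" "\<bar>w $ 2\<bar> < 1" by (meson component_le_norm_cart le_less_trans)+
      then have "w \<notin> quadrant \<sigma> 1" "w \<in> quadrant \<sigma> (-2)" by (auto simp: quadrant_def \<sigma>)
      then have "\<eta> \<in> A 1 - A (-2)"
        using \<eta> by (simp add: A_def emeasure_configuration_eq_0_iff)
      then have "delaunay_energy r \<alpha> \<theta> (ball 0 1) \<eta> = \<infinity>" using imp by (simp add: \<eta>_def)
      moreover have "hit {w} (ball 0 1) = {}"
      proof -
        have "T \<notin> del {w}" for T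
        proof
          assume T: "T \<in> del {w}"
          have "card T \<le> card {w}" using delD(1)[OF T] by (intro card_mono) auto
          then show False using delD(2)[OF T] by simp
        qed
        then show ?thesis by (auto simp: hit_def)
      qed
      ultimately show False unfolding delaunay_energy_infinite_iff \<eta>(2) by simp
    qed
  qed
qed

text \<open>The probability of missing a quadrant does not depend on the apex. As the apex recedes,
  the quadrants exhaust the plane and the events decrease to the empty configuration, which is
  null.\<close>

lemma AE_surrounded: "AE \<gamma> in \<nu>. \<forall>y. surrounded (points \<gamma>) y"
proof -
  have null: "AE \<gamma> in \<nu>. points \<gamma> \<inter> quadrant \<sigma> (real n) \<noteq> {}" if \<sigma>: "\<sigma> \<in> signs" for \<sigma> n
  proof -
    define A where "A m = {\<gamma> \<in> configurations. emeasure \<gamma> (quadrant \<sigma> m) = 0}" for m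
    have A: "A m \<in> sets \<nu>" for m unfolding A_def sets_\<nu> by (rule missing_quadrant_event)
    have mono: "A m \<subseteq> A m'" if "m \<le> m'" for m m'
    proof -
      have "quadrant \<sigma> m' \<subseteq> quadrant \<sigma> m" using that by (auto simp: quadrant_def)
      then show ?thesis by (auto simp: A_def emeasure_configuration_eq_0_iff disjoint_iff subset_iff)
    qed
    have c: "prob (A m) = prob (A 0)" for m unfolding A_def by (rule prob_missing_quadrant_const[OF \<sigma>])
    have "(\<lambda>i. prob (A (- real i))) \<longlonglongrightarrow> prob (\<Inter>i. A (- real i))"
      by (rule finite_Lim_measure_decseq) (use A mono in \<open>auto simp: decseq_def\<close>)
    moreover have "prob (\<Inter>i. A (- real i)) = 0"
    proof -
      have "AE \<gamma> in \<nu>. \<gamma> \<notin> (\<Inter>i. A (- real i))" using AE_nonempty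
      proof eventually_elim
        case (elim \<gamma>)
        then obtain p where p: "p \<in> points \<gamma>" by blast
        obtain i where i: "\<bar>p $ 1\<bar> + \<bar>p $ 2\<bar> < real i" using reals_Archimedean2 by blast
        have "\<bar>\<sigma> $ 1 * p $ 1\<bar> = \<bar>p $ 1\<bar>" "\<bar>\<sigma> $ 2 * p $ 2\<bar> = \<bar>p $ 2\<bar>"
          using \<sigma> by (simp_all add: signs_def abs_mult)
        then have "p \<in> quadrant \<sigma> (- real i)" using i by (simp add: quadrant_def abs_less_iff) linarith
        then have "\<gamma> \<notin> A (- real i)" using p by (auto simp: A_def emeasure_configuration_eq_0_iff)
        then show ?case by blast
      qed
      moreover have "(\<Inter>i. A (- real i)) \<in> sets \<nu>" using A by auto
      ultimately show ?thesis using prob_eq_0 by blast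
    qed
    moreover have "(\<lambda>i. prob (A (- real i))) = (\<lambda>i. prob (A 0))" by (intro ext c)
    ultimately have "prob (A 0) = 0" by (simp add: LIMSEQ_const_iff)
    then have "prob (A (real n)) = 0" using c by simp
    then have "AE \<gamma> in \<nu>. \<gamma> \<notin> A (real n)" using prob_eq_0[OF A] by blast
    then show ?thesis using AE_space
      by eventually_elim (auto simp: A_def space_\<nu> emeasure_configuration_eq_0_iff)
  qed
  have "AE \<gamma> in \<nu>. \<forall>\<sigma>\<in>signs. \<forall>n. points \<gamma> \<inter> quadrant \<sigma> (real n) \<noteq> {}"
    using null finite_signs by (simp add: AE_finite_all AE_all_countable)
  then show ?thesis by eventually_elim (auto intro: surrounded_of_quadrants)
qed

text \<open>If the event were null, almost every resampling that leaves the disc empty would have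
  infinite energy. Around the modified configuration \<open>Q\<close>, however, such resamplings of
  finite energy have positive Poisson probability.\<close>

lemma empty_disc_positive:
  assumes \<rho>: "\<rho> < \<alpha>"
  shows "0 < prob {\<gamma> \<in> configurations. emeasure \<gamma> (ball 0 \<rho>) = 0}"
proof (rule ccontr)
  define E where "E = {\<gamma> \<in> configurations. emeasure \<gamma> (ball (0::real^2) \<rho>) = 0}"
  have "{\<gamma> \<in> space conf. emeasure \<gamma> (ball (0::real^2) \<rho>) = 0} \<in> sets conf" by measurable
  then have E: "E \<in> sets conf" by (simp add: E_def)
  assume "\<not> ?thesis"
  then have null: "prob E = 0" by (simp add: E_def not_less measure_le_0_iff)
  \<comment> \<open>The midpoint lies strictly between \<open>max r \<rho>\<close> and
    \<open>\<alpha>\<close>: above \<open>r\<close> for separation, above \<open>\<rho>\<close> for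
    the empty disc, below \<open>\<alpha>\<close> for covering.\<close>
  define s where "s = (max r \<rho> + \<alpha>) / 2"
  have s: "0 < s" "r < s" "s < \<alpha>" "\<rho> < s" using r \<alpha> \<rho> by (auto simp: s_def)
  define M where "M = 2 * s + \<alpha> + 1"
  have M: "0 < M" "s \<le> M" using s by (auto simp: M_def)
  define \<Lambda> where "\<Lambda> = ball (0::real^2) M"
  have "delaunay_energy r \<alpha> \<theta> \<Lambda> \<in> borel_measurable conf"
    unfolding \<Lambda>_def by (rule measurable_delaunay_energy[OF M(1)])
  from gibbs_null_event[OF gibbs _ this E null]
  obtain \<pi> where \<pi>: "poisson_process \<Lambda> \<pi>"
    and ae: "AE \<gamma> in \<nu>. AE \<gamma>' in \<pi>. glue \<Lambda> \<gamma>' \<gamma> \<in> E \<longrightarrow> delaunay_energy r \<alpha> \<theta> \<Lambda> (glue \<Lambda> \<gamma>' \<gamma>) = \<infinity>"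
    by (auto simp: \<Lambda>_def)
  interpret \<pi>: prob_space \<pi> by (rule poisson_process_space(1)[OF \<pi>])
  have "AE \<gamma> in \<nu>. False" using ae AE_finite_energy AE_surrounded
  proof eventually_elim
    case (elim \<gamma>)
    have c\<gamma>: "\<gamma> \<in> configurations" using elim(2) by (simp add: finite_energy_iff)
    have sur: "surrounded (points \<gamma>) y" for y using elim(3) by blast
    have "0 < \<alpha>" using r \<alpha> by linarith
    note good = finite_energy_surrounded[OF elim(2) sur this]
    obtain Q where Q: "locally_finite Q" "separated r Q" "covering \<alpha> Q" "\<And>q. q \<in> Q \<Longrightarrow> s \<le> norm q"
      "Q - ball 0 M = points \<gamma> - ball 0 M"
      using exists_empty_disc_modification[OF good(1,3,2) s(1,2,3) M_def] by metis
    obtain \<epsilon> where \<epsilon>: "\<epsilon> > 0" "\<And>p. p \<in> Q \<inter> ball 0 M \<Longrightarrow> ball p \<epsilon> \<subseteq> ball 0 M"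
      "\<And>p q. p \<in> Q \<inter> ball 0 M \<Longrightarrow> q \<in> Q \<inter> ball 0 M \<Longrightarrow> p \<noteq> q \<Longrightarrow> ball p \<epsilon> \<inter> ball q \<epsilon> = {}"
      and stable: "\<And>Q'. Q' - ball 0 M = Q - ball 0 M \<Longrightarrow> (\<And>p. p \<in> Q \<inter> ball 0 M \<Longrightarrow> \<exists>w. Q' \<inter> ball p \<epsilon> = {w})
        \<Longrightarrow> Q' \<inter> ball 0 M \<subseteq> (\<Union>p\<in>Q \<inter> ball 0 M. ball p \<epsilon>)
        \<Longrightarrow> separated r Q' \<and> covering \<alpha> Q' \<and> (\<forall>q\<in>Q'. \<rho> \<le> norm q)"
      proof (rule perturbation_stable[OF Q(1-3) _ s(4) M(2) r], goal_cases)
      case (1 q)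
      show ?case by (rule Q(4)[OF 1(2)])
    next
      case (2 \<epsilon>)
      show ?case by (rule that[OF 2(2-5)])
    qed
    define F where "F = Q \<inter> ball 0 M"
    have finF: "finite F" using Q(1) by (simp add: F_def locally_finite_def)
    obtain e where e: "bij_betw e {..<card F} F"
      using ex_bij_betw_nat_finite[OF finF] by (auto simp: atLeast0LessThan)
    \<comment> \<open>The cells with prescribed counts: one small ball per point of
      \<open>F\<close>, to contain exactly one point, and, at the index \<open>card F\<close>, the
      rest of \<open>\<Lambda>\<close>, to contain none.\<close>
    define B where "B i = (if i < card F then ball (e i) \<epsilon> else \<Lambda> - (\<Union>p\<in>F. ball p \<epsilon>))" for i
    have eF: "e i \<in> F" if "i < card F" for i using e that by (auto simp: bij_betw_def)
    have dis: "disjoint_family_on B {..card F}"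
      unfolding disjoint_family_on_def
    proof (intro ballI impI)
      fix i j assume ij: "i \<in> {..card F}" "j \<in> {..card F}" "i \<noteq> j"
      consider "i < card F" "j < card F" | "i < card F" "\<not> j < card F" | "\<not> i < card F" "j < card F"
        using ij by fastforce
      then show "B i \<inter> B j = {}"
      proof cases
        case 1
        then have "e i \<noteq> e j" using e ij(3) by (auto simp: bij_betw_def inj_on_def)
        then show ?thesis using \<epsilon>(3)[of "e i" "e j"] eF 1 by (simp add: B_def F_def)
      next
        case 2
        then show ?thesis using eF[OF 2(1)] by (auto simp: B_def)
      next
        case 3
        then show ?thesis using eF[OF 3(2)] by (auto simp: B_def)
      qed
    qed
    have Bb: "B i \<in> bounded_borel" for i
    proof -
      have "\<Lambda> - (\<Union>p\<in>F. ball p \<epsilon>) \<in> bounded_borel"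
        unfolding bounded_borel_def \<Lambda>_def mem_Collect_eq
        by (intro conjI sets.Diff borel_open open_UN ballI open_ball bounded_subset[OF bounded_ball Diff_subset])
      then show ?thesis by (simp add: B_def)
    qed
    \<comment> \<open>Positive volume is checked for the small balls only; the remaining cell has
      prescribed count 0.\<close>
    have vol: "(if i < card F then 1 else 0 :: nat) = 0 \<or> 0 < measure lborel (B i \<inter> \<Lambda>)" for i
    proof (cases "i < card F")
      case True
      have "ball (e i) \<epsilon> \<inter> \<Lambda> = ball (e i) \<epsilon>"
        using \<epsilon>(2)[of "e i"] eF[OF True] unfolding F_def \<Lambda>_def by blast
      then show ?thesis using True \<epsilon>(1) by (simp add: B_def content_ball_pos)
    qed simp
    have pos: "0 < measure \<pi> {\<gamma> \<in> space \<pi>. \<forall>i\<in>{..card F}. emeasure \<gamma> (B i) = of_nat (if i < card F then 1 else 0)}"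
      by (rule poisson_process_counts_positive[OF \<pi> _ dis Bb vol]) simp
    obtain \<gamma>' where \<gamma>': "\<gamma>' \<in> {\<gamma> \<in> space \<pi>. \<forall>i\<in>{..card F}. emeasure \<gamma> (B i) = of_nat (if i < card F then 1 else 0)}"
      and imp: "glue \<Lambda> \<gamma>' \<gamma> \<in> E \<longrightarrow> delaunay_energy r \<alpha> \<theta> \<Lambda> (glue \<Lambda> \<gamma>' \<gamma>) = \<infinity>"
      using \<pi>.AE_positive_obtain[OF elim(1) pos] by blast
    have c\<gamma>': "\<gamma>' \<in> configurations" using \<gamma>' poisson_process_space(3)[OF \<pi>] by simp
    have \<Lambda>b: "\<Lambda> \<in> sets borel" by (simp add: \<Lambda>_def)
    define Q' where "Q' = points (glue \<Lambda> \<gamma>' \<gamma>)"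
    have Q': "Q' = (points \<gamma>' \<inter> ball 0 M) \<union> (points \<gamma> - ball 0 M)"
      using points_glue[OF c\<gamma> c\<gamma>' \<Lambda>b] by (simp add: Q'_def \<Lambda>_def)
    have "separated r Q' \<and> covering \<alpha> Q' \<and> (\<forall>q\<in>Q'. \<rho> \<le> norm q)"
    proof (rule stable)
      show "Q' - ball 0 M = Q - ball 0 M" unfolding Q(5) Q' by blast
      show "\<exists>w. Q' \<inter> ball p \<epsilon> = {w}" if p: "p \<in> Q \<inter> ball 0 M" for p
      proof -
        have "p \<in> F" using p by (simp add: F_def)
        then obtain i where i: "i < card F" "p = e i" using e by (auto simp: bij_betw_def)
        have "emeasure \<gamma>' (B i) = of_nat (if i < card F then 1 else 0)" using \<gamma>' i(1) by simp
        then have "emeasure \<gamma>' (ball p \<epsilon>) = of_nat 1" using i by (simp add: B_def)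
        then have "card (points \<gamma>' \<inter> ball p \<epsilon>) = 1"
          using emeasure_configuration_card[OF c\<gamma>' ball_bounded_borel, of p \<epsilon>] by simp
        moreover have "Q' \<inter> ball p \<epsilon> = points \<gamma>' \<inter> ball p \<epsilon>" using \<epsilon>(2)[OF p] unfolding Q' by blast
        ultimately show ?thesis by (simp add: card_1_singleton_iff)
      qed
      have "emeasure \<gamma>' (B (card F)) = 0" using \<gamma>' by simp
      then have "points \<gamma>' \<inter> B (card F) = {}"
        using emeasure_configuration_eq_0_iff[OF c\<gamma>'] Bb[of "card F"] by (simp add: bounded_borel_def)
      then show "Q' \<inter> ball 0 M \<subseteq> (\<Union>p\<in>Q \<inter> ball 0 M. ball p \<epsilon>)"
        unfolding Q' B_def \<Lambda>_def F_def by auto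
    qed
    then have sQ: "separated r Q'" "covering \<alpha> Q'" "\<And>q. q \<in> Q' \<Longrightarrow> \<rho> \<le> norm q" by blast+
    have gc: "glue \<Lambda> \<gamma>' \<gamma> \<in> configurations" by (rule glue_configuration[OF c\<gamma> c\<gamma>' \<Lambda>b])
    have "Q' \<inter> ball 0 \<rho> = {}" using sQ(3) by fastforce
    then have "glue \<Lambda> \<gamma>' \<gamma> \<in> E"
      using gc emeasure_configuration_eq_0_iff[OF gc, of "ball 0 \<rho>"] by (simp add: E_def Q'_def)
    then have "delaunay_energy r \<alpha> \<theta> \<Lambda> (glue \<Lambda> \<gamma>' \<gamma>) = \<infinity>" using imp by blast
    \<comment> \<open>Covering bounds the radii and separation the sides, so the resampled
      configuration has finite energy in spite of its empty disc.\<close>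
    moreover have "tame r \<alpha> T" if T: "T \<in> hit Q' \<Lambda>" for T
    proof -
      have d: "T \<in> del Q'" using T by (rule hit_del)
      have "circumradius T < \<alpha>" by (rule circumradius_less_of_covering[OF sQ(2) d order_refl])
      moreover have "\<not> min_side T \<le> r"
        unfolding min_side_le_iff[OF delD(2)[OF d]]
        using sQ(1) delD(1)[OF d] unfolding separated_def by (meson not_le subsetD)
      ultimately show ?thesis by (simp add: tame_def)
    qed
    ultimately show ?case unfolding delaunay_energy_infinite_iff Q'_def by blast
  qed
  then show False by simp
qed

end


section \<open>Local energies at the origin\<close>

text \<open>The triangle inequality, which is an equality only for parallel vectors; so the distance
  to \<open>p\<close> is strictly convex along segments whose line misses \<open>p\<close>.\<close>

lemma dist_convex_combination:
  fixes x1 x3 p :: "real^2"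
  assumes l: "0 < l" "l < 1" and x2: "x2 = (1 - l) *\<^sub>R x1 + l *\<^sub>R x3"
  shows "dist x2 p \<le> (1 - l) * dist x1 p + l * dist x3 p"
    and "\<not> collinear {p, x1, x3} \<Longrightarrow> dist x2 p < (1 - l) * dist x1 p + l * dist x3 p"
proof -
  define u where "u = (1 - l) *\<^sub>R (x1 - p)"
  define v where "v = l *\<^sub>R (x3 - p)"
  have uv: "x2 - p = u + v" by (simp add: x2 u_def v_def algebra_simps)
  have n: "norm u = (1 - l) * dist x1 p" "norm v = l * dist x3 p"
    using l by (simp_all add: u_def v_def dist_norm)
  show le: "dist x2 p \<le> (1 - l) * dist x1 p + l * dist x3 p"
    using norm_triangle_ineq[of u v] by (simp add: dist_norm[of x2] uv n)
  show "dist x2 p < (1 - l) * dist x1 p + l * dist x3 p" if nc: "\<not> collinear {p, x1, x3}"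
  proof (rule ccontr)
    assume "\<not> ?thesis"
    then have "norm (u + v) = norm u + norm v" using le by (simp add: dist_norm[of x2] uv n)
    then have eq: "norm u *\<^sub>R v = norm v *\<^sub>R u" by (simp add: norm_triangle_eq)
    have "rot u \<bullet> (norm u *\<^sub>R v) = 0" unfolding eq by simp
    then have z: "norm u * (rot u \<bullet> v) = 0" by simp
    have "rot u \<bullet> v = (1 - l) * l * (rot (x1 - p) \<bullet> (x3 - p))"
      by (simp add: u_def v_def inner_real2 algebra_simps)
    then have "u \<noteq> 0 \<Longrightarrow> rot (x1 - p) \<bullet> (x3 - p) = 0" using z l by simp
    moreover have "u = 0 \<Longrightarrow> rot (x1 - p) \<bullet> (x3 - p) = 0" using l by (simp add: u_def inner_real2)
    ultimately show False using nc by (auto simp: collinear_3_rot)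
  qed
qed

lemma collinear_of_common_line:
  fixes x1 x3 p q :: "real^2"
  assumes "x1 \<noteq> x3" "collinear {p, x1, x3}" "collinear {q, x1, x3}"
  shows "collinear {x1, p, q}"
proof -
  have ne: "x3 - x1 \<noteq> 0" using assms(1) by simp
  have "{p, x1, x3} = {x1, x3, p}" "{q, x1, x3} = {x1, x3, q}" by auto
  then have "rot (x3 - x1) \<bullet> (p - x1) = 0" "rot (x3 - x1) \<bullet> (q - x1) = 0"
    using assms(2,3) by (simp_all add: collinear_3_rot)
  then obtain k k' where "p - x1 = k *\<^sub>R (x3 - x1)" "q - x1 = k' *\<^sub>R (x3 - x1)"
    using orthogonal_rot_imp_parallel[OF _ ne] by metis
  then show ?thesis unfolding collinear_3_rot by (simp add: inner_real2)
qed

text \<open>The opposite edge has constant length. Its two endpoints are not both on the line of the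
  moving vertex, as the triangle at \<open>x1\<close> is non-degenerate, so at least one of the two
  varying sides is strictly convex.\<close>

lemma perimeter_strictly_convex:
  fixes x1 x2 x3 :: "real^2"
  assumes l: "0 < l" "l < 1" and x2: "x2 = (1 - l) *\<^sub>R x1 + l *\<^sub>R x3" and ne: "x1 \<noteq> x3"
    and e: "x1 \<notin> e" "x2 \<notin> e" "x3 \<notin> e" "card (insert x1 e) = 3" "\<not> collinear (insert x1 e)"
  shows "perimeter (insert x2 e) < (1 - l) * perimeter (insert x1 e) + l * perimeter (insert x3 e)"
proof -
  have "finite e" using e(4) by (metis card.infinite finite_insert zero_neq_numeral)
  then have "card e = 2" using e(1,4) by simp
  then obtain p q where pq: "e = {p, q}" "p \<noteq> q" by (auto simp: card_2_iff)
  have per: "perimeter (insert x e) = dist x p + dist p q + dist x q" if "x \<notin> e" for x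
    using that pq perimeter_3[of x p q] by (simp add: dist_commute)
  have "\<not> collinear {p, x1, x3} \<or> \<not> collinear {q, x1, x3}"
    using collinear_of_common_line[OF ne] e(5) pq(1) by blast
  then have "dist x2 p + dist x2 q < ((1 - l) * dist x1 p + l * dist x3 p) + ((1 - l) * dist x1 q + l * dist x3 q)"
    using dist_convex_combination[OF l x2, of p] dist_convex_combination[OF l x2, of q] by argo
  then show ?thesis unfolding per[OF e(1)] per[OF e(2)] per[OF e(3)] by (simp add: algebra_simps)
qed

lemma infinite_reals_three:
  fixes S :: "real set"
  assumes "infinite S"
  obtains a b c where "a \<in> S" "b \<in> S" "c \<in> S" "a < b" "b < c"
proof -
  obtain U where U: "U \<subseteq> S" "finite U" "card U = 3" using infinite_arbitrarily_large[OF assms] by metis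
  have ne: "U \<noteq> {}" using U(3) by auto
  have "card {Min U, Max U} \<le> 2" by (simp add: card_insert_if)
  then have "\<not> U \<subseteq> {Min U, Max U}" using U(3) card_mono[of "{Min U, Max U}" U] by auto
  then obtain b where b: "b \<in> U" "b \<noteq> Min U" "b \<noteq> Max U" by blast
  have "Min U \<le> b" "b \<le> Max U" using b(1) U(2) by auto
  then have "Min U < b" "b < Max U" using b by auto
  moreover have "Min U \<in> S" "Max U \<in> S" "b \<in> S" using U ne b(1) by (auto intro: Min_in Max_in subsetD)
  ultimately show ?thesis using that by blast
qed

text \<open>Infinitely many points of a segment produce the same edges and the same cavity. On these points
  the change of perimeter is a strictly convex function, which has at most two zeros.\<close>

lemma perimeter_change_not_identically_zero:
  fixes P :: "(real^2) set" and t :: "nat \<Rightarrow> real"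
  assumes lf: "locally_finite P" and cov: "covering \<alpha> P" and v: "v \<noteq> 0" and inj: "inj t"
    and bd: "\<And>n. norm (t n *\<^sub>R v) \<le> 1" and nP: "\<And>n. t n *\<^sub>R v \<notin> P"
    and nc: "\<And>n. \<not> collinear (insert (t n *\<^sub>R v) P)"
  shows "\<exists>n. perimeter_change P (t n *\<^sub>R v) \<noteq> 0"
proof (rule ccontr)
  assume "\<not> ?thesis"
  then have zero: "perimeter_change P (t n *\<^sub>R v) = 0" for n by blast
  define x where "x n = t n *\<^sub>R v" for n
  \<comment> \<open>Vertices of the triangles involved are within \<open>2 \<alpha>\<close> of
    \<open>x n\<close>, and \<open>x n\<close> has norm at most 1; so a finite set independent of
    \<open>n\<close> contains them all, and only finitely many combinatorial types are
    possible.\<close>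
  define F where "F = P \<inter> cball 0 (1 + (\<alpha> + \<alpha>))"
  have finF: "finite F" using lf by (simp add: F_def locally_finite_def)
  have near: "T - {x n} \<subseteq> F" if "T \<in> del Q" "P \<subseteq> Q" "Q \<subseteq> insert (x n) P" "dist (x n) (circumcenter T) \<le> circumradius T" for T Q n
  proof -
    have R: "circumradius T < \<alpha>" by (rule circumradius_less_of_covering[OF cov that(1,2)])
    then have "dist (x n) (circumcenter T) \<le> \<alpha>" using that(4) by simp
    from del_subset_cball[OF that(1) R this] have sub: "T \<subseteq> Q \<inter> cball (x n) (\<alpha> + \<alpha>)" .
    show ?thesis
    proof
      fix p assume p: "p \<in> T - {x n}"
      have "norm p \<le> dist (x n) p + norm (x n)" by (metis dist_commute dist_norm norm_triangle_sub add.commute)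
      moreover have "dist (x n) p \<le> \<alpha> + \<alpha>" using sub p by auto
      moreover have "norm (x n) \<le> 1" using bd by (simp add: x_def)
      ultimately show "p \<in> F" using sub p that(3) by (auto simp: F_def)
    qed
  qed
  have newE: "T - {x n} \<in> Pow F" if T: "T \<in> new_triangles P (x n)" for T n
  proof -
    have d: "T \<in> del (insert (x n) P)" "x n \<in> T" using T by (auto simp: new_triangles_def)
    have "dist (x n) (circumcenter T) = circumradius T" using delD(6)[OF d] by (simp add: dist_commute)
    then show ?thesis using near[OF d(1) subset_insertI order_refl] by simp
  qed
  have cavE: "T \<in> Pow F" if T: "T \<in> cavity P (x n)" for T n
  proof -
    have d: "T \<in> del P" "dist (x n) (circumcenter T) < circumradius T"
      using T by (auto simp: cavity_def circumball_def dist_commute)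
    have "x n \<notin> T" using delD(1)[OF d(1)] nP by (auto simp: x_def)
    then show ?thesis using near[OF d(1) order_refl subset_insertI, of n] d(2) by simp
  qed
  define code where "code n = ((\<lambda>T. T - {x n}) ` new_triangles P (x n), cavity P (x n))" for n
  have "range code \<subseteq> Pow (Pow F) \<times> Pow (Pow F)"
  proof
    fix z assume "z \<in> range code"
    then obtain n where z: "z = code n" by blast
    have "(\<lambda>T. T - {x n}) ` new_triangles P (x n) \<subseteq> Pow F" "cavity P (x n) \<subseteq> Pow F"
      using newE cavE by blast+
    then show "z \<in> Pow (Pow F) \<times> Pow (Pow F)" unfolding z code_def by (simp only: mem_Times_iff fst_conv snd_conv Pow_iff)
  qed
  moreover have "finite (Pow (Pow F) \<times> Pow (Pow F))" using finF by (intro finite_cartesian_product) (simp_all only: finite_Pow_iff)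
  ultimately have "finite (range code)" by (rule finite_subset)
  then obtain n0 where I: "infinite {n. code n = code n0}"
    using pigeonhole_infinite[of UNIV code] by auto
  have "infinite (t ` {n. code n = code n0})"
    using I finite_imageD[of t "{n. code n = code n0}"] inj_on_subset[OF inj] by blast
  then obtain a b c where abc: "a \<in> t ` {n. code n = code n0}" "b \<in> t ` {n. code n = code n0}"
    "c \<in> t ` {n. code n = code n0}" "a < b" "b < c" using infinite_reals_three by metis
  from abc(1-3) obtain n1 n2 n3 where n: "t n1 = a" "t n2 = b" "t n3 = c"
    "code n1 = code n0" "code n2 = code n0" "code n3 = code n0" by blast
  define E where "E = (\<lambda>T. T - {x n1}) ` new_triangles P (x n1)"
  define k where "k = (\<Sum>T\<in>cavity P (x n1). perimeter T)"
  have E: "(\<lambda>T. T - {x n}) ` new_triangles P (x n) = E" "cavity P (x n) = cavity P (x n1)"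
    if "code n = code n0" for n
    using that n(4) by (simp_all add: code_def E_def)
  have tri: "insert (x n) e \<in> new_triangles P (x n)" "x n \<notin> e" if e: "e \<in> E" and c: "code n = code n0" for e n
  proof -
    obtain T where T: "T \<in> new_triangles P (x n)" "e = T - {x n}" using e unfolding E(1)[OF c, symmetric] by blast
    then have "insert (x n) e = T" by (auto simp: new_triangles_def)
    then show "insert (x n) e \<in> new_triangles P (x n)" "x n \<notin> e" using T by auto
  qed
  have S: "(\<Sum>e\<in>E. perimeter (insert (x n) e)) = k" if c: "code n = code n0" for n
  proof -
    have i: "inj_on (\<lambda>T. T - {x n}) (new_triangles P (x n))"
    proof (rule inj_onI)
      fix T T' assume T: "T \<in> new_triangles P (x n)" "T' \<in> new_triangles P (x n)" "T - {x n} = T' - {x n}"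
      have "x n \<in> T" "x n \<in> T'" using T by (auto simp: new_triangles_def)
      then have "insert (x n) (T - {x n}) = T" "insert (x n) (T' - {x n}) = T'" by auto
      then show "T = T'" using T(3) by simp
    qed
    have "(\<Sum>e\<in>E. perimeter (insert (x n) e)) = (\<Sum>T\<in>new_triangles P (x n). perimeter (insert (x n) (T - {x n})))"
      unfolding E(1)[OF c, symmetric] by (subst sum.reindex[OF i]) simp
    also have "\<dots> = (\<Sum>T\<in>new_triangles P (x n). perimeter T)"
      by (intro sum.cong) (auto simp: new_triangles_def insert_absorb)
    also have "\<dots> = k" using zero[of n] unfolding perimeter_change_def x_def[symmetric] k_def E(2)[OF c] by simp
    finally show ?thesis .
  qed
  have "E \<subseteq> Pow F" unfolding E_def using newE by blast
  then have finE: "finite E" using finF by (meson finite_Pow_iff finite_subset)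
  \<comment> \<open>Strict convexity of the sum requires at least one new triangle; the nearest
    neighbour of \<open>x n1\<close> provides it.\<close>
  have "E \<noteq> {}"
  proof -
    obtain q where q: "q \<in> P" using cov by (auto simp: covering_def)
    then have "q \<in> insert (x n1) P" "q \<noteq> x n1" using nP by (auto simp: x_def)
    from exists_nearest_neighbour[OF locally_finite_insert[OF lf] this] obtain q' where q': "q' \<in> insert (x n1) P" "q' \<noteq> x n1"
      "\<And>s. s \<in> insert (x n1) P \<Longrightarrow> s \<noteq> x n1 \<Longrightarrow> dist (x n1) q' \<le> dist (x n1) s" by metis
    obtain s where "{x n1, q', s} \<in> del (insert (x n1) P)"
      using nearest_neighbour_del[OF locally_finite_insert[OF lf] insertI1 q'(1) q'(2)[symmetric] q'(3)] nc[of n1]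
      unfolding x_def by metis
    then have "{x n1, q', s} \<in> new_triangles P (x n1)" by (simp add: new_triangles_def)
    then show ?thesis by (auto simp: E_def)
  qed
  define l where "l = (b - a) / (c - a)"
  have l: "0 < l" "l < 1" using abc(4,5) by (simp_all add: l_def)
  have "l * (c - a) = b - a" using abc(4,5) by (simp add: l_def)
  then have bl: "b = (1 - l) * a + l * c" by (simp add: algebra_simps)
  have x2: "x n2 = (1 - l) *\<^sub>R x n1 + l *\<^sub>R x n3"
    unfolding x_def n bl by (simp add: scaleR_left_distrib)
  have ne: "x n1 \<noteq> x n3" using v abc(4,5) by (simp add: x_def n)
  \<comment> \<open>The sum over \<open>E\<close> equals the constant \<open>k\<close> at three
    points of a line, the second between the others, against strict convexity.\<close>
  have "k = (\<Sum>e\<in>E. perimeter (insert (x n2) e))" using S[OF n(5)] by simp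
  also have "\<dots> < (\<Sum>e\<in>E. (1 - l) * perimeter (insert (x n1) e) + l * perimeter (insert (x n3) e))"
  proof (rule sum_strict_mono[OF finE \<open>E \<noteq> {}\<close>])
    fix e assume e: "e \<in> E"
    have d: "insert (x n1) e \<in> del (insert (x n1) P)" using tri(1)[OF e n(4)] by (simp add: new_triangles_def)
    show "perimeter (insert (x n2) e) < (1 - l) * perimeter (insert (x n1) e) + l * perimeter (insert (x n3) e)"
      using delD(2,3)[OF d] tri(2)[OF e n(4)] tri(2)[OF e n(5)] tri(2)[OF e n(6)]
      by (intro perimeter_strictly_convex[OF l x2 ne])
  qed
  also have "\<dots> = (1 - l) * k + l * k"
    using S[OF n(4)] S[OF n(6)] by (simp add: sum.distrib sum_distrib_left[symmetric])
  also have "\<dots> = k" by (simp add: algebra_simps)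
  finally show False by simp
qed

lemma del_eq_hit_UNIV: "del P = hit P UNIV"
proof -
  have "circumball T \<noteq> {}" if "T \<in> del P" for T using delD(5)[OF that] by (simp add: circumball_def)
  then show ?thesis by (auto simp: hit_def)
qed

lemma del_translate: "del ((\<lambda>z. z + y) ` P) = (\<lambda>T. (\<lambda>z. z + y) ` T) ` del P"
proof -
  have "surj (\<lambda>z. z + y)" by (rule surjI[where f = "\<lambda>z. z - y"]) simp
  then show ?thesis using hit_translate[of y P UNIV] by (simp add: del_eq_hit_UNIV)
qed

section \<open>A measurable version of the local energy at the origin\<close>

lemma null_configuration: "null_measure borel \<in> (configurations :: 'a::euclidean_space measure set)"
  by (rule configurationsI) (auto intro: exI[of _ 0])

text \<open>Adding the origin yields a configuration only if it is not yet occupied, so it is removed first.\<close>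

definition origin_removed :: "(real^2) measure \<Rightarrow> (real^2) measure" where
  "origin_removed \<gamma> = glue (- {0}) \<gamma> (null_measure borel)"

lemma origin_removed:
  assumes "\<gamma> \<in> configurations"
  shows "origin_removed \<gamma> \<in> configurations" "points (origin_removed \<gamma>) = points \<gamma> - {0}"
proof -
  have c: "- {0 :: real^2} \<in> sets borel" by (intro borel_comp) simp
  show "origin_removed \<gamma> \<in> configurations"
    unfolding origin_removed_def by (rule glue_configuration[OF null_configuration assms c])
  have "points (null_measure borel :: (real^2) measure) = {}" by (simp add: points_def)
  then show "points (origin_removed \<gamma>) = points \<gamma> - {0}"
    unfolding origin_removed_def points_glue[OF null_configuration assms c] by auto
qed

text \<open>The fixed set \<open>ball 0 1\<close> replaces the definite description over admissible
  sets, which makes the function measurable on all configurations.\<close>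

definition origin_energy :: "real \<Rightarrow> real \<Rightarrow> real \<Rightarrow> (real^2) measure \<Rightarrow> ereal" where
  "origin_energy r \<alpha> \<theta> \<gamma> = delaunay_energy r \<alpha> \<theta> (ball 0 1) (add_point (origin_removed \<gamma>) 0)
     - delaunay_energy r \<alpha> \<theta> (ball 0 1) (origin_removed \<gamma>)"

lemma measurable_origin_energy [measurable]: "origin_energy r \<alpha> \<theta> \<in> borel_measurable conf"
proof -
  have E: "delaunay_energy r \<alpha> \<theta> (ball 0 1) \<in> borel_measurable conf"
    by (rule measurable_delaunay_energy) simp
  have c: "- {0 :: real^2} \<in> sets borel" by (intro borel_comp) simp
  have o: "origin_removed \<in> measurable conf conf"
    unfolding origin_removed_def[abs_def]
    by (rule measurable_glue[OF c]) (simp_all add: null_configuration)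
  have a: "(\<lambda>\<gamma>. add_point (origin_removed \<gamma>) 0) \<in> measurable conf conf"
    by (rule measurable_add_point[OF o]) (simp add: origin_removed)
  show ?thesis unfolding origin_energy_def[abs_def]
    by (intro borel_measurable_ereal_diff measurable_compose[OF a E] measurable_compose[OF o E])
qed

lemma origin_energy_eq:
  assumes fe: "\<gamma> \<in> finite_energy (delaunay_energy r \<alpha> \<theta>)" and "0 \<notin> points \<gamma>"
  shows "origin_energy r \<alpha> \<theta> \<gamma> = delaunay_local_energy r \<alpha> \<theta> 0 \<gamma>"
proof -
  have \<gamma>: "\<gamma> \<in> configurations" and t: "\<forall>T\<in>del (points \<gamma>). tame r \<alpha> T" using fe by (auto simp: finite_energy_iff)
  have p: "points (origin_removed \<gamma>) = points \<gamma>" using assms(2) by (simp add: origin_removed \<gamma>)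
  have fe': "origin_removed \<gamma> \<in> finite_energy (delaunay_energy r \<alpha> \<theta>)"
    using t origin_removed(1)[OF \<gamma>] by (simp add: finite_energy_iff p)
  have "origin_energy r \<alpha> \<theta> \<gamma> =
    (if \<forall>T\<in>new_triangles (points (origin_removed \<gamma>)) 0. tame r \<alpha> T then ereal (\<theta> * perimeter_change (points (origin_removed \<gamma>)) 0) else \<infinity>)"
    unfolding origin_energy_def
    using t by (intro delaunay_energy_add_point[where e = 1] origin_removed(1)[OF \<gamma>]) (auto simp: p assms(2) hit_def)
  then show ?thesis unfolding p local_energy_finite_energy[OF assms] .
qed

lemma finite_energy_parameter:
  "finite_energy (delaunay_energy r \<alpha> \<theta>) = finite_energy (delaunay_energy r \<alpha> \<theta>')"
  by (auto simp: finite_energy_iff)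

text \<open>In the completion every subset of a null set is measurable, so the part where
  \<open>f\<close> and \<open>g\<close> differ can be cut out and replaced. This covers local
  energies, which are only almost surely equal to \<open>origin_energy\<close>.\<close>

lemma borel_measurable_completion_AE:
  fixes f g :: "'b \<Rightarrow> 'c::topological_space"
  assumes g: "g \<in> borel_measurable M" and ae: "AE x in M. f x = g x"
  shows "f \<in> borel_measurable (completion M)"
proof (rule measurableI)
  fix A :: "'c set" assume A: "A \<in> sets borel"
  have ne: "Measurable.pred (completion M) (\<lambda>x. f x \<noteq> g x)"
    by (rule sets_completion_AE) (use ae in simp)
  have ne': "Measurable.pred (completion M) (\<lambda>x. f x \<noteq> g x \<and> f x \<in> A)"
    by (rule sets_completion_AE) (use ae in \<open>eventually_elim, simp\<close>)
  have "g -` A \<inter> space (completion M) \<in> sets (completion M)"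
    by (rule measurable_sets[OF measurable_completion[OF g] A])
  then have "(g -` A \<inter> space (completion M) - {x \<in> space (completion M). f x \<noteq> g x})
      \<union> {x \<in> space (completion M). f x \<noteq> g x \<and> f x \<in> A} \<in> sets (completion M)"
    using ne ne' by (simp only: pred_def sets.Un sets.Diff)
  also have "(g -` A \<inter> space (completion M) - {x \<in> space (completion M). f x \<noteq> g x})
      \<union> {x \<in> space (completion M). f x \<noteq> g x \<and> f x \<in> A} = f -` A \<inter> space (completion M)"
    by auto
  finally show "f -` A \<inter> space (completion M) \<in> sets (completion M)" .
qed simp

context
  fixes \<nu> :: "(real^2) measure measure" and r \<alpha> \<theta> :: real
  assumes gibbs: "gibbs_measure (delaunay_energy r \<alpha> \<theta>) \<nu>" and stat: "stationary \<nu>"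
    and r: "0 < r" and \<alpha>: "r < \<alpha>"
begin

interpretation prob_space \<nu> by (rule gibbs_space(1)[OF gibbs])

text \<open>The origin is moved through infinitely many points of a unit segment. Each point of the
  configuration is met at most once and each circle at most twice, and only finitely many circles of
  radius below \<open>\<alpha>\<close> are near; so only finitely many translates of the bad event
  occur.\<close>

lemma AE_origin_generic:
  "AE \<gamma> in \<nu>. 0 \<notin> points \<gamma> \<and> (\<forall>T\<in>del (points \<gamma>). circumradius T < \<alpha> \<longrightarrow> norm (circumcenter T) \<noteq> circumradius T)"
proof -
  define E where "E = {\<gamma> \<in> configurations. 0 \<in> points \<gamma> \<or> (\<exists>T\<in>del (points \<gamma>). norm (circumcenter T) = circumradius T \<and> circumradius T < \<alpha>)}"
  have E: "E \<in> sets conf" unfolding E_def by (rule origin_on_delaunay_circle_measurable)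
  define p :: "nat \<Rightarrow> real^2" where "p n = (1 / real (Suc n)) *\<^sub>R axis 1 1" for n
  have injp: "inj p" by (rule injI) (simp add: p_def axis_eq_0_iff)
  have np: "norm (p n) \<le> 1" for n by (simp add: p_def norm_axis_1)
  \<comment> \<open>The points \<open>p n\<close> lie on a line, which meets a circle at most
    twice.\<close>
  have circle: "finite {n. dist c (p n) = R}" for c R
  proof (rule ccontr)
    assume "infinite {n. dist c (p n) = R}"
    then obtain S where S: "S \<subseteq> {n. dist c (p n) = R}" "finite S" "card S = 3"
      using infinite_arbitrarily_large by metis
    then obtain i j k where ijk: "S = {i, j, k}" "i \<noteq> j" "i \<noteq> k" "j \<noteq> k" by (auto simp: card_3_iff)
    have "p i \<noteq> p j" "p i \<noteq> p k" "p j \<noteq> p k" using ijk injp by (auto simp: inj_def)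
    then have "\<not> collinear {p i, p j, p k}"
      by (rule concyclic_noncollinear[of _ _ _ c R]) (use S(1) ijk(1) in auto)
    moreover have "collinear {p i, p j, p k}" unfolding collinear_3_rot by (simp add: p_def inner_real2 axis_def)
    ultimately show False by blast
  qed
  have "AE \<gamma> in \<nu>. \<gamma> \<notin> E"
  proof (rule stationary_finitely_many_translates_null[OF prob_space_axioms gibbs_space(2)[OF gibbs] stat E])
    fix \<gamma> :: "(real^2) measure" assume \<gamma>: "\<gamma> \<in> configurations"
    define P where "P = points \<gamma>"
    have lf: "locally_finite P" using \<gamma> by (simp add: P_def locally_finite_points)
    \<comment> \<open>A circle through a point of norm at most 1 bounds a disc that meets
      \<open>ball 0 2\<close>.\<close>
    define \<T> where "\<T> = {T \<in> hit P (ball 0 2). circumradius T < \<alpha>}"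
    have fin\<T>: "finite \<T>" unfolding \<T>_def by (rule finite_small_hit[OF lf bounded_ball])
    have "{n. translate \<gamma> (- p n) \<in> E} \<subseteq> p -` (P \<inter> cball 0 1) \<union> (\<Union>T\<in>\<T>. {n. dist (circumcenter T) (p n) = circumradius T})"
    proof
      fix n assume "n \<in> {n. translate \<gamma> (- p n) \<in> E}"
      then have "0 \<in> points (translate \<gamma> (- p n)) \<or> (\<exists>T\<in>del (points (translate \<gamma> (- p n))). norm (circumcenter T) = circumradius T \<and> circumradius T < \<alpha>)"
        by (simp add: E_def)
      then show "n \<in> p -` (P \<inter> cball 0 1) \<union> (\<Union>T\<in>\<T>. {n. dist (circumcenter T) (p n) = circumradius T})"
        unfolding points_translate[OF \<gamma>] del_translate P_def[symmetric]
      proof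
        assume "0 \<in> (\<lambda>x. x + - p n) ` P"
        then show ?thesis using np by (auto simp: dist_norm)
      next
        assume "\<exists>T\<in>(\<lambda>T. (\<lambda>x. x + - p n) ` T) ` del P. norm (circumcenter T) = circumradius T \<and> circumradius T < \<alpha>"
        then obtain T where T: "T \<in> del P" "norm (circumcenter ((\<lambda>x. x + - p n) ` T)) = circumradius ((\<lambda>x. x + - p n) ` T)"
          "circumradius ((\<lambda>x. x + - p n) ` T) < \<alpha>" by blast
        note c = delD(2,3)[OF T(1)]
        have d: "dist (circumcenter T) (p n) = circumradius T" "circumradius T < \<alpha>"
          using T(2,3)[unfolded circumcenter_translate[OF c] circumradius_translate[OF c]] by (simp_all add: dist_norm)
        have "circumball T \<inter> ball 0 2 \<noteq> {}"
        proof -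
          have "norm (circumcenter T) \<le> dist (circumcenter T) (p n) + norm (p n)"
            by (metis dist_norm norm_triangle_sub add.commute)
          then have "norm (circumcenter T) < circumradius T + 2" using d(1) np[of n] by linarith
          then show ?thesis unfolding circumball_def
            by (rule ball_Int_ball_nonempty_iff[OF delD(5)[OF T(1)] zero_less_numeral, THEN iffD2])
        qed
        then have "T \<in> \<T>" using T(1) d(2) by (simp add: \<T>_def hit_def)
        then show ?thesis using d(1) by blast
      qed
    qed
    moreover have "finite (p -` (P \<inter> cball 0 1))"
      using lf injp by (intro finite_vimageI) (simp_all add: locally_finite_def)
    moreover have "finite (\<Union>T\<in>\<T>. {n. dist (circumcenter T) (p n) = circumradius T})"
      using fin\<T> circle by blast
    ultimately show "finite {n. translate \<gamma> (- p n) \<in> E}" by (meson finite_Un finite_subset)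
  qed
  then show ?thesis using AE_space by eventually_elim (auto simp: E_def gibbs_space(3)[OF gibbs])
qed

text \<open>An empty \<open>ball 0 \<beta>\<close> forces a Delaunay disc of radius at least
  \<open>\<beta>\<close> that contains the origin and is therefore counted in
  \<open>ball 0 1\<close>. Its triangle violates the radius constraint for \<open>\<beta>\<close>,
  which gives (S3).\<close>

lemma large_disc_positive:
  assumes \<beta>: "0 < \<beta>" "\<beta> < \<alpha>"
  shows "0 < measure \<nu> {\<gamma> \<in> space \<nu>. delaunay_energy r \<beta> \<theta>' (ball 0 1) \<gamma> = \<infinity>}"
proof -
  let ?E = "{\<gamma> \<in> configurations. emeasure \<gamma> (ball (0::real^2) \<beta>) = 0}"
  let ?I = "{\<gamma> \<in> space \<nu>. delaunay_energy r \<beta> \<theta>' (ball 0 1) \<gamma> = \<infinity>}"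
  have "delaunay_energy r \<beta> \<theta>' (ball 0 1) \<in> borel_measurable \<nu>"
    using measurable_delaunay_energy[of 1] gibbs_space(2)[OF gibbs] by (simp cong: measurable_cong_sets)
  then have I: "?I \<in> sets \<nu>" by measurable
  have "0 < prob ?E" by (rule empty_disc_positive[OF gibbs stat r \<alpha> \<beta>(2)])
  also have "\<dots> \<le> prob ?I"
  proof (rule finite_measure_mono_AE[OF _ I])
    show "AE \<gamma> in \<nu>. \<gamma> \<in> ?E \<longrightarrow> \<gamma> \<in> ?I" using AE_surrounded[OF gibbs stat r \<alpha>]
    proof eventually_elim
      case (elim \<gamma>)
      show ?case
      proof
        assume "\<gamma> \<in> ?E"
        then have \<gamma>: "\<gamma> \<in> configurations" by simp
        have empty: "points \<gamma> \<inter> ball 0 \<beta> = {}"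
          using \<open>\<gamma> \<in> ?E\<close> emeasure_configuration_eq_0_iff[OF \<gamma>, of "ball 0 \<beta>"] by simp
        have far: "\<beta> \<le> dist 0 p" if "p \<in> points \<gamma>" for p
        proof -
          have "p \<notin> ball 0 \<beta>" using empty that by blast
          then show ?thesis by simp
        qed
        obtain T where T: "T \<in> del (points \<gamma>)" "\<beta> \<le> circumradius T" "0 \<in> circumball T"
          using exists_large_delaunay_disc[OF locally_finite_points[OF \<gamma>] _ \<beta>(1) far] elim by blast
        have "0 \<in> circumball T \<inter> ball 0 1" using T(3) by simp
        then have "T \<in> hit (points \<gamma>) (ball 0 1)" using T(1) unfolding hit_def by blast
        moreover have "\<not> tame r \<beta> T" using T(2) by (simp add: tame_def)
        ultimately have "delaunay_energy r \<beta> \<theta>' (ball 0 1) \<gamma> = \<infinity>" unfolding delaunay_energy_infinite_iff by blast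
        then show "\<gamma> \<in> ?I" using \<gamma> by (simp add: gibbs_space(3)[OF gibbs])
      qed
    qed
  qed
  finally show ?thesis .
qed

text \<open>Where the new triangles are tame, both local energies are multiples of a number bounded
  by \<open>C\<close>; elsewhere the product is 0. The function is thus bounded by \<open>B\<close>
  almost surely.\<close>

lemma local_energy_integrable:
  "in_L1 \<nu> (\<lambda>\<gamma>. delaunay_local_energy r \<alpha> \<theta>' 0 \<gamma> * ereal (boltzmann (delaunay_local_energy r \<alpha> \<theta> 0 \<gamma>)))"
proof -
  obtain C where C: "0 \<le> C" "\<And>P x \<beta>. locally_finite P \<Longrightarrow> x \<notin> P \<Longrightarrow> \<beta> \<le> \<alpha> \<Longrightarrow> \<forall>T\<in>del P. tame r \<beta> T
    \<Longrightarrow> \<forall>T\<in>new_triangles P x. tame r \<beta> T \<Longrightarrow> \<bar>perimeter_change P x\<bar> \<le> C"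
  proof (rule perimeter_change_bounded[OF r, of \<alpha>], goal_cases)
    case (1 C)
    show ?case by (rule 1(1)[OF 1(2,3)])
  qed
  define B where "B = \<bar>\<theta>'\<bar> * C * exp (\<bar>\<theta>\<bar> * C)"
  let ?f = "\<lambda>\<gamma>. delaunay_local_energy r \<alpha> \<theta>' 0 \<gamma> * ereal (boltzmann (delaunay_local_energy r \<alpha> \<theta> 0 \<gamma>))"
  let ?g = "\<lambda>\<gamma>. real_of_ereal (origin_energy r \<alpha> \<theta>' \<gamma> * ereal (boltzmann (origin_energy r \<alpha> \<theta> \<gamma>)))"
  have gm: "?g \<in> borel_measurable \<nu>"
  proof -
    have "?g \<in> borel_measurable conf" by measurable
    then show ?thesis using gibbs_space(2)[OF gibbs] by (simp cong: measurable_cong_sets)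
  qed
  have ae: "AE \<gamma> in \<nu>. real_of_ereal (?f \<gamma>) = ?g \<gamma> \<and> \<bar>?f \<gamma>\<bar> \<noteq> \<infinity> \<and> \<bar>real_of_ereal (?f \<gamma>)\<bar> \<le> B"
    using AE_finite_energy[OF gibbs stat r \<alpha>] AE_origin_generic
  proof eventually_elim
    case (elim \<gamma>)
    have fe': "\<gamma> \<in> finite_energy (delaunay_energy r \<alpha> \<theta>')" using elim(1) finite_energy_parameter by blast
    have 0: "0 \<notin> points \<gamma>" using elim(2) by blast
    have B0: "0 \<le> B" using C(1) by (simp add: B_def)
    have "\<bar>?f \<gamma>\<bar> \<noteq> \<infinity> \<and> \<bar>real_of_ereal (?f \<gamma>)\<bar> \<le> B"
    proof (cases "\<forall>T\<in>new_triangles (points \<gamma>) 0. tame r \<alpha> T")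
      case True
      define D where "D = perimeter_change (points \<gamma>) 0"
      have t: "\<gamma> \<in> configurations" "\<forall>T\<in>del (points \<gamma>). tame r \<alpha> T" using elim(1) by (auto simp: finite_energy_iff)
      have D: "\<bar>D\<bar> \<le> C" unfolding D_def
        by (rule C(2)[OF locally_finite_points[OF t(1)] 0 order_refl t(2) True])
      have f: "?f \<gamma> = ereal (\<theta>' * D * exp (- (\<theta> * D)))"
        using True by (simp add: local_energy_finite_energy[OF elim(1) 0] local_energy_finite_energy[OF fe' 0] D_def boltzmann_def)
      have "- (\<theta> * D) \<le> \<bar>\<theta>\<bar> * C"
      proof -
        have "- (\<theta> * D) \<le> \<bar>\<theta>\<bar> * \<bar>D\<bar>" by (metis abs_ge_minus_self abs_mult)
        also have "\<dots> \<le> \<bar>\<theta>\<bar> * C" using D by (intro mult_left_mono) auto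
        finally show ?thesis .
      qed
      then have "\<bar>\<theta>'\<bar> * \<bar>D\<bar> * exp (- (\<theta> * D)) \<le> B"
        unfolding B_def using D C(1) by (intro mult_mono) auto
      then show ?thesis by (simp add: f abs_mult)
    next
      case False
      then have "delaunay_local_energy r \<alpha> \<theta> 0 \<gamma> = \<infinity>" "delaunay_local_energy r \<alpha> \<theta>' 0 \<gamma> = \<infinity>"
        by (simp_all only: local_energy_finite_energy[OF elim(1) 0] local_energy_finite_energy[OF fe' 0] if_False)
      \<comment> \<open>In \<open>ereal\<close> the product of \<open>\<infinity>\<close> and 0 is
        0, which realises the convention of (H4).\<close>
      then show ?thesis using B0 by (simp add: boltzmann_def zero_ereal_def[symmetric])
    qed
    then show ?case using origin_energy_eq[OF elim(1) 0] origin_energy_eq[OF fe' 0] by simp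
  qed
  have ae1: "AE \<gamma> in \<nu>. real_of_ereal (?f \<gamma>) = ?g \<gamma>" using ae by eventually_elim blast
  have "AE \<gamma> in \<nu>. norm (?g \<gamma>) \<le> B" using ae
  proof eventually_elim
    case (elim \<gamma>)
    then have "real_of_ereal (?f \<gamma>) = ?g \<gamma>" "\<bar>real_of_ereal (?f \<gamma>)\<bar> \<le> B" by blast+
    then show ?case by (simp only: real_norm_def)
  qed
  then have "integrable \<nu> ?g" using gm by (rule integrable_const_bound)
  then have ig: "integrable (completion \<nu>) ?g" using integrable_completion[OF gm] by simp
  have fm: "(\<lambda>\<gamma>. real_of_ereal (?f \<gamma>)) \<in> borel_measurable (completion \<nu>)"
    by (rule borel_measurable_completion_AE[OF gm ae1])
  have "integrable (completion \<nu>) (\<lambda>\<gamma>. real_of_ereal (?f \<gamma>)) \<longleftrightarrow> integrable (completion \<nu>) ?g"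
    by (rule integrable_cong_AE[OF fm measurable_completion[OF gm] AE_completion[OF ae1]])
  moreover have "AE \<gamma> in \<nu>. \<bar>?f \<gamma>\<bar> \<noteq> \<infinity>" using ae
  proof eventually_elim
    case (elim \<gamma>)
    then show ?case by (rule conjunct1[OF conjunct2])
  qed
  ultimately show ?thesis unfolding in_L1_def using ig by blast
qed

text \<open>If the energies agreed almost surely at the origin, stationarity would make them agree
  at countably many prescribed positions at once. In a configuration with a large empty disc these
  positions give finite energies, hence a vanishing change of perimeter at all of them.\<close>

lemma local_energies_differ:
  assumes ne: "\<theta>' \<noteq> \<theta>"
  shows "0 < measure (completion \<nu>) {\<gamma> \<in> space \<nu>. delaunay_local_energy r \<alpha> \<theta> 0 \<gamma> \<noteq> delaunay_local_energy r \<alpha> \<theta>' 0 \<gamma>}"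
proof (rule ccontr)
  define Q where "Q = {\<gamma> \<in> space conf. origin_energy r \<alpha> \<theta> \<gamma> = origin_energy r \<alpha> \<theta>' \<gamma>}"
  have Q: "Q \<in> sets conf" unfolding Q_def by measurable
  let ?X = "{\<gamma> \<in> space \<nu>. delaunay_local_energy r \<alpha> \<theta> 0 \<gamma> \<noteq> delaunay_local_energy r \<alpha> \<theta>' 0 \<gamma>}"
  let ?Y = "space \<nu> - Q"
  have Y: "?Y \<in> sets \<nu>" using Q by (intro sets.compl_sets) (simp add: gibbs_space(2)[OF gibbs])
  have XY: "AE \<gamma> in \<nu>. \<gamma> \<in> ?X \<longleftrightarrow> \<gamma> \<in> ?Y"
    using AE_finite_energy[OF gibbs stat r \<alpha>] AE_origin_generic AE_space
  proof eventually_elim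
    case (elim \<gamma>)
    have fe': "\<gamma> \<in> finite_energy (delaunay_energy r \<alpha> \<theta>')" using elim(1) finite_energy_parameter by blast
    have 0: "0 \<notin> points \<gamma>" using elim(2) by blast
    show ?case using elim(3) unfolding Q_def
      by (simp add: origin_energy_eq[OF elim(1) 0] origin_energy_eq[OF fe' 0] gibbs_space(3)[OF gibbs])
  qed
  assume "\<not> 0 < measure (completion \<nu>) ?X"
  then have mX: "measure (completion \<nu>) ?X = 0" by (simp add: not_less measure_le_0_iff)
  have "(indicator ?X :: _ \<Rightarrow> real) \<in> borel_measurable (completion \<nu>)"
  proof (rule borel_measurable_completion_AE[where g = "indicator ?Y"])
    show "(indicator ?Y :: _ \<Rightarrow> real) \<in> borel_measurable \<nu>" using Y by simp
    show "AE \<gamma> in \<nu>. (indicator ?X \<gamma> :: real) = indicator ?Y \<gamma>"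
      using XY by eventually_elim (simp only: indicator_def)
  qed
  from measurable_sets[OF this, of "{1}"]
  have "(indicator ?X :: _ \<Rightarrow> real) -` {1} \<inter> space (completion \<nu>) \<in> sets (completion \<nu>)" by simp
  moreover have "(indicator ?X :: _ \<Rightarrow> real) -` {1} \<inter> space (completion \<nu>) = ?X"
    by (auto simp: indicator_def)
  ultimately have X: "?X \<in> sets (completion \<nu>)" by (simp only:)
  have "measure (completion \<nu>) ?Y = measure (completion \<nu>) ?X"
  proof (rule measure_eq_AE[OF _ _ X])
    show "AE \<gamma> in completion \<nu>. \<gamma> \<in> ?Y \<longleftrightarrow> \<gamma> \<in> ?X"
      by (rule AE_completion) (use XY in \<open>eventually_elim, blast\<close>)
  qed (use Y in auto)
  then have "prob ?Y = 0" using mX Y by simp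
  then have "AE \<gamma> in \<nu>. \<gamma> \<notin> ?Y" using prob_eq_0[OF Y] by blast
  then have AEQ: "AE \<gamma> in \<nu>. \<gamma> \<in> Q" using AE_space by eventually_elim blast
  \<comment> \<open>Above \<open>r\<close>, so that points near the origin can be inserted at
    distance more than \<open>r\<close> from all others; below \<open>\<alpha>\<close>, so that such
    an empty disc has positive probability.\<close>
  define \<rho> where "\<rho> = (r + \<alpha>) / 2"
  have \<rho>: "r < \<rho>" "\<rho> < \<alpha>" using \<alpha> by (simp_all add: \<rho>_def)
  \<comment> \<open>Bounds the positions by 1, as the convexity lemma demands, and strictly by
    \<open>\<rho> - r\<close>, so that they keep distance more than \<open>r\<close> from points
    outside \<open>ball 0 \<rho>\<close>.\<close>
  define c where "c = min 1 ((\<rho> - r) / 2)"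
  have c: "0 < c" "c \<le> 1" "c < \<rho> - r" using \<rho> by (auto simp: c_def min_def)
  define t where "t n = c / real (Suc n)" for n
  have t: "0 < t n" "t n \<le> 1" "t n < \<rho> - r" for n
  proof -
    show "0 < t n" using c(1) by (simp add: t_def)
    have "c / real (Suc n) \<le> c / 1" using c(1) by (intro divide_left_mono) auto
    then show "t n \<le> 1" "t n < \<rho> - r" using c by (auto simp: t_def)
  qed
  have injt: "inj t" using c(1) by (intro injI) (simp add: t_def)
  define x :: "nat \<Rightarrow> real^2" where "x n = t n *\<^sub>R axis 1 1" for n
  have nx: "norm (x n) = t n" for n using t(1)[of n] by (simp add: x_def norm_axis_1)
  have "AE \<gamma> in \<nu>. translate \<gamma> (- x n) \<in> Q" for n
    by (rule stationary_AE_translate[OF prob_space_axioms gibbs_space(2)[OF gibbs] stat AEQ Q])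
  then have "AE \<gamma> in \<nu>. \<forall>n. translate \<gamma> (- x n) \<in> Q" by (simp add: AE_all_countable)
  then have all: "AE \<gamma> in \<nu>. (\<forall>n. translate \<gamma> (- x n) \<in> Q) \<and> \<gamma> \<in> finite_energy (delaunay_energy r \<alpha> \<theta>) \<and> (\<forall>y. surrounded (points \<gamma>) y)"
    using AE_finite_energy[OF gibbs stat r \<alpha>] AE_surrounded[OF gibbs stat r \<alpha>] by eventually_elim blast
  \<comment> \<open>One configuration with all the almost sure properties, chosen inside the event
    of positive probability; from here on the argument is deterministic.\<close>
  obtain \<gamma> where \<gamma>E: "\<gamma> \<in> {\<gamma> \<in> configurations. emeasure \<gamma> (ball (0::real^2) \<rho>) = 0}"
    and g: "(\<forall>n. translate \<gamma> (- x n) \<in> Q) \<and> \<gamma> \<in> finite_energy (delaunay_energy r \<alpha> \<theta>) \<and> (\<forall>y. surrounded (points \<gamma>) y)"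
    using AE_positive_obtain[OF all empty_disc_positive[OF gibbs stat r \<alpha> \<rho>(2)]] by blast
  have \<gamma>: "\<gamma> \<in> configurations" using \<gamma>E by simp
  have empty: "points \<gamma> \<inter> ball 0 \<rho> = {}"
    using \<gamma>E emeasure_configuration_eq_0_iff[OF \<gamma>, of "ball 0 \<rho>"] by simp
  have inQ: "translate \<gamma> (- x n) \<in> Q" for n using g by blast
  have fe: "\<gamma> \<in> finite_energy (delaunay_energy r \<alpha> \<theta>)" using g by blast
  have fe': "\<gamma> \<in> finite_energy (delaunay_energy r \<alpha> \<theta>')" using fe finite_energy_parameter by blast
  have sur: "surrounded (points \<gamma>) y" for y using g by blast
  have "0 < \<alpha>" using r \<alpha> by linarith
  note good = finite_energy_surrounded[OF fe sur this]
  define P where "P = points \<gamma>"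
  have far: "r < dist (x n) p" if "p \<in> P" for n p
  proof -
    have "p \<notin> ball 0 \<rho>" using empty that by (auto simp: P_def)
    then have "\<rho> \<le> norm p" by simp
    moreover have "norm p \<le> dist (x n) p + norm (x n)" by (metis dist_commute dist_norm norm_triangle_sub add.commute)
    ultimately show ?thesis using t(3)[of n] nx[of n] by linarith
  qed
  have xP: "x n \<notin> P" for n using far[of "x n" n] r by auto
  have tame_new: "tame r \<alpha> T" if T: "T \<in> new_triangles P (x n)" for T n
  proof -
    have d: "T \<in> del (insert (x n) P)" using T by (simp add: new_triangles_def)
    have "circumradius T < \<alpha>"
      by (rule circumradius_less_of_covering[OF good(2) d]) (auto simp: P_def)
    moreover have "\<not> min_side T \<le> r"
    proof
      assume "min_side T \<le> r"
      then obtain a b where ab: "a \<in> T" "b \<in> T" "a \<noteq> b" "dist a b \<le> r"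
        unfolding min_side_le_iff[OF delD(2)[OF d]] by blast
      have "a \<in> insert (x n) P" "b \<in> insert (x n) P" using delD(1)[OF d] ab by auto
      then consider "a = x n" "b \<in> P" | "b = x n" "a \<in> P" | "a \<in> P" "b \<in> P" using ab(3) by blast
      then show False
      proof cases
        case 1 then show ?thesis using far[of b n] ab(4) by simp
      next
        case 2 then show ?thesis using far[of a n] ab(4) by (simp add: dist_commute)
      next
        case 3
        then have "r < dist a b" using good(3) ab(3) unfolding separated_def P_def by blast
        then show ?thesis using ab(4) by simp
      qed
    qed
    ultimately show ?thesis by (simp add: tame_def)
  qed
  have "perimeter_change P (x n) = 0" for n
  proof -
    let ?\<gamma> = "translate \<gamma> (- x n)"
    have pt: "points ?\<gamma> = (\<lambda>z. z + - x n) ` P" by (simp add: points_translate[OF \<gamma>] P_def)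
    have 0: "0 \<notin> points ?\<gamma>" using xP[of n] unfolding pt by auto
    have tr: "?\<gamma> \<in> finite_energy (delaunay_energy r \<alpha> \<theta>)"
    proof -
      have "tame r \<alpha> ((\<lambda>z. z + - x n) ` T)" if T: "T \<in> del P" for T
      proof -
        note c = delD(2,3)[OF T]
        have "tame r \<alpha> T" using fe T by (auto simp: finite_energy_iff P_def)
        then show ?thesis by (simp only: tame_def circumradius_translate[OF c] min_side_translate[OF c])
      qed
      then show ?thesis unfolding finite_energy_iff pt del_translate
        using translate_configuration[OF \<gamma>] by blast
    qed
    have tr': "?\<gamma> \<in> finite_energy (delaunay_energy r \<alpha> \<theta>')" using tr finite_energy_parameter by blast
    have tl: "delaunay_local_energy r \<alpha> \<theta>'' 0 ?\<gamma> = delaunay_local_energy r \<alpha> \<theta>'' (x n) \<gamma>" for \<theta>''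
      using local_energy_translate[OF \<gamma>, of r \<alpha> \<theta>'' "x n" "- x n"] by simp
    have "delaunay_local_energy r \<alpha> \<theta> 0 ?\<gamma> = delaunay_local_energy r \<alpha> \<theta>' 0 ?\<gamma>"
      using inQ[of n] unfolding Q_def by (simp add: origin_energy_eq[OF tr 0] origin_energy_eq[OF tr' 0])
    then have "delaunay_local_energy r \<alpha> \<theta> (x n) \<gamma> = delaunay_local_energy r \<alpha> \<theta>' (x n) \<gamma>" by (simp only: tl)
    moreover have xn: "x n \<notin> points \<gamma>" using xP by (simp add: P_def)
    have tn: "\<forall>T\<in>new_triangles (points \<gamma>) (x n). tame r \<alpha> T" using tame_new by (simp add: P_def)
    moreover have "delaunay_local_energy r \<alpha> \<theta> (x n) \<gamma> = ereal (\<theta> * perimeter_change P (x n))"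
      using tn by (simp add: local_energy_finite_energy[OF fe xn] P_def)
    moreover have "delaunay_local_energy r \<alpha> \<theta>' (x n) \<gamma> = ereal (\<theta>' * perimeter_change P (x n))"
      using tn by (simp add: local_energy_finite_energy[OF fe' xn] P_def)
    \<comment> \<open>Tameness of the new triangles makes both energies finite; two infinite
      energies would agree without any consequence for the perimeters.\<close>
    ultimately have "\<theta> * perimeter_change P (x n) = \<theta>' * perimeter_change P (x n)" by simp
    then show ?thesis using ne by simp
  qed
  moreover have "\<exists>n. perimeter_change P (t n *\<^sub>R (axis 1 1 :: real^2)) \<noteq> 0"
  proof (rule perimeter_change_not_identically_zero)
    show "locally_finite P" "covering \<alpha> P" using good by (simp_all add: P_def)
    show "axis 1 1 \<noteq> (0 :: real^2)" by (simp add: axis_eq_0_iff)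
    show "norm (t n *\<^sub>R (axis 1 1 :: real^2)) \<le> 1" for n using nx[of n] t(2)[of n] by (simp add: x_def)
    show "t n *\<^sub>R axis 1 1 \<notin> P" for n using xP[of n] by (simp add: x_def)
    have "\<not> collinear P" using surrounded_not_collinear[OF sur] by (simp add: P_def)
    then show "\<not> collinear (insert (t n *\<^sub>R axis 1 1) P)" for n
      using collinear_subset[OF _ subset_insertI] by blast
  qed (rule injt)
  ultimately show False by (simp add: x_def)
qed

end

lemma tame_mono: "tame r \<alpha> T \<Longrightarrow> \<alpha> \<le> \<alpha>' \<Longrightarrow> tame r \<alpha>' T"
  by (simp add: tame_def)

text \<open>For almost every \<open>\<gamma>\<close> the origin lies on no Delaunay circle, so a small disc around it only meets
  the Delaunay discs that contain it. Hence the disc is admissible for \<open>\<alpha>\<close> as soon as \<open>0\<close> is removable.\<close>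

lemma removable_imp_small_ball_admissible:
  assumes fe: "\<gamma> \<in> finite_energy (delaunay_energy r \<alpha>' \<theta>')"
    and generic: "0 \<notin> points \<gamma>"
      "\<forall>T\<in>del (points \<gamma>). circumradius T < \<alpha>' \<longrightarrow> norm (circumcenter T) \<noteq> circumradius T"
    and rem: "0 \<in> removable (delaunay_energy r \<alpha> \<theta>) (add_point \<gamma> 0)"
  obtains e where "0 < e" "ball 0 e \<in> admissible (delaunay_energy r \<alpha> \<theta>) 0 \<gamma>"
proof -
  have \<gamma>: "\<gamma> \<in> configurations" and t: "\<And>T. T \<in> del (points \<gamma>) \<Longrightarrow> tame r \<alpha>' T"
    using fe by (auto simp: finite_energy_iff)
  have "\<exists>\<Lambda>\<in>bounded_borel. 0 \<in> \<Lambda> \<and> delaunay_energy r \<alpha> \<theta> \<Lambda> (remove_point (add_point \<gamma> 0) 0) < \<infinity>"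
    using rem unfolding removable_def mem_Collect_eq by (elim conjE)
  then obtain \<Lambda> where \<Lambda>: "0 \<in> \<Lambda>" "\<forall>T\<in>hit (points \<gamma>) \<Lambda>. tame r \<alpha> T"
    unfolding remove_add_point[OF \<gamma>] delaunay_energy_finite_iff by (elim bexE conjE) (rule that)
  \<comment> \<open>The triangles near the origin that violate the constraint for
    \<open>\<alpha>\<close>. None has the origin in its disc, since \<open>\<Lambda>\<close> would
    count it, and none has it on its circle by genericity; being finitely many, their discs stay at
    a positive distance \<open>d\<close>.\<close>
  define \<T> where "\<T> = {T \<in> {T \<in> hit (points \<gamma>) (ball 0 1). circumradius T < \<alpha>'}. \<not> tame r \<alpha> T}"
  have fin: "finite \<T>" unfolding \<T>_def
    by (rule finite_subset[OF _ finite_small_hit[OF locally_finite_points[OF \<gamma>] bounded_ball]]) blast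
  have "0 < norm (circumcenter T) - circumradius T" if "T \<in> \<T>" for T
  proof -
    have T: "T \<in> del (points \<gamma>)" "circumradius T < \<alpha>'" "\<not> tame r \<alpha> T"
      using that by (auto simp: \<T>_def hit_def)
    have "T \<notin> hit (points \<gamma>) \<Lambda>" using T(3) \<Lambda>(2) by blast
    then have "0 \<notin> circumball T" using T(1) \<Lambda>(1) unfolding hit_def by blast
    then have "circumradius T \<le> norm (circumcenter T)" by (simp add: circumball_def)
    then show ?thesis using generic(2) T(1,2) by fastforce
  qed
  from finite_positive_lower_bound[OF fin, of "\<lambda>T. norm (circumcenter T) - circumradius T", OF this]
  obtain d where d: "0 < d" "\<forall>T\<in>\<T>. d \<le> norm (circumcenter T) - circumradius T" by blast
  define e where "e = min 1 d"
  have e: "0 < e" "e \<le> 1" "e \<le> d" using d(1) by (auto simp: e_def)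
  have "tame r \<alpha> T" if T: "T \<in> hit (points \<gamma>) (ball 0 e)" for T
  proof (rule ccontr)
    assume n: "\<not> tame r \<alpha> T"
    have D: "T \<in> del (points \<gamma>)" using T by (rule hit_del)
    have "circumball T \<inter> ball 0 e \<noteq> {}" using T by (simp add: hit_def)
    then have lt: "norm (circumcenter T) < circumradius T + e"
      unfolding circumball_def by (rule ball_Int_ball_nonempty_iff[OF delD(5)[OF D] e(1), THEN iffD1])
    have "circumball T \<inter> ball 0 1 \<noteq> {}"
      unfolding circumball_def
      by (rule ball_Int_ball_nonempty_iff[OF delD(5)[OF D] zero_less_one, THEN iffD2]) (use lt e(2) in simp)
    then have "T \<in> \<T>" using D n t[OF D] by (simp add: \<T>_def hit_def tame_def)
    then show False using d(2) lt e(3) by fastforce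
  qed
  then have "ball 0 e \<in> admissible (delaunay_energy r \<alpha> \<theta>) 0 \<gamma>"
    unfolding admissible_def delaunay_energy_finite_iff using e(1) by simp
  then show ?thesis using that e(1) by blast
qed

theorem proposition5:
  fixes r \<alpha>s \<theta>s :: real
    and K \<Theta> :: "real set"
    and \<mu> :: "(real^2) measure measure"
  assumes "r > 0"
    and "compact K" and "K \<subseteq> {0<..}" and "\<forall>\<alpha>\<in>K. \<alpha> > r"
    and "open \<Theta>" and "bounded \<Theta>"
    and "\<alpha>s \<in> K" and "\<theta>s \<in> \<Theta>"
    and "gibbs_measure (delaunay_energy r \<alpha>s \<theta>s) \<mu>" and "stationary \<mu>"
  shows
    "(\<forall>\<gamma>\<in>configurations. \<forall>\<alpha>\<in>K. \<forall>\<theta>\<in>\<Theta>. \<forall>\<theta>'\<in>\<Theta>. \<forall>\<Lambda>\<in>bounded_borel.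
        delaunay_energy r \<alpha> \<theta> \<Lambda> \<gamma> < \<infinity> \<longleftrightarrow> delaunay_energy r \<alpha> \<theta>' \<Lambda> \<gamma> < \<infinity>)
    \<and> (\<forall>\<gamma>\<in>configurations. \<forall>\<alpha>\<in>K. \<forall>\<alpha>'\<in>K. \<forall>\<theta>\<in>\<Theta>. \<forall>\<Lambda>\<in>bounded_borel. \<alpha> \<le> \<alpha>' \<longrightarrow>
        delaunay_energy r \<alpha> \<theta> \<Lambda> \<gamma> < \<infinity> \<longrightarrow> delaunay_energy r \<alpha>' \<theta> \<Lambda> \<gamma> < \<infinity>)
    \<and> (\<forall>\<alpha>\<in>K. \<alpha> < \<alpha>s \<longrightarrow> (\<exists>R>0. \<forall>\<nu>.
        gibbs_measure (delaunay_energy r \<alpha>s \<theta>s) \<nu> \<and> stationary \<nu> \<longrightarrow>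
        measure \<nu> {\<gamma> \<in> space \<nu>. delaunay_energy r \<alpha> \<theta>s (ball 0 R) \<gamma> = \<infinity>} > 0))
    \<and> (\<forall>\<gamma>\<in>configurations. \<forall>\<Lambda>\<in>bounded_borel. \<forall>\<theta>\<in>\<Theta>. \<forall>\<alpha>'\<in>K.
        delaunay_energy r \<alpha>' \<theta> \<Lambda> \<gamma> < \<infinity> \<longrightarrow>
        (\<exists>\<alpha>. 0 < \<alpha> \<and> \<alpha> < \<alpha>' \<and> delaunay_energy r \<alpha> \<theta> \<Lambda> \<gamma> < \<infinity>))
    \<and> (\<forall>\<alpha>\<in>K. \<forall>\<theta>\<in>\<Theta>. \<forall>x y. \<forall>\<gamma>\<in>configurations.
        x \<in> removable (delaunay_energy r \<alpha> \<theta>) (add_point \<gamma> x) \<longrightarrow>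
        delaunay_local_energy r \<alpha> \<theta> (x + y) (translate \<gamma> y) = delaunay_local_energy r \<alpha> \<theta> x \<gamma>)
    \<and> (\<exists>C\<ge>0. \<forall>\<alpha>\<in>K. \<forall>\<theta>\<in>\<Theta>. \<forall>\<gamma>\<in>finite_energy (delaunay_energy r \<alpha> \<theta>). \<forall>x.
        x \<notin> points \<gamma> \<longrightarrow> delaunay_local_energy r \<alpha> \<theta> x \<gamma> \<ge> ereal (- C))
    \<and> (\<forall>\<theta>\<in>\<Theta>. in_L1 \<mu> (\<lambda>\<gamma>. delaunay_local_energy r \<alpha>s \<theta> 0 \<gamma>
        * ereal (boltzmann (delaunay_local_energy r \<alpha>s \<theta>s 0 \<gamma>))))
    \<and> (\<forall>\<theta>\<in>\<Theta> - {\<theta>s}. measure (completion \<mu>) {\<gamma> \<in> space \<mu>.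
        delaunay_local_energy r \<alpha>s \<theta>s 0 \<gamma> \<noteq> delaunay_local_energy r \<alpha>s \<theta> 0 \<gamma>} > 0)
    \<and> (\<exists>(\<delta> :: real \<Rightarrow> real) (g :: (real^2) measure \<Rightarrow> real).
        (\<delta> \<longlongrightarrow> 0) (nhds 0) \<and> integrable \<mu> g \<and>
        (AE \<gamma> in \<mu>. \<gamma> \<in> finite_energy (delaunay_energy r \<alpha>s \<theta>s) \<longrightarrow>
          (\<forall>\<alpha>\<in>K. \<alpha> \<le> \<alpha>s \<longrightarrow> (\<forall>\<theta>\<in>\<Theta>. \<forall>\<theta>'\<in>\<Theta>.
            0 \<in> removable (delaunay_energy r \<alpha> \<theta>) (add_point \<gamma> 0) \<and>
            delaunay_local_energy r \<alpha> \<theta> 0 \<gamma> < \<infinity> \<longrightarrow>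
            \<bar>delaunay_local_energy r \<alpha> \<theta> 0 \<gamma> - delaunay_local_energy r \<alpha>s \<theta>' 0 \<gamma>\<bar>
              \<le> ereal (g \<gamma> * (\<delta> \<bar>\<alpha> - \<alpha>s\<bar> + \<delta> \<bar>\<theta> - \<theta>'\<bar>))))))"
proof -
  have \<alpha>s: "r < \<alpha>s" using assms(4,7) by blast
  note G = assms(9,10,1) \<alpha>s
  obtain A where A: "\<And>\<alpha>. \<alpha> \<in> K \<Longrightarrow> \<alpha> \<le> A"
  proof -
    have "bounded K" using assms(2) by (rule compact_imp_bounded)
    then obtain A where "\<forall>x\<in>K. norm x \<le> A" by (auto simp: bounded_iff)
    then show ?thesis by (intro that[of A]) fastforce
  qed
  obtain B where B: "0 \<le> B" "\<And>\<theta>. \<theta> \<in> \<Theta> \<Longrightarrow> \<bar>\<theta>\<bar> \<le> B"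
  proof -
    obtain B where "\<forall>x\<in>\<Theta>. norm x \<le> B" using assms(6) by (auto simp: bounded_iff)
    then show ?thesis by (intro that[of "max 0 B"]) fastforce+
  qed
  obtain C where C: "0 \<le> C" "\<And>P x \<beta>. locally_finite P \<Longrightarrow> x \<notin> P \<Longrightarrow> \<beta> \<le> A \<Longrightarrow> \<forall>T\<in>del P. tame r \<beta> T
    \<Longrightarrow> \<forall>T\<in>new_triangles P x. tame r \<beta> T \<Longrightarrow> \<bar>perimeter_change P x\<bar> \<le> C"
  proof (rule perimeter_change_bounded[OF assms(1), of A], goal_cases)
    case (1 C)
    show ?case by (rule 1(1)[OF 1(2,3)])
  qed
  have S1: "\<forall>\<gamma>\<in>configurations. \<forall>\<alpha>\<in>K. \<forall>\<theta>\<in>\<Theta>. \<forall>\<theta>'\<in>\<Theta>. \<forall>\<Lambda>\<in>bounded_borel.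
        delaunay_energy r \<alpha> \<theta> \<Lambda> \<gamma> < \<infinity> \<longleftrightarrow> delaunay_energy r \<alpha> \<theta>' \<Lambda> \<gamma> < \<infinity>"
    unfolding delaunay_energy_finite_iff by blast
  have S2: "\<forall>\<gamma>\<in>configurations. \<forall>\<alpha>\<in>K. \<forall>\<alpha>'\<in>K. \<forall>\<theta>\<in>\<Theta>. \<forall>\<Lambda>\<in>bounded_borel. \<alpha> \<le> \<alpha>' \<longrightarrow>
        delaunay_energy r \<alpha> \<theta> \<Lambda> \<gamma> < \<infinity> \<longrightarrow> delaunay_energy r \<alpha>' \<theta> \<Lambda> \<gamma> < \<infinity>"
    unfolding delaunay_energy_finite_iff using tame_mono by blast
  have S3: "\<exists>R>0. \<forall>\<nu>. gibbs_measure (delaunay_energy r \<alpha>s \<theta>s) \<nu> \<and> stationary \<nu> \<longrightarrow>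
        measure \<nu> {\<gamma> \<in> space \<nu>. delaunay_energy r \<alpha> \<theta>s (ball 0 R) \<gamma> = \<infinity>} > 0"
    if "\<alpha> \<in> K" "\<alpha> < \<alpha>s" for \<alpha>
  \<comment> \<open>The same radius 1 serves every \<open>\<alpha>\<close>, as the large disc can be
    chosen to contain the origin.\<close>
  proof (intro exI[of _ 1] conjI allI impI)
    fix \<nu> assume "gibbs_measure (delaunay_energy r \<alpha>s \<theta>s) \<nu> \<and> stationary \<nu>"
    then have \<nu>: "gibbs_measure (delaunay_energy r \<alpha>s \<theta>s) \<nu>" "stationary \<nu>" by blast+
    have "0 < \<alpha>" using assms(3) that(1) by auto
    then show "measure \<nu> {\<gamma> \<in> space \<nu>. delaunay_energy r \<alpha> \<theta>s (ball 0 1) \<gamma> = \<infinity>} > 0"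
      using large_disc_positive[OF \<nu> assms(1) \<alpha>s _ that(2)] by blast
  qed simp
  have S4: "\<exists>\<alpha>. 0 < \<alpha> \<and> \<alpha> < \<alpha>' \<and> delaunay_energy r \<alpha> \<theta> \<Lambda> \<gamma> < \<infinity>"
    if "\<gamma> \<in> configurations" "\<Lambda> \<in> bounded_borel" "\<alpha>' \<in> K" "delaunay_energy r \<alpha>' \<theta> \<Lambda> \<gamma> < \<infinity>" for \<gamma> \<Lambda> \<alpha>' \<theta>
    using that assms(3) by (intro delaunay_energy_smaller_radius[of _ _ \<alpha>']) (auto simp: bounded_borel_def)
  have H3: "delaunay_local_energy r \<alpha> \<theta> x \<gamma> \<ge> ereal (- (B * C))"
    if "\<alpha> \<in> K" "\<theta> \<in> \<Theta>" "\<gamma> \<in> finite_energy (delaunay_energy r \<alpha> \<theta>)" "x \<notin> points \<gamma>" for \<alpha> \<theta> \<gamma> x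
  proof (cases "\<forall>T\<in>new_triangles (points \<gamma>) x. tame r \<alpha> T")
    case True
    have t: "\<gamma> \<in> configurations" "\<forall>T\<in>del (points \<gamma>). tame r \<alpha> T" using that(3) by (auto simp: finite_energy_iff)
    have D: "\<bar>perimeter_change (points \<gamma>) x\<bar> \<le> C"
      by (rule C(2)[OF locally_finite_points[OF t(1)] that(4) A[OF that(1)] t(2) True])
    have "\<bar>\<theta> * perimeter_change (points \<gamma>) x\<bar> \<le> B * C"
      unfolding abs_mult using B D that(2) by (intro mult_mono) auto
    then show ?thesis using True by (simp add: local_energy_finite_energy[OF that(3,4)] abs_le_iff)
  next
    case False
    then have "delaunay_local_energy r \<alpha> \<theta> x \<gamma> = \<infinity>"
      by (simp only: local_energy_finite_energy[OF that(3,4)] if_False)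
    then show ?thesis by simp
  qed
  \<comment> \<open>Here \<open>\<delta>\<close> is the absolute value and \<open>g\<close> the
    constant \<open>C\<close>. When the smaller parameter gives a finite local energy, both energies
    are multiples of the same \<open>D\<close>, by \<open>\<theta>\<close> and
    \<open>\<theta>'\<close>, and \<open>\<bar>D\<bar> \<le> C\<close>.\<close>
  have H6: "AE \<gamma> in \<mu>. \<gamma> \<in> finite_energy (delaunay_energy r \<alpha>s \<theta>s) \<longrightarrow>
          (\<forall>\<alpha>\<in>K. \<alpha> \<le> \<alpha>s \<longrightarrow> (\<forall>\<theta>\<in>\<Theta>. \<forall>\<theta>'\<in>\<Theta>.
            0 \<in> removable (delaunay_energy r \<alpha> \<theta>) (add_point \<gamma> 0) \<and>
            delaunay_local_energy r \<alpha> \<theta> 0 \<gamma> < \<infinity> \<longrightarrow>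
            \<bar>delaunay_local_energy r \<alpha> \<theta> 0 \<gamma> - delaunay_local_energy r \<alpha>s \<theta>' 0 \<gamma>\<bar>
              \<le> ereal (C * (\<bar>\<bar>\<alpha> - \<alpha>s\<bar>\<bar> + \<bar>\<bar>\<theta> - \<theta>'\<bar>\<bar>))))"
    using AE_origin_generic[OF G]
  proof eventually_elim
    case (elim \<gamma>)
    show ?case
    proof (intro impI ballI, elim conjE)
      fix \<alpha> \<theta> \<theta>'
      assume fe: "\<gamma> \<in> finite_energy (delaunay_energy r \<alpha>s \<theta>s)" and \<alpha>: "\<alpha> \<in> K" "\<alpha> \<le> \<alpha>s"
        and rem: "0 \<in> removable (delaunay_energy r \<alpha> \<theta>) (add_point \<gamma> 0)"
        and fin: "delaunay_local_energy r \<alpha> \<theta> 0 \<gamma> < \<infinity>"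
      have \<gamma>: "\<gamma> \<in> configurations" and t: "\<forall>T\<in>del (points \<gamma>). tame r \<alpha>s T" using fe by (auto simp: finite_energy_iff)
      have 0: "0 \<notin> points \<gamma>" using elim by blast
      have fe': "\<gamma> \<in> finite_energy (delaunay_energy r \<alpha>s \<theta>')" using fe finite_energy_parameter by blast
      obtain e where e: "0 < e" "ball 0 e \<in> admissible (delaunay_energy r \<alpha> \<theta>) 0 \<gamma>"
        using removable_imp_small_ball_admissible[OF fe 0 _ rem] elim by blast
      define D where "D = perimeter_change (points \<gamma>) 0"
      note le = delaunay_local_energy_eq[OF \<gamma> 0 e(2) order_refl e(1)]
      \<comment> \<open>Finiteness says that the new triangles are tame for \<open>\<alpha>\<close>;
        they remain so for \<open>\<alpha>s\<close>, which makes the second local energy finite as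
        well.\<close>
      have new: "\<forall>T\<in>new_triangles (points \<gamma>) 0. tame r \<alpha> T"
        using fin unfolding le by (rule contrapos_pp) simp
      have new': "\<forall>T\<in>new_triangles (points \<gamma>) 0. tame r \<alpha>s T" using new tame_mono[OF _ \<alpha>(2)] by blast
      have "\<bar>D\<bar> \<le> C" unfolding D_def
        by (rule C(2)[OF locally_finite_points[OF \<gamma>] 0 A[OF assms(7)] t new'])
      then have "\<bar>\<theta> - \<theta>'\<bar> * \<bar>D\<bar> \<le> \<bar>\<theta> - \<theta>'\<bar> * C" by (intro mult_left_mono) auto
      also have "\<dots> \<le> C * (\<bar>\<bar>\<alpha> - \<alpha>s\<bar>\<bar> + \<bar>\<bar>\<theta> - \<theta>'\<bar>\<bar>)" using C(1) by (simp add: algebra_simps)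
      finally have "\<bar>\<theta> * D - \<theta>' * D\<bar> \<le> C * (\<bar>\<bar>\<alpha> - \<alpha>s\<bar>\<bar> + \<bar>\<bar>\<theta> - \<theta>'\<bar>\<bar>)"
        by (simp add: left_diff_distrib[symmetric] abs_mult)
      moreover have "delaunay_local_energy r \<alpha> \<theta> 0 \<gamma> = ereal (\<theta> * D)" using new by (simp add: le D_def)
      moreover have "delaunay_local_energy r \<alpha>s \<theta>' 0 \<gamma> = ereal (\<theta>' * D)"
        using new' by (simp add: local_energy_finite_energy[OF fe' 0] D_def)
      ultimately show "\<bar>delaunay_local_energy r \<alpha> \<theta> 0 \<gamma> - delaunay_local_energy r \<alpha>s \<theta>' 0 \<gamma>\<bar>
              \<le> ereal (C * (\<bar>\<bar>\<alpha> - \<alpha>s\<bar>\<bar> + \<bar>\<bar>\<theta> - \<theta>'\<bar>\<bar>))" by simp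
    qed
  qed
  interpret \<mu>: prob_space \<mu> by (rule gibbs_space(1)[OF assms(9)])
  have abs0: "((\<lambda>x :: real. \<bar>x\<bar>) \<longlongrightarrow> 0) (nhds 0)"
    using tendsto_rabs[OF filterlim_ident[of "nhds (0 :: real)"]] by simp
  show ?thesis
  proof (intro conjI)
    show "\<forall>\<gamma>\<in>configurations. \<forall>\<alpha>\<in>K. \<forall>\<theta>\<in>\<Theta>. \<forall>\<theta>'\<in>\<Theta>. \<forall>\<Lambda>\<in>bounded_borel.
        delaunay_energy r \<alpha> \<theta> \<Lambda> \<gamma> < \<infinity> \<longleftrightarrow> delaunay_energy r \<alpha> \<theta>' \<Lambda> \<gamma> < \<infinity>"
      by (rule S1)
    show "\<forall>\<gamma>\<in>configurations. \<forall>\<alpha>\<in>K. \<forall>\<alpha>'\<in>K. \<forall>\<theta>\<in>\<Theta>. \<forall>\<Lambda>\<in>bounded_borel. \<alpha> \<le> \<alpha>' \<longrightarrow>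
        delaunay_energy r \<alpha> \<theta> \<Lambda> \<gamma> < \<infinity> \<longrightarrow> delaunay_energy r \<alpha>' \<theta> \<Lambda> \<gamma> < \<infinity>"
      by (rule S2)
    show "\<forall>\<alpha>\<in>K. \<alpha> < \<alpha>s \<longrightarrow> (\<exists>R>0. \<forall>\<nu>.
        gibbs_measure (delaunay_energy r \<alpha>s \<theta>s) \<nu> \<and> stationary \<nu> \<longrightarrow>
        measure \<nu> {\<gamma> \<in> space \<nu>. delaunay_energy r \<alpha> \<theta>s (ball 0 R) \<gamma> = \<infinity>} > 0)"
      by (intro ballI impI S3)
    show "\<forall>\<gamma>\<in>configurations. \<forall>\<Lambda>\<in>bounded_borel. \<forall>\<theta>\<in>\<Theta>. \<forall>\<alpha>'\<in>K.
        delaunay_energy r \<alpha>' \<theta> \<Lambda> \<gamma> < \<infinity> \<longrightarrow>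
        (\<exists>\<alpha>. 0 < \<alpha> \<and> \<alpha> < \<alpha>' \<and> delaunay_energy r \<alpha> \<theta> \<Lambda> \<gamma> < \<infinity>)"
      by (intro ballI impI S4)
    show "\<forall>\<alpha>\<in>K. \<forall>\<theta>\<in>\<Theta>. \<forall>x y. \<forall>\<gamma>\<in>configurations.
        x \<in> removable (delaunay_energy r \<alpha> \<theta>) (add_point \<gamma> x) \<longrightarrow>
        delaunay_local_energy r \<alpha> \<theta> (x + y) (translate \<gamma> y) = delaunay_local_energy r \<alpha> \<theta> x \<gamma>"
      by (intro ballI allI impI local_energy_translate)
    show "\<exists>C\<ge>0. \<forall>\<alpha>\<in>K. \<forall>\<theta>\<in>\<Theta>. \<forall>\<gamma>\<in>finite_energy (delaunay_energy r \<alpha> \<theta>). \<forall>x.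
        x \<notin> points \<gamma> \<longrightarrow> delaunay_local_energy r \<alpha> \<theta> x \<gamma> \<ge> ereal (- C)"
      using H3 B(1) C(1) by (intro exI[of _ "B * C"]) simp
    show "\<exists>(\<delta> :: real \<Rightarrow> real) (g :: (real^2) measure \<Rightarrow> real).
        (\<delta> \<longlongrightarrow> 0) (nhds 0) \<and> integrable \<mu> g \<and>
        (AE \<gamma> in \<mu>. \<gamma> \<in> finite_energy (delaunay_energy r \<alpha>s \<theta>s) \<longrightarrow>
          (\<forall>\<alpha>\<in>K. \<alpha> \<le> \<alpha>s \<longrightarrow> (\<forall>\<theta>\<in>\<Theta>. \<forall>\<theta>'\<in>\<Theta>.
            0 \<in> removable (delaunay_energy r \<alpha> \<theta>) (add_point \<gamma> 0) \<and>
            delaunay_local_energy r \<alpha> \<theta> 0 \<gamma> < \<infinity> \<longrightarrow>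
            \<bar>delaunay_local_energy r \<alpha> \<theta> 0 \<gamma> - delaunay_local_energy r \<alpha>s \<theta>' 0 \<gamma>\<bar>
              \<le> ereal (g \<gamma> * (\<delta> \<bar>\<alpha> - \<alpha>s\<bar> + \<delta> \<bar>\<theta> - \<theta>'\<bar>)))))"
      by (rule exI[of _ abs], rule exI[of _ "\<lambda>_. C"]) (intro conjI abs0 \<mu>.integrable_const H6)
    show "\<forall>\<theta>\<in>\<Theta>. in_L1 \<mu> (\<lambda>\<gamma>. delaunay_local_energy r \<alpha>s \<theta> 0 \<gamma>
        * ereal (boltzmann (delaunay_local_energy r \<alpha>s \<theta>s 0 \<gamma>)))"
      using local_energy_integrable[OF G] by blast
    show "\<forall>\<theta>\<in>\<Theta> - {\<theta>s}. measure (completion \<mu>) {\<gamma> \<in> space \<mu>.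
        delaunay_local_energy r \<alpha>s \<theta>s 0 \<gamma> \<noteq> delaunay_local_energy r \<alpha>s \<theta> 0 \<gamma>} > 0"
      using local_energies_differ[OF G] by blast
  qed
qed

end
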